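(* Consider the imperfect-acknowledgment optimal transmission problem $$\min_{\{\nu_k\}}\ \limsup_{T\to\infty}\frac1T\sum_{k=0}^{T-1}\mathbb{E}\big[\lambda\,\mathrm{Tr}\,P^{1,1}_{k+1}+(1-\lambda)J(\nu_k)\big],\qquad \mathbf P_{k+1}=\mathcal L(\mathbf P_k,\gamma_k,\nu_k),$$ where $P^{1,1}_{k}$ denotes the upper-left $n\times n$ block of $\mathbf P_k$, $\lambda\in[0,1]$, and the minimization is over policies in which $\nu_k\in\{0,1\}$ depends only on the imperfect acknowledgments $\hat\gamma_0,\dots,\hat\gamma_{k-1}$, on $\nu_0,\dots,\nu_{k-1}$ and on $P_{x_0}$. Then, independently of the initial estimation error covariance $P_{x_0}$, the value of this problem is a constant $\rho$ which, together with a function $V:\Pi\to\mathbb R$ (the relative value function), solves the average cost optimality (Bellman) equation $$\rho+V(\pi)=\min_{\nu\in\{0,1\}}\Big(\mathbb E\big[\lambda\,\mathrm{Tr}\,\mathcal L^{1,1}(\mathbf P,\gamma,\nu)+(1-\lambda)J(\nu)\,\big|\,\pi,\nu\big]+\mathbb E\big[V(\Phi(\pi,\hat\gamma,\nu))\,\big|\,\pi,\nu\big]\Big),\qquad \pi\in\Pi,$$ where in the first expectation $\mathbf P\sim\pi$ and $\gamma$ is an independent Bernoulli variable with $\mathbb P(\gamma=1)=1-p$, and in the second $\mathbb E[V(\Phi(\pi,\hat\gamma,\nu))|\pi,\nu]=\sum_{j\in\{0,1,2\}}\mathbb P(\hat\gamma=j)\,V(\Phi(\pi,j,\nu))$ with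 $\mathbb P(\hat\gamma=j)=\sum_{\gamma\in\{0,1\}}\mathbb P(\hat\gamma=j|\gamma)\mathbb P(\gamma)$.
   Context: Data. $A\in\mathbb R^{n\times n}$ is Schur stable, $C\in\mathbb R^{m\times n}$, $(A,C)$ is detectable, $\Sigma_w\ge0$, $\Sigma_v>0$ are noise covariances (of the process $x_{k+1}=Ax_k+w_k$ and measurement $y_k=Cx_k+v_k$). $P_s\ge0$ solves the algebraic Riccati equation $P_s=AP_sA^T+\Sigma_w-AP_sC^T(CP_sC^T+\Sigma_v)^{-1}CP_sA^T$; $K_f=P_sC^T(CP_sC^T+\Sigma_v)^{-1}$, $K_s=AK_f$; $\Sigma_s$ solves $\Sigma_s=A\Sigma_sA^T+K_s(CP_sC^T+\Sigma_v)K_s^T$. For given $\alpha_0,\alpha_1\ge0$ (chosen so that the two traces below agree), the quantization noise covariances are $\Sigma_q^x=\alpha_1\big(\Sigma_s+K_f(CP_sC^T+\Sigma_v)K_f^T\big)$ and $\Sigma_q^\epsilon=\alpha_0K_f(CP_sC^T+\Sigma_v)K_f^T$, with $\mathrm{Tr}\,\Sigma_q^x=\mathrm{Tr}\,\Sigma_q^\epsilon$. For $\nu\in\{0,1\}$ put $$\mathcal A=\begin{bmatrix} A & 0 \\ K_sC & A-K_sC \end{bmatrix},\quad \mathcal C(\nu)=[K_fC\ \ \nu I-K_fC],\quad Q=\begin{bmatrix} \Sigma_w & 0 \\ 0 & K_s\Sigma_vK_s^T \end{bmatrix},\quad S=\begin{bmatrix} 0 \\ K_s\Sigma_vK_f^T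 \end{bmatrix},$$ $R(\nu)=K_f\Sigma_vK_f^T+\nu^2\Sigma_q^x+(1-\nu)^2\Sigma_q^\epsilon$. The Riccati operator is $$\mathcal L(\mathbf P,\gamma,\nu)=\mathcal A\mathbf P\mathcal A^T+Q-\gamma[\mathcal A\mathbf P\mathcal C^T(\nu)+S][\mathcal C(\nu)\mathbf P\mathcal C^T(\nu)+R(\nu)]^{-1}[\mathcal A\mathbf P\mathcal C^T(\nu)+S]^T$$ (the inverse is assumed to exist), and $\mathcal L^{1,1}$ is its upper-left $n\times n$ block. Let $$\mathbb S=\left\{\begin{bmatrix} P & P-P_s \\ P-P_s & P-P_s \end{bmatrix}:P\ge P_s\right\},$$ which $\mathcal L(\cdot,\gamma,\nu)$ maps into itself; $\mathbf P_0\in\mathbb S$ is the element with upper-left block $P_{x_0}$. Channels. $\gamma_k\in\{0,1\}$ are i.i.d. with $\mathbb P(\gamma_k=1)=1-p$, $p\in[0,1]$. The sensor receives $\hat\gamma_k\in\{0,1,2\}$, the output of a discrete memoryless channel with input $\gamma_k$ and $\mathbb P(\hat\gamma=j-1|\gamma=i-1)=a_{ij}$, where $$(a_{ij})=\begin{bmatrix} (1-\delta)(1-\eta) & \delta(1-\eta) & \eta \\ \delta(1-\eta) & (1-\delta)(1-\eta) & \eta \end{bmatrix},\qquad \delta,\eta\in[0,1].$$ Cost. $J(\nu)=n_\nu E_b^\nu$ is the packet transmission energy, where $n_0\le n_1$ are bit rates and $0\le E_b^0\le E_b^1$ energies per bit; thus $J(0)\le J(1)$ are given nonnegative constants. Information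 state. $\Pi$ is the space of probability densities on $\mathbb S$ (densities understood in the generalized sense, so Dirac masses are allowed). For $\pi\in\Pi$, $\hat\gamma\in\{0,1,2\}$ (with $\mathbb P(\hat\gamma)>0$), $\nu\in\{0,1\}$, the information-state update is $$\Phi(\pi,\hat\gamma,\nu)(\mathbf P_+)=\sum_{\gamma\in\{0,1\}}\Big[\int_{\mathbb S}\mathbb P(\mathbf P_+|\mathbf P,\gamma,\nu)\,\pi(\mathbf P)\,d\mathbf P\Big]\frac{\mathbb P(\hat\gamma|\gamma)\mathbb P(\gamma)}{\sum_{\gamma'\in\{0,1\}}\mathbb P(\hat\gamma|\gamma')\mathbb P(\gamma')},$$ where $\mathbb P(\cdot|\mathbf P,\gamma,\nu)$ is the Dirac mass at $\mathcal L(\mathbf P,\gamma,\nu)$.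
   Formalization: The Bellman equation is asserted only at those π in Π for which the expected stage cost is finite for at least one ν; at all other π (infinite mean covariance) its right-hand side is +∞, so no real ρ and V(π) could satisfy it. *)

theory Defs
  imports "HOL-Probability.Probability"
begin

section \<open>Matrices\<close>

definition psd :: "real^'n^'n \<Rightarrow> bool" where
  "psd X \<longleftrightarrow> transpose X = X \<and> (\<forall>x. 0 \<le> x \<bullet> (X *v x))"

definition pos_def :: "real^'n^'n \<Rightarrow> bool" where
  "pos_def X \<longleftrightarrow> transpose X = X \<and> (\<forall>x. x \<noteq> 0 \<longrightarrow> 0 < x \<bullet> (X *v x))"

definition schur_stable :: "real^'n^'n \<Rightarrow> bool" where
  "schur_stable A \<longleftrightarrow>
     (\<forall>z::complex. (\<exists>v::complex^'n. v \<noteq> 0 \<and> map_matrix complex_of_real A *v v = z *s v) \<longrightarrow> cmod z < 1)"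

definition detectable :: "real^'n^'n \<Rightarrow> real^'n^'m \<Rightarrow> bool" where
  "detectable A C \<longleftrightarrow> (\<exists>L :: real^'m^'n. schur_stable (A - L ** C))"

definition block_row :: "real^'a^'r \<Rightarrow> real^'b^'r \<Rightarrow> real^('a::finite + 'b::finite)^'r" where
  "block_row X Y = (\<chi> i j. case j of Inl k \<Rightarrow> X $ i $ k | Inr k \<Rightarrow> Y $ i $ k)"

definition block_col :: "real^'c^'a \<Rightarrow> real^'c^'b \<Rightarrow> real^'c^('a + 'b)" where
  "block_col X Y = (\<chi> i. case i of Inl k \<Rightarrow> X $ k | Inr k \<Rightarrow> Y $ k)"

definition block_mat ::
  "real^'a^'c \<Rightarrow> real^'b^'c \<Rightarrow> real^'a^'d \<Rightarrow> real^'b^'d \<Rightarrow> real^('a::finite + 'b::finite)^('c::finite + 'd::finite)" where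
  "block_mat X Y Z W = block_col (block_row X Y) (block_row Z W)"

definition upper_left :: "real^('a::finite + 'b::finite)^('c::finite + 'd::finite) \<Rightarrow> real^'a^'c" where
  "upper_left X = (\<chi> i j. X $ Inl i $ Inl j)"

section \<open>The Riccati operator\<close>

definition innov_cov :: "real^'n^'m \<Rightarrow> real^'m^'m \<Rightarrow> real^'n^'n \<Rightarrow> real^'m^'m" where
  "innov_cov C Sigma_v P_s = C ** P_s ** transpose C + Sigma_v"

definition calA :: "real^'n^'n \<Rightarrow> real^'n^'m \<Rightarrow> real^'m^'n \<Rightarrow> real^('n + 'n)^('n + 'n)" where
  "calA A C K_s = block_mat A 0 (K_s ** C) (A - K_s ** C)"

definition calC :: "real^'n^'m \<Rightarrow> real^'m^'n \<Rightarrow> nat \<Rightarrow> real^('n + 'n)^'n" where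
  "calC C K_f \<nu> = block_row (K_f ** C) (real \<nu> *\<^sub>R mat 1 - K_f ** C)"

definition noiseQ :: "real^'n^'n \<Rightarrow> real^'m^'m \<Rightarrow> real^'m^'n \<Rightarrow> real^('n + 'n)^('n + 'n)" where
  "noiseQ Sigma_w Sigma_v K_s = block_mat Sigma_w 0 0 (K_s ** Sigma_v ** transpose K_s)"

definition noiseS :: "real^'m^'m \<Rightarrow> real^'m^'n \<Rightarrow> real^'m^'n \<Rightarrow> real^'n^('n + 'n)" where
  "noiseS Sigma_v K_f K_s = block_col 0 (K_s ** Sigma_v ** transpose K_f)"

definition noiseR ::
  "real^'m^'m \<Rightarrow> real^'m^'n \<Rightarrow> real^'n^'n \<Rightarrow> real^'n^'n \<Rightarrow> nat \<Rightarrow> real^'n^'n" where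
  "noiseR Sigma_v K_f Sigma_qx Sigma_qe \<nu> =
     K_f ** Sigma_v ** transpose K_f + (real \<nu>)\<^sup>2 *\<^sub>R Sigma_qx + (1 - real \<nu>)\<^sup>2 *\<^sub>R Sigma_qe"

definition riccati ::
  "real^'b^'b \<Rightarrow> (nat \<Rightarrow> real^'b^'n) \<Rightarrow> real^'b^'b \<Rightarrow> real^'n^'b \<Rightarrow> (nat \<Rightarrow> real^'n^'n) \<Rightarrow>
   real^'b^'b \<Rightarrow> nat \<Rightarrow> nat \<Rightarrow> real^'b^'b" where
  "riccati AA CC Q S R P \<gamma> \<nu> =
     AA ** P ** transpose AA + Q
     - real \<gamma> *\<^sub>R ((AA ** P ** transpose (CC \<nu>) + S)
         ** matrix_inv (CC \<nu> ** P ** transpose (CC \<nu>) + R \<nu>)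
         ** transpose (AA ** P ** transpose (CC \<nu>) + S))"

definition lift_cov :: "real^'n^'n \<Rightarrow> real^'n^'n \<Rightarrow> real^('n + 'n)^('n + 'n)" where
  "lift_cov P_s P = block_mat P (P - P_s) (P - P_s) (P - P_s)"

definition cov_set :: "real^'n^'n \<Rightarrow> (real^('n + 'n)^('n + 'n)) set" where
  "cov_set P_s = {lift_cov P_s P | P. psd (P - P_s)}"

section \<open>Channels\<close>

definition loss_prob :: "real \<Rightarrow> nat \<Rightarrow> real" where
  "loss_prob p \<gamma> = (if \<gamma> = 1 then 1 - p else if \<gamma> = 0 then p else 0)"

definition ack_mat :: "real \<Rightarrow> real \<Rightarrow> nat \<Rightarrow> nat \<Rightarrow> real" where
  "ack_mat \<delta> \<eta> \<gamma> j =
     [[(1 - \<delta>) * (1 - \<eta>), \<delta> * (1 - \<eta>), \<eta>],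
      [\<delta> * (1 - \<eta>), (1 - \<delta>) * (1 - \<eta>), \<eta>]] ! \<gamma> ! j"

definition ack_prob :: "real \<Rightarrow> real \<Rightarrow> real \<Rightarrow> nat \<Rightarrow> real" where
  "ack_prob p \<delta> \<eta> j = (\<Sum>\<gamma>\<in>{0,1}. ack_mat \<delta> \<eta> \<gamma> j * loss_prob p \<gamma>)"

definition iid_losses :: "'w measure \<Rightarrow> real \<Rightarrow> (nat \<Rightarrow> 'w \<Rightarrow> nat) \<Rightarrow> bool" where
  "iid_losses M p gam \<longleftrightarrow>
     prob_space.indep_vars M (\<lambda>_. count_space UNIV) gam UNIV \<and>
     (\<forall>k. \<forall>\<omega>\<in>space M. gam k \<omega> \<in> {0, 1}) \<and>
     (\<forall>k. measure M {\<omega>\<in>space M. gam k \<omega> = 1} = 1 - p)"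

text \<open>Discrete memoryless channel, used without feedback: given the inputs up to any time, the
  outputs are conditionally independent and each depends on its own input only.\<close>

definition memoryless_acks ::
  "'w measure \<Rightarrow> real \<Rightarrow> real \<Rightarrow> (nat \<Rightarrow> 'w \<Rightarrow> nat) \<Rightarrow> (nat \<Rightarrow> 'w \<Rightarrow> nat) \<Rightarrow> bool" where
  "memoryless_acks M \<delta> \<eta> gam ghat \<longleftrightarrow>
     (\<forall>k. ghat k \<in> measurable M (count_space UNIV)) \<and>
     (\<forall>k. \<forall>\<omega>\<in>space M. ghat k \<omega> \<in> {0, 1, 2}) \<and>
     (\<forall>N g h. (\<forall>k<N. g k \<in> {0, 1} \<and> h k \<in> {0, 1, 2}) \<longrightarrow>
        measure M {\<omega>\<in>space M. \<forall>k<N. gam k \<omega> = g k \<and> ghat k \<omega> = h k} =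
        measure M {\<omega>\<in>space M. \<forall>k<N. gam k \<omega> = g k} * (\<Prod>k<N. ack_mat \<delta> \<eta> (g k) (h k)))"

section \<open>The transmission problem\<close>

text \<open>A policy maps the acknowledgments received so far, the past decisions (both in
  chronological order) and the initial covariance to the next decision.\<close>

type_synonym 'n policy = "nat list \<Rightarrow> nat list \<Rightarrow> real^'n^'n \<Rightarrow> nat"

definition policies :: "('n::finite) policy set" where
  "policies = {g. \<forall>acks nus P. g acks nus P \<in> {0, 1}}"

primrec decisions :: "('n::finite) policy \<Rightarrow> real^'n^'n \<Rightarrow> (nat \<Rightarrow> nat) \<Rightarrow> nat \<Rightarrow> nat list" where
  "decisions g Px0 h 0 = []"
| "decisions g Px0 h (Suc k) =
     decisions g Px0 h k @ [g (map h [0..<k]) (decisions g Px0 h k) Px0]"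

definition decision :: "('n::finite) policy \<Rightarrow> real^'n^'n \<Rightarrow> (nat \<Rightarrow> nat) \<Rightarrow> nat \<Rightarrow> nat" where
  "decision g Px0 h k = g (map h [0..<k]) (decisions g Px0 h k) Px0"

primrec trajectory ::
  "('s \<Rightarrow> nat \<Rightarrow> nat \<Rightarrow> 's) \<Rightarrow> 's \<Rightarrow> (nat \<Rightarrow> nat) \<Rightarrow> (nat \<Rightarrow> nat) \<Rightarrow> nat \<Rightarrow> 's" where
  "trajectory L P0 gs ns 0 = P0"
| "trajectory L P0 gs ns (Suc k) = L (trajectory L P0 gs ns k) (gs k) (ns k)"

definition average_cost ::
  "'w measure \<Rightarrow> (nat \<Rightarrow> 'w \<Rightarrow> nat) \<Rightarrow> (nat \<Rightarrow> 'w \<Rightarrow> nat) \<Rightarrow>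
   (real^('n + 'n)^('n + 'n) \<Rightarrow> nat \<Rightarrow> nat \<Rightarrow> real^('n + 'n)^('n + 'n)) \<Rightarrow> real^'n^'n \<Rightarrow>
   real \<Rightarrow> (nat \<Rightarrow> real) \<Rightarrow> ('n::finite) policy \<Rightarrow> real^'n^'n \<Rightarrow> ereal" where
  "average_cost M gam ghat L P_s lam J g Px0 =
     limsup (\<lambda>T. ereal (1 / real T * (\<Sum>k<T. integral\<^sup>L M (\<lambda>\<omega>.
       let ns = decision g Px0 (\<lambda>i. ghat i \<omega>);
           P = trajectory L (lift_cov P_s Px0) (\<lambda>i. gam i \<omega>) ns
       in lam * trace (upper_left (P (Suc k))) + (1 - lam) * J (ns k)))))"

section \<open>Information states\<close>

definition cov_space :: "real^'n^'n \<Rightarrow> (real^('n + 'n)^('n + 'n)) measure" where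
  "cov_space P_s = restrict_space borel (cov_set P_s)"

definition info_states :: "real^'n^'n \<Rightarrow> (real^('n + 'n)^('n + 'n)) measure set" where
  "info_states P_s = space (prob_algebra (cov_space P_s))"

definition info_update ::
  "'s measure \<Rightarrow> ('s \<Rightarrow> nat \<Rightarrow> nat \<Rightarrow> 's) \<Rightarrow> real \<Rightarrow> real \<Rightarrow> real \<Rightarrow>
   's measure \<Rightarrow> nat \<Rightarrow> nat \<Rightarrow> 's measure" where
  "info_update SS L p \<delta> \<eta> \<pi> j \<nu> = measure_of (space SS) (sets SS)
     (\<lambda>B. \<Sum>\<gamma>\<in>{0,1}. (\<integral>\<^sup>+P. emeasure (return SS (L P \<gamma> \<nu>)) B \<partial>\<pi>)
        * ennreal (ack_mat \<delta> \<eta> \<gamma> j * loss_prob p \<gamma>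
                   / (\<Sum>\<gamma>'\<in>{0,1}. ack_mat \<delta> \<eta> \<gamma>' j * loss_prob p \<gamma>')))"

text \<open>The mean stage cost at an information state. It is taken in the extended nonnegative reals,
  since an information state need not have a finite first moment; on \<^const>\<open>cov_set\<close> the
  integrand is nonnegative. Where it is infinite for both decisions, the right-hand side of
  the Bellman equation is infinite, so no real-valued function can satisfy the equation there.\<close>

definition stage_cost ::
  "(real^('n::finite + 'n)^('n::finite + 'n) \<Rightarrow> nat \<Rightarrow> nat \<Rightarrow> real^('n::finite + 'n)^('n::finite + 'n)) \<Rightarrow>
   real \<Rightarrow> real \<Rightarrow> (nat \<Rightarrow> real) \<Rightarrow> (real^('n::finite + 'n)^('n::finite + 'n)) measure \<Rightarrow> nat \<Rightarrow> ennreal" where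
  "stage_cost L p lam J \<pi> \<nu> = (\<Sum>\<gamma>\<in>{0,1}. ennreal (loss_prob p \<gamma>) *
     (\<integral>\<^sup>+P. ennreal (lam * trace (upper_left (L P \<gamma> \<nu>)) + (1 - lam) * J \<nu>) \<partial>\<pi>))"

end

theory Submission
  imports Defs "HOL-Computational_Algebra.Fundamental_Theorem_Algebra"
begin

text \<open>Write \<open>D = P - P_s\<close> for the covariance that the receiver has in excess of the sensor's Kalman
  filter, and \<open>Z = K_f W K_f\<^sup>T\<close> with \<open>W\<close> the innovation covariance. On the joint covariances the
  Riccati operator collapses to an \<open>n \<times> n\<close> recursion for \<open>D\<close> (\<open>riccati_lift\<close>): with
  \<open>T = Z + \<nu> D\<close> and noise covariance \<open>N\<close>, the new \<open>D\<close> is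
  \<open>A (Z + D - \<gamma> T (T + N)\<inverse> T) A\<^sup>T\<close>. The recursion is affine in \<open>D\<close>, except for \<open>\<gamma> = \<nu> = 1\<close>, when it is
  \<open>A (T : N) A\<^sup>T\<close> with the parallel sum \<open>T : N\<close>.

  The point of the argument is that all these maps contract with respect to one and the same order unit. Put
  \<open>X = \<Sigma>\<^sub>s + Z\<close>. The equation for \<open>\<Sigma>\<^sub>s\<close> becomes \<open>X = A X A\<^sup>T + Z\<close>, so that \<open>A X A\<^sup>T \<le> r X\<close> for some
  \<open>r < 1\<close>, and the quantization noise for \<open>\<nu> = 1\<close> is exactly \<open>\<alpha>\<^sub>1 X\<close>. The parallel sum with a multiple of
  \<open>X\<close> does not expand an excess bounded by \<open>t X\<close> (\<open>psd_par_sum_nonexpansive\<close>). Hence, if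
  \<open>D \<le> D' \<le> D + t X\<close>, then after one step, whatever the loss and the decision, the same holds with
  \<open>r t\<close> in place of \<open>t\<close> (\<open>close_step\<close>): the influence of the initial covariance on the cost decays
  geometrically, uniformly over policies.

  This gives the average cost theory by vanishing discount. The discounted values, taken relative
  to the value at \<open>D = 0\<close>, are bounded by a multiple of the first moment of the information state,
  uniformly in the discount (\<open>disc_value_near_base\<close>), so by Tychonoff's theorem they
  have a cluster function, and the discounted Bellman equations pass to the limit
  (\<open>bellman_finite_moment\<close>). A policy is treated as a tree, a function from
  acknowledgment histories to decisions, which makes discounted dynamic programming a
  statement about infima over trees and avoids any measurability of value functions. The verification
  argument (\<open>total_cost_lower\<close>, \<open>total_cost_upper\<close>) turns the Bellman equation into the optimality of
  \<open>\<rho>\<close>; a path expansion (\<open>expected_stage_cost\<close>) identifies expectations over the losses and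
  acknowledgments with the recursively defined stage costs.\<close>

section \<open>Orbits of Schur stable matrices\<close>

lemma perturbed_contraction_tendsto_zero:
  fixes a b :: "nat \<Rightarrow> real"
  assumes a: "\<And>k. 0 \<le> a k" and rec: "\<And>k. a (Suc k) \<le> q * a k + b k"
    and q: "0 \<le> q" "q < 1" and b: "b \<longlonglongrightarrow> 0"
  shows "a \<longlonglongrightarrow> 0"
proof (rule LIMSEQ_I)
  fix e :: real assume e: "0 < e"
  have "eventually (\<lambda>k. b k < e / 2 * (1 - q)) sequentially"
    using b e q by (intro order_tendstoD) auto
  then obtain N where N: "\<And>k. N \<le> k \<Longrightarrow> b k < e / 2 * (1 - q)"
    unfolding eventually_sequentially by blast
  have bound: "a (N + m) \<le> q ^ m * a N + e / 2" for m
  proof (induction m)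
    case (Suc m)
    have "a (N + Suc m) \<le> q * a (N + m) + b (N + m)" using rec by simp
    also have "\<dots> \<le> q * (q ^ m * a N + e / 2) + e / 2 * (1 - q)"
      using Suc N [of "N + m"] q by (intro add_mono mult_left_mono) auto
    also have "\<dots> = q ^ Suc m * a N + e / 2" by (simp add: field_simps)
    finally show ?case .
  qed (use e in simp)
  have "(\<lambda>m. q ^ m * a N) \<longlonglongrightarrow> 0"
    using tendsto_mult_left_zero [OF LIMSEQ_power_zero [of q]] q by auto
  then have "eventually (\<lambda>m. q ^ m * a N < e / 2) sequentially"
    using e by (intro order_tendstoD) auto
  then obtain M where M: "\<And>m. M \<le> m \<Longrightarrow> q ^ m * a N < e / 2"
    unfolding eventually_sequentially by blast
  have "norm (a k - 0) < e" if k: "N + M \<le> k" for k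
  proof -
    have "M \<le> k - N" "N + (k - N) = k" using k by simp_all
    then show ?thesis using bound [of "k - N"] M [of "k - N"] a [of k] by simp
  qed
  then show "\<exists>no. \<forall>k\<ge>no. norm (a k - 0) < e" by blast
qed

lemma matrix_vector_mult_smult:
  fixes A :: "'a::comm_ring_1^'n^'m"
  shows "A *v (c *s x) = c *s (A *v x)"
  by (simp add: vec_eq_iff matrix_vector_mult_def sum_distrib_left mult.left_commute)

lemma mat_vector_mult: "mat z *v x = z *s (x :: 'a::comm_ring_1^'n)"
  by (simp add: vec_eq_iff matrix_vector_mult_def mat_def if_distrib [of "\<lambda>a. a * _"] cong: if_cong)

lemma matrix_orbit_diff:
  fixes A :: "'a::comm_ring_1^'n^'n"
  shows "((*v) A ^^ k) (x - y) = ((*v) A ^^ k) x - ((*v) A ^^ k) y"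
  by (induction k) (simp_all add: matrix_vector_mult_diff_distrib)

lemma matrix_orbit_scale:
  fixes A :: "'a::comm_ring_1^'n^'n"
  shows "((*v) A ^^ k) (c *s x) = c *s ((*v) A ^^ k) x"
  by (induction k) (simp_all add: matrix_vector_mult_smult)

lemma norm_vector_scalar_mult: "norm (c *s x) = cmod c * norm (x :: complex^'n)"
  by (simp add: norm_vec_def norm_mult L2_set_right_distrib [symmetric])

text \<open>If \<open>z\<close> lies in the open unit disc, the orbit of \<open>v\<close> obeys a contracting recursion driven by
  the orbit of \<open>(A - z) v\<close>. Otherwise \<open>z\<close> is not an eigenvalue, and the orbit of \<open>v\<close> is recovered by
  the inverse of \<open>A - z\<close>. So convergence for \<open>(A - z) v\<close> gives convergence for \<open>v\<close>, for every \<open>z\<close>.\<close>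

lemma matrix_orbit_tendsto_zero_shift:
  fixes A :: "complex^'n^'n"
  assumes ev: "\<And>z v. v \<noteq> 0 \<Longrightarrow> A *v v = z *s v \<Longrightarrow> cmod z < 1"
    and u: "(\<lambda>k. ((*v) A ^^ k) (A *v v - z *s v)) \<longlonglongrightarrow> 0"
  shows "(\<lambda>k. ((*v) A ^^ k) v) \<longlonglongrightarrow> 0"
proof -
  let ?y = "\<lambda>k. ((*v) A ^^ k) v"
  have u_eq: "((*v) A ^^ k) (A *v v - z *s v) = ?y (Suc k) - z *s ?y k" for k
    by (simp add: matrix_orbit_diff matrix_orbit_scale funpow_swap1)
  show ?thesis
  proof (cases "cmod z < 1")
    case True
    have "norm (?y (Suc k)) \<le> cmod z * norm (?y k) + norm (?y (Suc k) - z *s ?y k)" for k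
      using norm_triangle_sub [of "?y (Suc k)" "z *s ?y k"] by (simp add: norm_vector_scalar_mult)
    moreover have "(\<lambda>k. norm (?y (Suc k) - z *s ?y k)) \<longlonglongrightarrow> 0"
      using tendsto_norm_zero [OF u] unfolding u_eq .
    ultimately have "(\<lambda>k. norm (?y k)) \<longlonglongrightarrow> 0"
      by (rule perturbed_contraction_tendsto_zero [OF norm_ge_zero _ norm_ge_zero True])
    then show ?thesis by (rule tendsto_norm_zero_cancel)
  next
    case False
    let ?S = "A - mat z"
    have S: "?S *v x = A *v x - z *s x" for x
      by (simp only: matrix_vector_mult_diff_rdistrib mat_vector_mult)
    have "inj ((*v) ?S)"
    proof (rule injI)
      fix x y assume "?S *v x = ?S *v y"
      then have "?S *v (x - y) = 0" by (simp add: matrix_vector_mult_diff_distrib)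
      then have "A *v (x - y) = z *s (x - y)" unfolding S by simp
      then show "x = y" using ev [of "x - y" z] False by auto
    qed
    then obtain B where B: "B ** ?S = mat 1"
      using matrix_left_invertible_injective by blast
    have "?y k = B *v (((*v) A ^^ k) (A *v v - z *s v))" for k
    proof -
      have "((*v) A ^^ k) (A *v v - z *s v) = ?S *v ?y k"
        unfolding u_eq S by simp
      then show ?thesis
        by (simp only: matrix_vector_mul_assoc B matrix_vector_mul_lid)
    qed
    moreover have "(\<lambda>k. B *v (((*v) A ^^ k) (A *v v - z *s v))) \<longlonglongrightarrow> B *v 0"
    proof (rule vec_tendstoI)
      fix i
      have "(\<lambda>k. \<Sum>j\<in>UNIV. B $ i $ j * ((*v) A ^^ k) (A *v v - z *s v) $ j) \<longlonglongrightarrow> (\<Sum>j\<in>UNIV. B $ i $ j * 0 $ j)"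
        by (intro tendsto_sum tendsto_mult tendsto_const tendsto_vec_nth u)
      then show "(\<lambda>k. (B *v (((*v) A ^^ k) (A *v v - z *s v))) $ i) \<longlonglongrightarrow> (B *v 0) $ i"
        by (simp add: matrix_vector_mult_def)
    qed
    ultimately show ?thesis by simp
  qed
qed

text \<open>Splitting off one root at a time reduces the annihilating polynomial to a constant.
  A repeated root is just split off repeatedly, so no Jordan form enters.\<close>

lemma annihilated_orbit_tendsto_zero:
  fixes A :: "complex^'n^'n"
  assumes ev: "\<And>z v. v \<noteq> 0 \<Longrightarrow> A *v v = z *s v \<Longrightarrow> cmod z < 1"
  shows "f \<noteq> 0 \<Longrightarrow> degree f = d \<Longrightarrow> (\<Sum>i\<le>d. coeff f i *s ((*v) A ^^ i) v) = 0 \<Longrightarrow>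
    (\<lambda>k. ((*v) A ^^ k) v) \<longlonglongrightarrow> 0"
proof (induction d arbitrary: f v)
  case 0
  then have "coeff f 0 \<noteq> 0" by (metis leading_coeff_neq_0)
  then have v: "v = 0" using 0 by simp
  have "((*v) A ^^ k) 0 = 0" for k by (induction k) simp_all
  then show ?case unfolding v by simp
next
  case (Suc d)
  have "\<not> constant (poly f)"
    using Suc.prems(2) by (simp add: constant_degree)
  then obtain z where "poly f z = 0"
    using fundamental_theorem_of_algebra by blast
  then obtain g where f: "f = [:-z, 1:] * g"
    by (metis dvdE poly_eq_0_iff_dvd)
  have g: "g \<noteq> 0" using Suc.prems(1) f by auto
  then have "degree f = Suc (degree g)"
    unfolding f by (subst degree_mult_eq) auto
  then have d: "degree g = d"
    using Suc.prems(2) by simp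
  let ?y = "\<lambda>k. ((*v) A ^^ k) v"
  have c: "coeff f (Suc i) = coeff g i - z * coeff g (Suc i)" "coeff f 0 = - z * coeff g 0" for i
    unfolding f by simp_all
  have gd: "coeff g (Suc d) = 0" using d by (simp add: coeff_eq_0)
  have "(\<Sum>i\<le>d. coeff g i *s ((*v) A ^^ i) (A *v v - z *s v)) =
      (\<Sum>i\<le>d. coeff g i *s ?y (Suc i)) - (\<Sum>i\<le>d. (z * coeff g i) *s ?y i)"
    unfolding sum_subtractf [symmetric]
    by (intro sum.cong refl)
      (simp add: matrix_orbit_diff matrix_orbit_scale funpow_swap1 vec_eq_iff algebra_simps)
  also have "(\<Sum>i\<le>d. (z * coeff g i) *s ?y i) = (\<Sum>i\<le>Suc d. (z * coeff g i) *s ?y i)"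
    using gd by simp
  also have "\<dots> = (z * coeff g 0) *s ?y 0 + (\<Sum>i\<le>d. (z * coeff g (Suc i)) *s ?y (Suc i))"
    by (rule sum.atMost_Suc_shift)
  also have "(\<Sum>i\<le>d. coeff g i *s ?y (Suc i)) - ((z * coeff g 0) *s ?y 0 + (\<Sum>i\<le>d. (z * coeff g (Suc i)) *s ?y (Suc i)))
      = coeff f 0 *s ?y 0 + (\<Sum>i\<le>d. coeff f (Suc i) *s ?y (Suc i))"
    unfolding c vector_sub_rdistrib sum_subtractf by (simp add: vec_eq_iff)
  also have "\<dots> = (\<Sum>i\<le>Suc d. coeff f i *s ?y i)"
    by (rule sum.atMost_Suc_shift [symmetric])
  finally have "(\<Sum>i\<le>d. coeff g i *s ((*v) A ^^ i) (A *v v - z *s v)) = 0"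
    using Suc.prems(3) by simp
  from matrix_orbit_tendsto_zero_shift [OF ev Suc.IH [OF g d this]] show ?case .
qed

text \<open>The first \<open>n + 1\<close> points of an orbit are linearly dependent.\<close>

lemma orbit_annihilator:
  fixes A :: "complex^'n^'n"
  shows "\<exists>f. f \<noteq> 0 \<and> (\<Sum>i\<le>degree f. coeff f i *s ((*v) A ^^ i) v) = 0"
proof -
  let ?y = "\<lambda>k. ((*v) A ^^ k) v"
  let ?I = "{..CARD('n)}"
  have "\<exists>c. (\<exists>i\<in>?I. c i \<noteq> 0) \<and> (\<Sum>i\<in>?I. c i *s ?y i) = 0"
  proof (cases "inj_on ?y ?I")
    case True
    have "vec.dependent (?y ` ?I)"
    proof (rule ccontr)
      assume "\<not> ?thesis"
      then have "card (?y ` ?I) \<le> vec.dim (?y ` ?I)"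
        using vec.dim_eq_card_independent by fastforce
      also have "\<dots> \<le> CARD('n)" by (rule dim_subset_UNIV_cart_gen)
      finally show False using card_image [OF True] by simp
    qed
    then obtain w where w: "\<exists>x\<in>?y ` ?I. w x \<noteq> 0" "(\<Sum>x\<in>?y ` ?I. w x *s x) = 0"
      using vec.dependent_finite [of "?y ` ?I"] by auto
    show ?thesis
      using w sum.reindex [OF True, of "\<lambda>x. w x *s x"] by (intro exI [of _ "\<lambda>i. w (?y i)"]) auto
  next
    case False
    then obtain i j where ij: "i \<in> ?I" "j \<in> ?I" "i \<noteq> j" "?y i = ?y j"
      unfolding inj_on_def by blast
    let ?c = "\<lambda>k. (if k = i then 1 else 0) - (if k = j then 1 else 0 :: complex)"
    have "(\<Sum>k\<in>?I. ?c k *s ?y k) = (\<Sum>k\<in>?I. if k = i then ?y k else 0) - (\<Sum>k\<in>?I. if k = j then ?y k else 0)"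
      unfolding sum_subtractf [symmetric] by (intro sum.cong refl) (simp add: vec_eq_iff)
    also have "\<dots> = 0" using ij by simp
    finally show ?thesis using ij by (intro exI [of _ ?c]) auto
  qed
  then obtain c i where c: "i \<in> ?I" "c i \<noteq> 0" "(\<Sum>i\<in>?I. c i *s ?y i) = 0" by blast
  define f where "f = (\<Sum>i\<in>?I. monom (c i) i)"
  have coeff: "coeff f k = (if k \<in> ?I then c k else 0)" for k
    unfolding f_def by (simp add: coeff_sum)
  have "f \<noteq> 0" using coeff [of i] c by auto
  moreover have "degree f \<le> CARD('n)"
    by (rule degree_le) (simp add: coeff)
  then have "(\<Sum>i\<le>degree f. coeff f i *s ?y i) = (\<Sum>i\<in>?I. coeff f i *s ?y i)"
    by (intro sum.mono_neutral_left) (auto simp: coeff_eq_0)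
  then have "(\<Sum>i\<le>degree f. coeff f i *s ?y i) = 0"
    using c(3) coeff by simp
  ultimately show ?thesis by blast
qed

lemma schur_stable_orbit:
  fixes A :: "real^'n^'n"
  assumes "schur_stable A"
  shows "(\<lambda>k. ((*v) A ^^ k) x) \<longlonglongrightarrow> 0"
proof (rule vec_tendstoI)
  fix i
  let ?A = "map_matrix complex_of_real A"
  let ?c = "\<lambda>x :: real^'n. (\<chi> i. complex_of_real (x $ i))"
  have mult: "?A *v ?c y = ?c (A *v y)" for y
    by (simp add: vec_eq_iff matrix_vector_mult_def map_matrix_def)
  have orbit: "((*v) ?A ^^ k) (?c x) = ?c (((*v) A ^^ k) x)" for k
    by (induction k) (simp_all add: mult)
  have ev: "cmod z < 1" if "v \<noteq> 0" "?A *v v = z *s v" for z v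
    using assms that unfolding schur_stable_def by blast
  obtain f where f: "f \<noteq> 0" "(\<Sum>i\<le>degree f. coeff f i *s ((*v) ?A ^^ i) (?c x)) = 0"
    using orbit_annihilator by blast
  have "(\<lambda>k. ((*v) ?A ^^ k) (?c x)) \<longlonglongrightarrow> 0"
    by (rule annihilated_orbit_tendsto_zero [OF ev f(1) refl f(2)])
  from tendsto_vec_nth [OF this, of i] have "(\<lambda>k. complex_of_real (((*v) A ^^ k) x $ i)) \<longlonglongrightarrow> 0"
    unfolding orbit by simp
  then show "(\<lambda>k. ((*v) A ^^ k) x $ i) \<longlonglongrightarrow> 0 $ i"
    by (auto dest: tendsto_Re)
qed

lemma transpose_orbit_dot:
  fixes A :: "real^'n^'n"
  shows "((*v) (transpose A) ^^ k) x \<bullet> y = x \<bullet> ((*v) A ^^ k) y"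
proof (induction k arbitrary: x)
  case (Suc k)
  have "((*v) (transpose A) ^^ Suc k) x \<bullet> y = ((*v) (transpose A) ^^ k) (transpose A *v x) \<bullet> y"
    by (simp only: funpow_Suc_right comp_apply)
  also have "\<dots> = (x v* A) \<bullet> ((*v) A ^^ k) y"
    by (simp add: Suc.IH)
  also have "\<dots> = x \<bullet> ((*v) A ^^ Suc k) y"
    by (simp add: dot_lmul_matrix)
  finally show ?case .
qed simp

lemma schur_stable_transpose_orbit:
  fixes A :: "real^'n^'n"
  assumes "schur_stable A"
  shows "(\<lambda>k. ((*v) (transpose A) ^^ k) x) \<longlonglongrightarrow> 0"
proof (rule vec_tendstoI)
  fix i
  have "(\<lambda>k. x \<bullet> ((*v) A ^^ k) (axis i 1)) \<longlonglongrightarrow> x \<bullet> 0"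
    by (intro tendsto_inner tendsto_const schur_stable_orbit assms)
  then show "(\<lambda>k. ((*v) (transpose A) ^^ k) x $ i) \<longlonglongrightarrow> 0 $ i"
    by (simp only: transpose_orbit_dot [symmetric] inner_axis inner_zero_right zero_index)
      (simp add: inner_real_def)
qed

lemma matrix_add_rdistrib: "(A + B) ** C = A ** C + B ** (C :: 'a::comm_ring_1^_^_)"
  by (simp add: matrix_matrix_mult_def vec_eq_iff distrib_right sum.distrib)

lemma matrix_diff_ldistrib: "A ** (B - C) = A ** B - A ** (C :: 'a::comm_ring_1^_^_)"
  by (simp add: matrix_matrix_mult_def vec_eq_iff right_diff_distrib sum_subtractf)

lemma matrix_diff_rdistrib: "(A - B) ** C = A ** C - B ** (C :: 'a::comm_ring_1^_^_)"
  by (simp add: matrix_matrix_mult_def vec_eq_iff left_diff_distrib sum_subtractf)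

lemma matrix_scaleR_left: "(k *\<^sub>R A) ** B = k *\<^sub>R (A ** (B :: real^_^_))"
  by (simp add: matrix_matrix_mult_def vec_eq_iff sum_distrib_left mult.assoc)

lemma matrix_scaleR_right: "A ** (k *\<^sub>R B) = k *\<^sub>R (A ** (B :: real^_^_))"
  by (simp add: matrix_matrix_mult_def vec_eq_iff sum_distrib_left mult_ac)

lemma transpose_add: "transpose (A + B) = transpose A + transpose B"
  by (simp add: transpose_def vec_eq_iff)

lemma transpose_diff: "transpose (A - B) = transpose A - transpose B"
  by (simp add: transpose_def vec_eq_iff)

lemma transpose_zero [simp]: "transpose 0 = 0"
  by (simp add: transpose_def vec_eq_iff)

lemmas matrix_algebra = matrix_add_ldistrib matrix_add_rdistrib matrix_diff_ldistrib
  matrix_diff_rdistrib matrix_scaleR_left matrix_scaleR_right matrix_mul_assoc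

section \<open>Block matrices\<close>

lemma sum_UNIV_Plus:
  fixes f :: "'a::finite + 'b::finite \<Rightarrow> 'c::comm_monoid_add"
  shows "(\<Sum>x\<in>UNIV. f x) = (\<Sum>x\<in>UNIV. f (Inl x)) + (\<Sum>x\<in>UNIV. f (Inr x))"
  by (subst UNIV_Plus_UNIV [symmetric], subst sum.Plus) simp_all

lemma block_mat_times_block_mat:
  "block_mat a b c d ** block_mat e f g h =
    block_mat (a ** e + b ** g) (a ** f + b ** h) (c ** e + d ** g) (c ** f + d ** h)"
  by (simp add: vec_eq_iff block_mat_def block_col_def block_row_def matrix_matrix_mult_def
      sum_UNIV_Plus split: sum.split)

lemma block_mat_times_block_col:
  "block_mat a b c d ** block_col e f = block_col (a ** e + b ** f) (c ** e + d ** f)"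
  by (simp add: vec_eq_iff block_mat_def block_col_def block_row_def matrix_matrix_mult_def
      sum_UNIV_Plus split: sum.split)

lemma block_row_times_block_mat:
  "block_row a b ** block_mat e f g h = block_row (a ** e + b ** g) (a ** f + b ** h)"
  by (simp add: vec_eq_iff block_mat_def block_col_def block_row_def matrix_matrix_mult_def
      sum_UNIV_Plus split: sum.split)

lemma block_row_times_block_col: "block_row a b ** block_col e f = a ** e + b ** f"
  by (simp add: vec_eq_iff block_col_def block_row_def matrix_matrix_mult_def sum_UNIV_Plus)

lemma block_col_times: "block_col a b ** c = block_col (a ** c) (b ** c)"
  by (simp add: vec_eq_iff block_col_def matrix_matrix_mult_def split: sum.split)

lemma block_col_times_block_row:
  "block_col a b ** block_row c d = block_mat (a ** c) (a ** d) (b ** c) (b ** d)"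
  by (simp add: vec_eq_iff block_mat_def block_col_def block_row_def matrix_matrix_mult_def split: sum.split)

lemma transpose_block_mat:
  "transpose (block_mat a b c d) = block_mat (transpose a) (transpose c) (transpose b) (transpose d)"
  by (simp add: vec_eq_iff block_mat_def block_col_def block_row_def transpose_def split: sum.split)

lemma transpose_block_row: "transpose (block_row a b) = block_col (transpose a) (transpose b)"
  by (simp add: vec_eq_iff block_col_def block_row_def transpose_def split: sum.split)

lemma transpose_block_col: "transpose (block_col a b) = block_row (transpose a) (transpose b)"
  by (simp add: vec_eq_iff block_col_def block_row_def transpose_def split: sum.split)

lemma block_mat_add: "block_mat a b c d + block_mat e f g h = block_mat (a + e) (b + f) (c + g) (d + h)"
  by (simp add: vec_eq_iff block_mat_def block_col_def block_row_def split: sum.split)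

lemma block_mat_diff: "block_mat a b c d - block_mat e f g h = block_mat (a - e) (b - f) (c - g) (d - h)"
  by (simp add: vec_eq_iff block_mat_def block_col_def block_row_def split: sum.split)

lemma block_mat_scaleR: "k *\<^sub>R block_mat a b c d = block_mat (k *\<^sub>R a) (k *\<^sub>R b) (k *\<^sub>R c) (k *\<^sub>R d)"
  by (simp add: vec_eq_iff block_mat_def block_col_def block_row_def split: sum.split)

lemma block_col_add: "block_col a b + block_col c d = block_col (a + c) (b + d)"
  by (simp add: vec_eq_iff block_col_def split: sum.split)

lemma upper_left_block_mat [simp]: "upper_left (block_mat a b c d) = a"
  by (simp add: vec_eq_iff upper_left_def block_mat_def block_col_def block_row_def)

lemma upper_left_lift_cov [simp]: "upper_left (lift_cov P_s P) = P"
  unfolding lift_cov_def by simp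

section \<open>The Riccati operator on the set of joint covariances\<close>

text \<open>The excess covariance after the measurement update and before the time update: \<open>Z + D\<close> without
  a packet, and the update by a linear measurement of covariance \<open>Z + \<nu> D\<close> in noise \<open>N\<close> with one.\<close>

definition filtered :: "real^'n^'n \<Rightarrow> real^'n^'n \<Rightarrow> nat \<Rightarrow> nat \<Rightarrow> real^'n^'n \<Rightarrow> real^'n^'n" where
  "filtered Z N \<gamma> \<nu> D = Z + D - real \<gamma> *\<^sub>R ((Z + real \<nu> *\<^sub>R D) **
     matrix_inv ((Z + real \<nu> *\<^sub>R D) + N) ** (Z + real \<nu> *\<^sub>R D))"

text \<open>A joint covariance is \<open>diag (P_s, 0)\<close> plus \<open>D\<close> in all four blocks, and \<open>calA\<close> maps a pair of
  equal blocks to a pair of equal blocks. The equation for \<open>P_s\<close> makes the remaining terms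
  combine into copies of \<open>Z\<close>.\<close>

lemma riccati_lift:
  fixes A P_s Z D F G Sigma_w :: "real^'n^'n" and \<nu> \<gamma> :: nat
  assumes F: "F ** P_s = Z" "P_s ** transpose F = Z" and G: "Z ** transpose F + G = Z"
    and Z: "transpose Z = Z" and D: "transpose D = D"
    and are: "A ** P_s ** transpose A + Sigma_w = P_s + A ** Z ** transpose A"
    and \<nu>: "\<nu> \<in> {0,1}"
    and AA: "AA = block_mat A 0 (A ** F) (A - A ** F)"
    and CC: "CC = (\<lambda>\<nu>. block_row F (real \<nu> *\<^sub>R mat 1 - F))"
    and Q: "Q = block_mat Sigma_w 0 0 (A ** G ** transpose A)" and S: "S = block_col 0 (A ** G)"
    and R: "R \<nu> = G + N"
  shows "CC \<nu> ** lift_cov P_s (P_s + D) ** transpose (CC \<nu>) + R \<nu> = (Z + real \<nu> *\<^sub>R D) + N" (is ?innov)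
    and "riccati AA CC Q S R (lift_cov P_s (P_s + D)) \<gamma> \<nu> =
      lift_cov P_s (P_s + A ** filtered Z N \<gamma> \<nu> D ** transpose A)" (is ?ric)
proof -
  let ?P = "block_mat (P_s + D) D D D"
  let ?T = "Z + real \<nu> *\<^sub>R D"
  have P: "lift_cov P_s (P_s + D) = ?P"
    unfolding lift_cov_def by simp
  have \<nu>2: "real \<nu> * real \<nu> = real \<nu>" using \<nu> by auto
  have FA: "X ** F ** P_s = X ** Z" "X ** P_s ** transpose F = X ** Z" for X :: "real^'n^'n"
    using F by (simp_all add: matrix_mul_assoc [symmetric])
  have ZF1: "Z ** transpose F = Z - G"
    using G by (simp add: eq_diff_eq)
  have ZF: "Z ** transpose F = Z - G" "X ** Z ** transpose F = X ** Z - X ** G" for X :: "real^'n^'n"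
    by (simp_all only: matrix_mul_assoc [symmetric] ZF1 matrix_diff_ldistrib)
  have Sigma_w: "Sigma_w = P_s + A ** Z ** transpose A - A ** P_s ** transpose A"
    using are by (simp add: eq_diff_eq add.commute)
  have CP: "CC \<nu> ** ?P = block_row ?T (real \<nu> *\<^sub>R D)"
    unfolding CC block_row_times_block_mat by (simp add: matrix_algebra F algebra_simps)
  have CPC: "CC \<nu> ** ?P ** transpose (CC \<nu>) = Z - G + real \<nu> *\<^sub>R D"
    unfolding CP unfolding CC transpose_block_row block_row_times_block_col
    by (simp add: matrix_algebra transpose_diff transpose_scalar ZF \<nu>2)
  show innov: ?innov
    unfolding P CPC R by simp
  have AP: "AA ** ?P = block_mat (A ** P_s + A ** D) (A ** D) (A ** Z + A ** D) (A ** D)"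
    unfolding AA block_mat_times_block_mat by (simp add: matrix_algebra FA)
  have APA: "AA ** ?P ** transpose AA + Q = block_mat (P_s + A ** (Z + D) ** transpose A)
      (A ** (Z + D) ** transpose A) (A ** (Z + D) ** transpose A) (A ** (Z + D) ** transpose A)"
    unfolding AP unfolding AA Q transpose_block_mat block_mat_times_block_mat block_mat_add
    by (simp add: Sigma_w matrix_algebra transpose_diff matrix_transpose_mul FA ZF algebra_simps)
  have APC: "AA ** ?P ** transpose (CC \<nu>) + S = block_col (A ** ?T) (A ** ?T)"
    unfolding AP unfolding CC S transpose_block_row block_mat_times_block_col block_col_add
    by (simp add: matrix_algebra transpose_diff transpose_scalar FA ZF)
  have tT: "transpose ?T = ?T"
    by (simp add: transpose_add transpose_scalar Z D)
  have "riccati AA CC Q S R ?P \<gamma> \<nu> = block_mat (P_s + A ** (Z + D) ** transpose A)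
      (A ** (Z + D) ** transpose A) (A ** (Z + D) ** transpose A) (A ** (Z + D) ** transpose A) -
      real \<gamma> *\<^sub>R (block_col (A ** ?T) (A ** ?T) ** matrix_inv (?T + N) ** block_row (?T ** transpose A) (?T ** transpose A))"
    unfolding riccati_def APA APC innov [unfolded P]
    by (simp only: transpose_block_col matrix_transpose_mul tT)
  also have "\<dots> = lift_cov P_s (P_s + A ** (Z + D - real \<gamma> *\<^sub>R (?T ** matrix_inv (?T + N) ** ?T)) ** transpose A)"
  proof -
    define T where "T = ?T"
    show ?thesis
      unfolding T_def [symmetric] block_col_times [of _ _ "matrix_inv _"] block_col_times_block_row
        block_mat_scaleR block_mat_diff lift_cov_def
      by (simp add: matrix_algebra add_diff_eq)
  qed
  finally show ?ric
    unfolding P filtered_def .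
qed

section \<open>Positive semidefinite matrices\<close>

lemma symmetric_dot: "transpose T = T \<Longrightarrow> a \<bullet> (T *v b) = b \<bullet> (T *v (a :: real^'n))"
  by (metis dot_lmul_matrix inner_commute transpose_matrix_vector)

lemma congruence_dot: "x \<bullet> ((A ** X ** transpose A) *v x) = (x v* A) \<bullet> (X *v (x v* A))"
  for x :: "real^'n"
  by (simp add: matrix_vector_mul_assoc [symmetric] dot_lmul_matrix)

lemma psdI: "transpose X = X \<Longrightarrow> (\<And>x. 0 \<le> x \<bullet> (X *v x)) \<Longrightarrow> psd X"
  unfolding psd_def by blast

lemma psdD: "psd X \<Longrightarrow> transpose X = X" "psd X \<Longrightarrow> 0 \<le> x \<bullet> (X *v x)"
  unfolding psd_def by blast+

lemma pos_defD: "pos_def X \<Longrightarrow> transpose X = X" "pos_def X \<Longrightarrow> x \<noteq> 0 \<Longrightarrow> 0 < x \<bullet> (X *v x)"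
  unfolding pos_def_def by blast+

lemma pos_def_imp_psd: "pos_def X \<Longrightarrow> psd X"
  unfolding pos_def_def psd_def by (metis inner_zero_left order.refl less_imp_le)

lemma psd_zero [simp]: "psd 0"
  by (simp add: psd_def)

lemma psd_add: "psd X \<Longrightarrow> psd Y \<Longrightarrow> psd (X + Y)"
  unfolding psd_def by (simp add: transpose_add matrix_vector_mult_add_rdistrib inner_add_right)

lemma psd_scaleR: "psd X \<Longrightarrow> 0 \<le> k \<Longrightarrow> psd (k *\<^sub>R X)"
  unfolding psd_def by (simp add: transpose_scalar scaleR_matrix_vector_assoc [symmetric])

lemma psd_congruence: "psd X \<Longrightarrow> psd (A ** X ** transpose A)"
  by (rule psdI) (simp_all only: congruence_dot psdD matrix_transpose_mul transpose_transpose matrix_mul_assoc)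

lemma psd_trans: "psd (Y - X) \<Longrightarrow> psd (W - Y) \<Longrightarrow> psd (W - X)"
  using psd_add [of "Y - X" "W - Y"] by simp

lemma psd_invertible_imp_pos_def:
  assumes Z: "psd Z" and inv: "invertible Z"
  shows "pos_def Z"
proof -
  have "x = 0" if x: "x \<bullet> (Z *v x) = 0" for x
  proof -
    \<comment> \<open>A zero of the form is a minimum, so the derivative in every direction vanishes.\<close>
    define y where "y = Z *v x"
    have sym: "x \<bullet> (Z *v y) = y \<bullet> y"
      using symmetric_dot [OF psdD(1) [OF Z], of x y] by (simp add: y_def)
    have form: "(x + t *\<^sub>R y) \<bullet> (Z *v (x + t *\<^sub>R y)) = 2 * t * (y \<bullet> y) + t\<^sup>2 * (y \<bullet> (Z *v y))" for t
      using x sym by (simp add: matrix_vector_right_distrib matrix_vector_mult_scaleR inner_add_left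
          inner_add_right power2_eq_square y_def [symmetric] algebra_simps)
    define b where "b = y \<bullet> (Z *v y)"
    have b: "0 \<le> b" unfolding b_def by (rule psdD(2) [OF Z])
    define t where "t = - (y \<bullet> y) / (1 + b)"
    have "0 \<le> 2 * t * (y \<bullet> y) + t\<^sup>2 * b"
      using psdD(2) [OF Z] form unfolding b_def by metis
    also have "\<dots> = - ((y \<bullet> y)\<^sup>2 / (1 + b)) * (2 - b / (1 + b))"
      using b by (simp add: t_def divide_simps power2_eq_square) (simp add: algebra_simps)
    finally have "(y \<bullet> y)\<^sup>2 / (1 + b) * (2 - b / (1 + b)) \<le> 0" by simp
    moreover have "0 < 2 - b / (1 + b)" using b by (simp add: field_simps)
    ultimately have "(y \<bullet> y)\<^sup>2 / (1 + b) \<le> 0"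
      by (metis mult_pos_pos not_le)
    then have "y = 0"
      using b by (auto simp: divide_le_0_iff)
    then show "x = 0"
      using inj_matrix_vector_mult [OF inv] unfolding y_def by (metis injD matrix_vector_mult_0_right)
  qed
  then show ?thesis
    unfolding pos_def_def using psdD [OF Z] by (metis less_eq_real_def)
qed

lemma matrix_inv_inverse:
  "invertible N \<Longrightarrow> N ** matrix_inv N = mat 1" "invertible N \<Longrightarrow> matrix_inv N ** N = mat 1"
  unfolding invertible_def matrix_inv_def by (metis (mono_tags, lifting) someI_ex)+

lemma pos_def_imp_invertible: "pos_def N \<Longrightarrow> invertible (N :: real^'n^'n)"
proof -
  assume N: "pos_def N"
  have "inj ((*v) N)"
  proof (rule injI)
    fix x y assume "N *v x = N *v y"
    then have "(x - y) \<bullet> (N *v (x - y)) = 0" by (simp add: matrix_vector_mult_diff_distrib)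
    then show "x = y" using pos_defD(2) [OF N, of "x - y"] by force
  qed
  then show ?thesis
    using matrix_left_invertible_injective invertible_left_inverse by blast
qed

lemma transpose_matrix_inv:
  assumes "invertible (N :: real^'n^'n)" "transpose N = N"
  shows "transpose (matrix_inv N) = matrix_inv N"
proof -
  have "transpose (matrix_inv N) ** N = mat 1"
    using matrix_inv_inverse(1) [OF assms(1)] assms(2) by (metis matrix_transpose_mul transpose_mat)
  then have "transpose (matrix_inv N) ** N ** matrix_inv N = matrix_inv N" by simp
  then show ?thesis
    by (simp add: matrix_mul_assoc [symmetric] matrix_inv_inverse(1) [OF assms(1)])
qed

section \<open>Parallel sums\<close>

text \<open>This is the parallel sum \<open>(T\<inverse> + N\<inverse>)\<inverse>\<close>, in a form that makes sense for singular \<open>N\<close>.\<close>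

definition par_sum :: "real^'n^'n \<Rightarrow> real^'n^'n \<Rightarrow> real^'n^'n" where
  "par_sum T N = T - T ** matrix_inv (T + N) ** T"

lemma pos_def_add_psd: "pos_def T \<Longrightarrow> psd N \<Longrightarrow> pos_def (T + N)"
  unfolding pos_def_def psd_def
  by (simp add: transpose_add matrix_vector_mult_add_rdistrib inner_add_right add_pos_nonneg)

lemma transpose_par_sum:
  assumes T: "pos_def T" and N: "psd N"
  shows "transpose (par_sum T N) = par_sum T N"
proof -
  have TN: "pos_def (T + N)"
    by (rule pos_def_add_psd [OF T N])
  show ?thesis
    unfolding par_sum_def
    by (simp only: transpose_diff matrix_transpose_mul pos_defD(1) [OF T] matrix_mul_assoc
        transpose_matrix_inv [OF pos_def_imp_invertible [OF TN] pos_defD(1) [OF TN]])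
qed

lemma par_sum_form:
  fixes x :: "real^'n"
  assumes T: "pos_def T" and N: "psd N"
  defines "y \<equiv> matrix_inv (T + N) *v (N *v x)"
  shows "x \<bullet> (par_sum T N *v x) = y \<bullet> (T *v y) + (x - y) \<bullet> (N *v (x - y))"
    and "T *v y = N *v (x - y)"
proof -
  have inv: "invertible (T + N)"
    by (intro pos_def_imp_invertible pos_def_add_psd T N)
  have "(T + N) *v y = N *v x"
    unfolding y_def by (simp only: matrix_vector_mul_assoc matrix_inv_inverse [OF inv] matrix_mul_assoc matrix_mul_lid)
  then show y: "T *v y = N *v (x - y)"
    by (simp add: matrix_vector_mult_add_rdistrib matrix_vector_mult_diff_distrib eq_diff_eq)
  have "T *v x = (T + N) *v x - N *v x"
    by (simp add: matrix_vector_mult_add_rdistrib)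
  then have "matrix_inv (T + N) *v (T *v x) = x - y"
    unfolding y_def
    by (simp only: matrix_vector_mult_diff_distrib matrix_vector_mul_assoc matrix_inv_inverse [OF inv]
        matrix_vector_mul_lid)
  then have "par_sum T N *v x = T *v y"
    unfolding par_sum_def
    by (simp only: matrix_vector_mult_diff_rdistrib matrix_vector_mul_assoc [symmetric])
      (simp add: matrix_vector_mult_diff_distrib)
  then have "x \<bullet> (par_sum T N *v x) = y \<bullet> (T *v y) + (x - y) \<bullet> (T *v y)"
    by (simp add: inner_diff_left)
  then show "x \<bullet> (par_sum T N *v x) = y \<bullet> (T *v y) + (x - y) \<bullet> (N *v (x - y))"
    using y by simp
qed

text \<open>The parallel sum is the infimal convolution of the two quadratic forms;
  \<open>par_sum_form\<close> is the value at the minimizer.\<close>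

lemma par_sum_le:
  assumes T: "pos_def T" and N: "psd N"
  shows "x \<bullet> (par_sum T N *v x) \<le> v \<bullet> (T *v v) + (x - v) \<bullet> (N *v (x - v))"
proof -
  define y where "y = matrix_inv (T + N) *v (N *v x)"
  define d where "d = v - y"
  note y = par_sum_form [OF T N, of x, folded y_def]
  have T': "y \<bullet> (T *v d) = d \<bullet> (T *v y)"
    by (rule symmetric_dot [OF pos_defD(1) [OF T]])
  have N': "(x - y) \<bullet> (N *v d) = d \<bullet> (N *v (x - y))"
    by (rule symmetric_dot [OF psdD(1) [OF N]])
  have v: "v = y + d" "x - v = (x - y) - d"
    unfolding d_def by simp_all
  have "v \<bullet> (T *v v) + (x - v) \<bullet> (N *v (x - v)) =
      x \<bullet> (par_sum T N *v x) + 2 * (d \<bullet> (T *v y) - d \<bullet> (N *v (x - y))) + (d \<bullet> (T *v d) + d \<bullet> (N *v d))"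
    unfolding v(2) unfolding v(1) y(1)
    by (simp only: matrix_vector_right_distrib matrix_vector_mult_diff_distrib [of N "x - y"]
        inner_add_left inner_add_right inner_diff_left [of "x - y"] inner_diff_right T' N') simp
  also have "\<dots> \<ge> x \<bullet> (par_sum T N *v x)"
    using y(2) psdD(2) [OF pos_def_imp_psd [OF T], of d] psdD(2) [OF N, of d] by simp
  finally show ?thesis .
qed

lemma psd_diff_iff:
  "transpose X = X \<Longrightarrow> transpose Y = Y \<Longrightarrow> psd (X - Y) \<longleftrightarrow> (\<forall>x. x \<bullet> (Y *v x) \<le> x \<bullet> (X *v x))"
  unfolding psd_def by (simp add: transpose_diff matrix_vector_mult_diff_rdistrib inner_diff_right)

lemma psd_par_sum:
  assumes T: "pos_def T" and N: "psd N"
  shows "psd (par_sum T N)" "psd (T - par_sum T N)"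
proof -
  show "psd (par_sum T N)"
    by (rule psdI [OF transpose_par_sum [OF T N]])
      (simp only: par_sum_form(1) [OF T N] add_nonneg_nonneg psdD(2) pos_def_imp_psd T N)
  show "psd (T - par_sum T N)"
    unfolding psd_diff_iff [OF pos_defD(1) [OF T] transpose_par_sum [OF T N]]
    using par_sum_le [OF T N, of x x for x] by simp
qed

lemma psd_par_sum_mono:
  assumes T: "pos_def T" and N: "psd N" and E: "psd E"
  shows "psd (par_sum (T + E) N - par_sum T N)"
proof -
  have TE: "pos_def (T + E)" by (rule pos_def_add_psd [OF T E])
  have "x \<bullet> (par_sum T N *v x) \<le> x \<bullet> (par_sum (T + E) N *v x)" for x
  proof -
    define y where "y = matrix_inv (T + E + N) *v (N *v x)"
    have "x \<bullet> (par_sum T N *v x) \<le> y \<bullet> (T *v y) + (x - y) \<bullet> (N *v (x - y))"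
      by (rule par_sum_le [OF T N])
    also have "\<dots> \<le> y \<bullet> ((T + E) *v y) + (x - y) \<bullet> (N *v (x - y))"
      using psdD(2) [OF E, of y] by (simp add: matrix_vector_mult_add_rdistrib inner_add_right)
    also have "\<dots> = x \<bullet> (par_sum (T + E) N *v x)"
      unfolding y_def by (rule par_sum_form(1) [OF TE N, symmetric])
    finally show ?thesis .
  qed
  then show ?thesis
    unfolding psd_diff_iff [OF transpose_par_sum [OF TE N] transpose_par_sum [OF T N]] by blast
qed

text \<open>Inserting the minimizer \<open>y\<close> for \<open>T\<close> into the variational formula for \<open>T + E\<close> bounds the increase
  by \<open>y \<bullet> E y\<close>. When \<open>N\<close> is a multiple of \<open>X\<close>, the map from \<open>x\<close> to \<open>y\<close> is a contraction in the norm
  of \<open>X\<close>. For a general \<open>N\<close> the increase need not be below \<open>E\<close>, nor below \<open>t X\<close>.\<close>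

lemma psd_par_sum_nonexpansive:
  assumes T: "pos_def T" and X: "psd X" and \<alpha>: "0 \<le> \<alpha>" and E: "psd E" and t: "0 \<le> t" "psd (t *\<^sub>R X - E)"
  shows "psd (t *\<^sub>R X - (par_sum (T + E) (\<alpha> *\<^sub>R X) - par_sum T (\<alpha> *\<^sub>R X)))"
proof -
  let ?N = "\<alpha> *\<^sub>R X"
  have N: "psd ?N" by (rule psd_scaleR [OF X \<alpha>])
  have TE: "pos_def (T + E)" by (rule pos_def_add_psd [OF T E])
  have "x \<bullet> (par_sum (T + E) ?N *v x) - x \<bullet> (par_sum T ?N *v x) \<le> t * (x \<bullet> (X *v x))" for x
  proof -
    define y where "y = matrix_inv (T + ?N) *v (?N *v x)"
    note y = par_sum_form [OF T N, of x, folded y_def]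
    have "x \<bullet> (par_sum (T + E) ?N *v x) \<le> y \<bullet> ((T + E) *v y) + (x - y) \<bullet> (?N *v (x - y))"
      by (rule par_sum_le [OF TE N])
    also have "\<dots> = x \<bullet> (par_sum T ?N *v x) + y \<bullet> (E *v y)"
      unfolding y(1) by (simp add: matrix_vector_mult_add_rdistrib inner_add_right)
    finally have 1: "x \<bullet> (par_sum (T + E) ?N *v x) - x \<bullet> (par_sum T ?N *v x) \<le> y \<bullet> (E *v y)"
      by simp
    have 2: "y \<bullet> (E *v y) \<le> t * (y \<bullet> (X *v y))"
      using psdD(2) [OF t(2), of y]
      by (simp add: matrix_vector_mult_diff_rdistrib inner_diff_right scaleR_matrix_vector_assoc [symmetric])
    have "y \<bullet> (X *v y) \<le> x \<bullet> (X *v x)"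
    proof (cases "\<alpha> = 0")
      case True
      then have "y = 0" unfolding y_def by simp
      then show ?thesis using psdD(2) [OF X] by simp
    next
      case False
      have "0 \<le> y \<bullet> (T *v y)" by (rule psdD(2) [OF pos_def_imp_psd [OF T]])
      also have "\<dots> = \<alpha> * (y \<bullet> (X *v x) - y \<bullet> (X *v y))"
        unfolding y(2) by (simp add: scaleR_matrix_vector_assoc [symmetric] matrix_vector_mult_diff_distrib
            inner_diff_right right_diff_distrib)
      finally have "y \<bullet> (X *v y) \<le> y \<bullet> (X *v x)"
        using \<alpha> False by (simp add: zero_le_mult_iff)
      moreover have "0 \<le> (x - y) \<bullet> (X *v (x - y))" by (rule psdD(2) [OF X])
      then have "2 * (y \<bullet> (X *v x)) \<le> x \<bullet> (X *v x) + y \<bullet> (X *v y)"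
        using symmetric_dot [OF psdD(1) [OF X], of x y]
        by (simp add: matrix_vector_mult_diff_distrib inner_diff_right inner_diff_left)
      ultimately show ?thesis by linarith
    qed
    then have "t * (y \<bullet> (X *v y)) \<le> t * (x \<bullet> (X *v x))"
      by (rule mult_left_mono [OF _ t(1)])
    then show ?thesis using 1 2 by linarith
  qed
  then show ?thesis
    unfolding psd_def
    by (simp add: transpose_diff transpose_scalar transpose_par_sum [OF TE N] transpose_par_sum [OF T N] psdD(1) [OF X]
        matrix_vector_mult_diff_rdistrib inner_diff_right scaleR_matrix_vector_assoc [symmetric])
qed

section \<open>Bounds by the trace\<close>

lemma psd_diag_nonneg: "psd D \<Longrightarrow> 0 \<le> D $ i $ i"
  using psdD(2) [of D "axis i 1"]
  by (simp add: matrix_vector_mult_basis inner_axis' column_def)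

lemma psd_trace_nonneg: "psd D \<Longrightarrow> 0 \<le> trace D"
  unfolding trace_def by (intro sum_nonneg psd_diag_nonneg)

lemma psd_entry_le_trace:
  assumes D: "psd D" shows "\<bar>D $ i $ j\<bar> \<le> trace D"
proof -
  have diag: "D $ i $ i \<le> trace D" for i
    unfolding trace_def by (rule member_le_sum) (auto intro: psd_diag_nonneg [OF D])
  have e: "axis a 1 \<bullet> (D *v axis b 1) = D $ a $ b" for a b
    by (simp add: matrix_vector_mult_basis inner_axis' column_def)
  have sym: "D $ j $ i = D $ i $ j"
    using psdD(1) [OF D] by (metis transpose_def vec_lambda_beta)
  have "0 \<le> D $ i $ i + s * 2 * (D $ i $ j) + s * s * (D $ j $ j)" for s
    using psdD(2) [OF D, of "axis i 1 + s *\<^sub>R axis j 1"] sym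
    by (simp add: matrix_vector_right_distrib matrix_vector_mult_scaleR inner_add_left inner_add_right e algebra_simps)
  from this [of 1] this [of "-1"] diag [of i] diag [of j] show ?thesis by simp
qed

lemma psd_form_le_trace:
  assumes D: "psd (D :: real^'n^'n)" shows "x \<bullet> (D *v x) \<le> real CARD('n) * trace D * (x \<bullet> x)"
proof -
  have "x \<bullet> (D *v x) = (\<Sum>i\<in>UNIV. \<Sum>j\<in>UNIV. D $ i $ j * (x $ i * x $ j))"
    by (simp add: inner_vec_def matrix_vector_mult_def sum_distrib_left mult_ac)
  also have "\<dots> \<le> (\<Sum>i\<in>UNIV. \<Sum>j\<in>UNIV. trace D * (((x $ i)\<^sup>2 + (x $ j)\<^sup>2) / 2))"
  proof (intro sum_mono)
    fix i j
    have "D $ i $ j * (x $ i * x $ j) \<le> \<bar>D $ i $ j\<bar> * \<bar>x $ i * x $ j\<bar>"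
      by (metis abs_ge_self abs_mult)
    also have "\<dots> \<le> trace D * (((x $ i)\<^sup>2 + (x $ j)\<^sup>2) / 2)"
    proof (intro mult_mono psd_entry_le_trace D psd_trace_nonneg abs_ge_zero)
      have "0 \<le> (\<bar>x $ i\<bar> - \<bar>x $ j\<bar>)\<^sup>2" by simp
      then show "\<bar>x $ i * x $ j\<bar> \<le> ((x $ i)\<^sup>2 + (x $ j)\<^sup>2) / 2"
        by (simp add: power2_diff abs_mult)
    qed
    finally show "D $ i $ j * (x $ i * x $ j) \<le> trace D * (((x $ i)\<^sup>2 + (x $ j)\<^sup>2) / 2)" .
  qed
  also have "\<dots> = real CARD('n) * trace D * (x \<bullet> x)"
    unfolding sum_distrib_left [symmetric]
    by (simp add: inner_vec_def sum.distrib sum_divide_distrib [symmetric] power2_eq_square sum_distrib_left [symmetric])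
  finally show ?thesis .
qed

lemma pos_def_lower_bound:
  assumes Z: "pos_def (Z :: real^'n^'n)"
  shows "\<exists>e>0. \<forall>x. e * (x \<bullet> x) \<le> x \<bullet> (Z *v x)"
proof -
  let ?f = "\<lambda>x. x \<bullet> (Z *v x)"
  have "continuous_on (sphere 0 1) ?f"
    by (intro continuous_on_inner continuous_on_id linear_continuous_on linear_conv_bounded_linear [THEN iffD1] matrix_vector_mul_linear)
  then obtain z where z: "z \<in> sphere 0 1" "\<And>y. y \<in> sphere 0 1 \<Longrightarrow> ?f z \<le> ?f y"
    using continuous_attains_inf [of "sphere 0 1" ?f] by (metis compact_sphere sphere_eq_empty not_one_less_zero)
  have "?f z * (x \<bullet> x) \<le> ?f x" for x
  proof (cases "x = 0")
    case False
    then have "?f z \<le> ?f ((1 / norm x) *\<^sub>R x)" by (intro z) simp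
    also have "\<dots> = ?f x / (norm x)\<^sup>2"
      by (simp add: matrix_vector_mult_scaleR power2_eq_square)
    finally show ?thesis
      using False by (simp add: pos_le_divide_eq power2_norm_eq_inner)
  qed simp
  moreover have "0 < ?f z" using z(1) by (intro pos_defD(2) [OF Z]) auto
  ultimately show ?thesis by blast
qed

section \<open>The Lyapunov equation\<close>

lemma lyapunov_orbit:
  assumes E: "E = A ** E ** transpose (A :: real^'n^'n)"
  shows "x \<bullet> (E *v y) = ((*v) (transpose A) ^^ k) x \<bullet> (E *v ((*v) (transpose A) ^^ k) y)"
proof (induction k)
  case (Suc k)
  have "a \<bullet> (E *v b) = (transpose A *v a) \<bullet> (E *v (transpose A *v b))" for a b
    using arg_cong [where f="\<lambda>M. a \<bullet> (M *v b)", OF E]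
    by (simp add: matrix_vector_mul_assoc [symmetric] dot_lmul_matrix)
  then show ?case using Suc by simp
qed simp

text \<open>Iterating the equation expresses the form of \<open>X\<close> at \<open>x\<close> through its values along the orbit of
  \<open>A\<^sup>T\<close>, which tend to zero. Uniqueness of the solution gives symmetry.\<close>

lemma lyapunov_solution:
  assumes A: "schur_stable (A :: real^'n^'n)" and X: "X = A ** X ** transpose A + Z" and Z: "psd Z"
  shows "transpose X = X" and "x \<bullet> (Z *v x) \<le> x \<bullet> (X *v x)"
proof -
  have lim: "(\<lambda>k. ((*v) (transpose A) ^^ k) x \<bullet> (M *v ((*v) (transpose A) ^^ k) y)) \<longlonglongrightarrow> 0" for M x y
  proof -
    have "(\<lambda>k. M *v ((*v) (transpose A) ^^ k) y) \<longlonglongrightarrow> M *v 0"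
      by (intro bounded_linear.tendsto [of "(*v) M"] schur_stable_transpose_orbit A
          linear_conv_bounded_linear [THEN iffD1] matrix_vector_mul_linear)
    then have "(\<lambda>k. ((*v) (transpose A) ^^ k) x \<bullet> (M *v ((*v) (transpose A) ^^ k) y)) \<longlonglongrightarrow> 0 \<bullet> (M *v 0)"
      by (intro tendsto_inner schur_stable_transpose_orbit A)
    then show ?thesis by simp
  qed
  have "X - transpose X = A ** (X - transpose X) ** transpose A"
  proof -
    have "transpose X = A ** transpose X ** transpose A + Z"
      using arg_cong [OF X, of transpose]
      by (simp add: transpose_add matrix_transpose_mul matrix_mul_assoc psdD(1) [OF Z])
    with X have "X - transpose X = A ** X ** transpose A + Z - (A ** transpose X ** transpose A + Z)"
      by metis
    also have "\<dots> = A ** (X - transpose X) ** transpose A"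
      by (simp add: matrix_algebra)
    finally show ?thesis .
  qed
  note orbit = lyapunov_orbit [OF this]
  have "a \<bullet> ((X - transpose X) *v b) = 0" for a b
  proof (rule LIMSEQ_unique [OF _ lim [of a "X - transpose X" b]])
    show "(\<lambda>k. ((*v) (transpose A) ^^ k) a \<bullet> ((X - transpose X) *v ((*v) (transpose A) ^^ k) b))
        \<longlonglongrightarrow> a \<bullet> ((X - transpose X) *v b)"
      by (simp only: orbit [symmetric] tendsto_const)
  qed
  then have "(X - transpose X) *v b = 0" for b
    using inner_eq_zero_iff by blast
  then have "X - transpose X = 0"
    by (simp add: matrix_eq)
  then show "transpose X = X" by simp
  define y where "y = (\<lambda>k. ((*v) (transpose A) ^^ k) x)"
  define f where "f = (\<lambda>k. y k \<bullet> (X *v y k))"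
  have f: "f k = f (Suc k) + y k \<bullet> (Z *v y k)" for k
  proof -
    have "a \<bullet> (X *v a) = (transpose A *v a) \<bullet> (X *v (transpose A *v a)) + a \<bullet> (Z *v a)" for a
      using arg_cong [where f="\<lambda>M. a \<bullet> (M *v a)", OF X]
      by (simp add: matrix_vector_mult_add_rdistrib inner_add_right
          matrix_vector_mul_assoc [symmetric] dot_lmul_matrix)
    from this [of "y k"] show ?thesis unfolding f_def y_def by (simp only: funpow.simps comp_apply)
  qed
  have "f (Suc k) \<le> f k" for k
    using psdD(2) [OF Z, of "y k"] f [of k] by linarith
  then have "decseq f" by (rule decseq_SucI)
  moreover have "f \<longlonglongrightarrow> 0"
    unfolding f_def y_def by (rule lim)
  ultimately have "0 \<le> f (Suc 0)"
    by (rule decseq_ge)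
  then have "y 0 \<bullet> (Z *v y 0) \<le> f 0"
    using f [of 0] by linarith
  then show "x \<bullet> (Z *v x) \<le> x \<bullet> (X *v x)"
    unfolding f_def y_def by simp
qed

section \<open>Continuity of the Riccati operator\<close>

lemma continuous_on_matrix_mult [continuous_intros]:
  fixes f :: "'s::topological_space \<Rightarrow> real^'m^'n" and g :: "'s \<Rightarrow> real^'k^'m"
  shows "continuous_on S f \<Longrightarrow> continuous_on S g \<Longrightarrow> continuous_on S (\<lambda>s. f s ** g s)"
  unfolding matrix_matrix_mult_def by (intro continuous_intros)

lemma continuous_on_transpose [continuous_intros]:
  fixes f :: "'s::topological_space \<Rightarrow> real^'m^'n"
  shows "continuous_on S f \<Longrightarrow> continuous_on S (\<lambda>s. transpose (f s))"
  unfolding transpose_def by (intro continuous_intros)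

lemma continuous_on_det:
  fixes f :: "'s::topological_space \<Rightarrow> real^'n^'n"
  shows "continuous_on S f \<Longrightarrow> continuous_on S (\<lambda>s. det (f s))"
  unfolding det_def by (intro continuous_intros)

lemma matrix_inv_cramer:
  fixes N :: "real^'n^'n"
  assumes "invertible N"
  shows "matrix_inv N = (\<chi> k j. det (\<chi> i l. if l = k then (axis j 1 :: real^'n) $ i else N $ i $ l) / det N)"
proof -
  have "det N \<noteq> 0" using assms invertible_det_nz by blast
  moreover have "N *v (matrix_inv N *v axis j 1) = axis j 1" for j
    by (simp add: matrix_vector_mul_assoc matrix_inv_inverse [OF assms])
  ultimately have "matrix_inv N *v axis j 1 = (\<chi> k. det (\<chi> i l. if l = k then (axis j 1 :: real^'n) $ i else N $ i $ l) / det N)" for j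
    using cramer by blast
  then show ?thesis
    by (simp add: vec_eq_iff matrix_vector_mult_basis column_def)
qed

lemma continuous_on_matrix_inv:
  fixes f :: "'s::topological_space \<Rightarrow> real^'n^'n"
  assumes f: "continuous_on S f" and inv: "\<And>s. s \<in> S \<Longrightarrow> invertible (f s)"
  shows "continuous_on S (\<lambda>s. matrix_inv (f s))"
proof -
  have "continuous_on S (\<lambda>s. (\<chi> k j. det (\<chi> i l. if l = k then (axis j 1 :: real^'n) $ i else f s $ i $ l) / det (f s)) :: real^'n^'n)"
  proof (intro continuous_on_vec_lambda continuous_on_divide continuous_on_det f)
    fix k j i l :: 'n
    show "continuous_on S (\<lambda>s. if l = k then (axis j 1 :: real^'n) $ i else f s $ i $ l)"
      by (cases "l = k") (auto intro!: continuous_intros f)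
  qed (use inv invertible_det_nz in blast)
  then show ?thesis
    by (rule continuous_on_cong [THEN iffD1, rotated -1]) (simp_all add: matrix_inv_cramer inv)
qed

lemma continuous_on_riccati:
  assumes "\<And>P. P \<in> S \<Longrightarrow> invertible (CC \<nu> ** P ** transpose (CC \<nu>) + R \<nu>)"
  shows "continuous_on S (\<lambda>P. riccati AA CC Q SS R P \<gamma> \<nu>)"
  unfolding riccati_def by (intro continuous_intros continuous_on_matrix_inv assms)

section \<open>Expected stage costs along a decision tree\<close>

text \<open>The abstract control problem. The relation \<open>near t s s'\<close> says that \<open>s\<close> dominates \<open>s'\<close> by at most
  \<open>t\<close>; every controlled step contracts it by \<open>r\<close>, and the costs of such states differ by
  at most \<open>K t\<close>. The function \<open>u\<close> bounds the excess over the base state \<open>s0\<close>;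
  in the application it is truncated from below, so that it never increases along trajectories. Condition \<open>coercive\<close> makes a finite mean cost force a
  finite mean of \<open>u\<close> one step later.\<close>

locale transmission_mdp =
  fixes SS :: "'s measure" and L :: "'s \<Rightarrow> nat \<Rightarrow> nat \<Rightarrow> 's"
    and c :: "'s \<Rightarrow> nat \<Rightarrow> nat \<Rightarrow> real" and p \<delta> \<eta> :: real
    and near :: "real \<Rightarrow> 's \<Rightarrow> 's \<Rightarrow> bool" and u :: "'s \<Rightarrow> real" and s0 :: 's
    and r K K' :: real
  assumes p: "p \<in> {0..1}" and \<delta>: "\<delta> \<in> {0..1}" and \<eta>: "\<eta> \<in> {0..1}"
    and L_measurable: "\<And>\<gamma> \<nu>. \<gamma> \<in> {0,1} \<Longrightarrow> \<nu> \<in> {0,1} \<Longrightarrow> (\<lambda>s. L s \<gamma> \<nu>) \<in> measurable SS SS"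
    and c_measurable: "\<And>\<gamma> \<nu>. \<gamma> \<in> {0,1} \<Longrightarrow> \<nu> \<in> {0,1} \<Longrightarrow> (\<lambda>s. c s \<gamma> \<nu>) \<in> borel_measurable SS"
    and u_measurable [measurable]: "u \<in> borel_measurable SS"
    and c_nonneg: "\<And>s \<gamma> \<nu>. s \<in> space SS \<Longrightarrow> \<gamma> \<in> {0,1} \<Longrightarrow> \<nu> \<in> {0,1} \<Longrightarrow> 0 \<le> c s \<gamma> \<nu>"
    and u_nonneg: "\<And>s. s \<in> space SS \<Longrightarrow> 0 \<le> u s"
    and s0: "s0 \<in> space SS"
    and near_base: "\<And>s. s \<in> space SS \<Longrightarrow> near (u s) s s0"
    and near_step: "\<And>t s s' \<gamma> \<nu>. near t s s' \<Longrightarrow> \<gamma> \<in> {0,1} \<Longrightarrow> \<nu> \<in> {0,1} \<Longrightarrow>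
           near (r * t) (L s \<gamma> \<nu>) (L s' \<gamma> \<nu>)"
    and near_cost: "\<And>t s s' \<gamma> \<nu>. near t s s' \<Longrightarrow> \<gamma> \<in> {0,1} \<Longrightarrow> \<nu> \<in> {0,1} \<Longrightarrow>
           c s' \<gamma> \<nu> \<le> c s \<gamma> \<nu> \<and> c s \<gamma> \<nu> \<le> c s' \<gamma> \<nu> + K * t"
    and drift: "\<And>s \<gamma> \<nu>. s \<in> space SS \<Longrightarrow> \<gamma> \<in> {0,1} \<Longrightarrow> \<nu> \<in> {0,1} \<Longrightarrow> u (L s \<gamma> \<nu>) \<le> u s"
    and coercive: "\<And>s \<gamma> \<nu>. s \<in> space SS \<Longrightarrow> \<gamma> \<in> {0,1} \<Longrightarrow> \<nu> \<in> {0,1} \<Longrightarrow>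
           u (L s \<gamma> \<nu>) \<le> K' * (c s \<gamma> \<nu> + 1)"
    and r: "0 \<le> r" "r < 1" and K: "0 \<le> K"
begin

text \<open>Here \<open>w\<close> is the joint law of a loss and its acknowledgment, and \<open>q\<close> the law of the
  acknowledgment.\<close>

abbreviation w :: "nat \<Rightarrow> nat \<Rightarrow> real" where
  "w \<gamma> j \<equiv> loss_prob p \<gamma> * ack_mat \<delta> \<eta> \<gamma> j"

abbreviation q :: "nat \<Rightarrow> real" where
  "q j \<equiv> ack_prob p \<delta> \<eta> j"

text \<open>Past decisions are determined by the past acknowledgments, so a policy for a fixed initial covariance
  is a decision for each acknowledgment history.\<close>

definition trees :: "(nat list \<Rightarrow> nat) set" where
  "trees = {g. \<forall>h. g h \<in> {0,1}}"

text \<open>The expected cost at time \<open>k\<close> from \<open>s\<close>, expanded at the first step: what follows an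
  acknowledgment \<open>j\<close> is governed by the subtree of \<open>g\<close> at \<open>j\<close>.\<close>

primrec stage :: "nat \<Rightarrow> 's \<Rightarrow> (nat list \<Rightarrow> nat) \<Rightarrow> real" where
  "stage 0 s g = (\<Sum>\<gamma>\<in>{0,1}. loss_prob p \<gamma> * c s \<gamma> (g []))"
| "stage (Suc k) s g = (\<Sum>\<gamma>\<in>{0,1}. \<Sum>j\<in>{0,1,2}. w \<gamma> j * stage k (L s \<gamma> (g [])) (\<lambda>h. g (j # h)))"

lemma loss_nonneg: "0 \<le> loss_prob p \<gamma>"
  using p by (simp add: loss_prob_def)

lemma loss_sum: "(\<Sum>\<gamma>\<in>{0,1}. loss_prob p \<gamma>) = 1"
  by (simp add: loss_prob_def)

lemma ack_nonneg: "\<gamma> \<in> {0,1} \<Longrightarrow> j \<in> {0,1,2} \<Longrightarrow> 0 \<le> ack_mat \<delta> \<eta> \<gamma> j"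
  using \<delta> \<eta> by (auto simp: ack_mat_def numeral_2_eq_2)

lemma ack_sum: "\<gamma> \<in> {0,1} \<Longrightarrow> (\<Sum>j\<in>{0,1,2}. ack_mat \<delta> \<eta> \<gamma> j) = 1"
  by (auto simp: ack_mat_def numeral_2_eq_2 algebra_simps)

lemma w_nonneg: "\<gamma> \<in> {0,1} \<Longrightarrow> j \<in> {0,1,2} \<Longrightarrow> 0 \<le> w \<gamma> j"
  by (intro mult_nonneg_nonneg loss_nonneg ack_nonneg)

lemma w_sum: "\<gamma> \<in> {0,1} \<Longrightarrow> (\<Sum>j\<in>{0,1,2}. w \<gamma> j) = loss_prob p \<gamma>"
  by (simp only: sum_distrib_left [symmetric] ack_sum mult_1_right)

lemma q_eq: "q j = (\<Sum>\<gamma>\<in>{0,1}. w \<gamma> j)"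
  by (simp add: ack_prob_def mult.commute)

lemma q_nonneg: "j \<in> {0,1,2} \<Longrightarrow> 0 \<le> q j"
  unfolding q_eq by (intro sum_nonneg w_nonneg)

lemma w_total: "(\<Sum>\<gamma>\<in>{0,1}. \<Sum>j\<in>{0,1,2}. w \<gamma> j) = 1"
  by (simp only: w_sum loss_sum cong: sum.cong)

lemma q_sum: "(\<Sum>j\<in>{0,1,2}. q j) = 1"
  unfolding q_eq by (subst sum.swap) (rule w_total)

lemma w_zero: "j \<in> {0,1,2} \<Longrightarrow> q j = 0 \<Longrightarrow> \<gamma> \<in> {0,1} \<Longrightarrow> w \<gamma> j = 0"
  unfolding q_eq using w_nonneg by (subst (asm) sum_nonneg_eq_0_iff) blast+

lemma w_avg_const: "(\<Sum>\<gamma>\<in>{0,1}. \<Sum>j\<in>{0,1,2}. w \<gamma> j * a) = a"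
  by (simp only: sum_distrib_right [symmetric] w_total mult_1)

lemma w_avg_mono:
  assumes "\<And>\<gamma> j. \<gamma> \<in> {0,1} \<Longrightarrow> j \<in> {0,1,2} \<Longrightarrow> f \<gamma> j \<le> g \<gamma> j"
  shows "(\<Sum>\<gamma>\<in>{0,1}. \<Sum>j\<in>{0,1,2}. w \<gamma> j * f \<gamma> j) \<le> (\<Sum>\<gamma>\<in>{0,1}. \<Sum>j\<in>{0,1,2}. w \<gamma> j * g \<gamma> j)"
  by (intro sum_mono mult_left_mono assms w_nonneg)

lemma w_avg_add: "(\<Sum>\<gamma>\<in>{0,1}. \<Sum>j\<in>{0,1,2}. w \<gamma> j * (f \<gamma> j + a)) =
    (\<Sum>\<gamma>\<in>{0,1}. \<Sum>j\<in>{0,1,2}. w \<gamma> j * f \<gamma> j) + a"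
  by (simp only: distrib_left sum.distrib w_avg_const)

lemma loss_avg_const: "(\<Sum>\<gamma>\<in>{0,1}. loss_prob p \<gamma> * a) = a"
  by (simp only: sum_distrib_right [symmetric] loss_sum mult_1)

lemma trees_root: "g \<in> trees \<Longrightarrow> g [] \<in> {0,1}"
  unfolding trees_def by blast

lemma trees_sub: "g \<in> trees \<Longrightarrow> (\<lambda>h. g (j # h)) \<in> trees"
  unfolding trees_def by blast

lemma L_space: "s \<in> space SS \<Longrightarrow> \<gamma> \<in> {0,1} \<Longrightarrow> \<nu> \<in> {0,1} \<Longrightarrow> L s \<gamma> \<nu> \<in> space SS"
  using measurable_space [OF L_measurable] by blast

lemma stage_measurable: "g \<in> trees \<Longrightarrow> (\<lambda>s. stage k s g) \<in> borel_measurable SS"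
proof (induction k arbitrary: g)
  case 0
  show ?case unfolding stage.simps
    by (intro borel_measurable_sum borel_measurable_times borel_measurable_const c_measurable
        trees_root [OF 0])
next
  case (Suc k)
  have "(\<lambda>s. stage k (L s \<gamma> (g [])) (\<lambda>h. g (j # h))) \<in> borel_measurable SS" if "\<gamma> \<in> {0,1}" for \<gamma> j
    using measurable_compose [OF L_measurable [OF that trees_root [OF Suc.prems]]
        Suc.IH [OF trees_sub [OF Suc.prems]]] .
  then show ?case unfolding stage.simps
    by (intro borel_measurable_sum borel_measurable_times borel_measurable_const)
qed

lemma stage_nonneg: "s \<in> space SS \<Longrightarrow> g \<in> trees \<Longrightarrow> 0 \<le> stage k s g"
proof (induction k arbitrary: g s)
  case 0
  then show ?case unfolding stage.simps
    by (intro sum_nonneg mult_nonneg_nonneg c_nonneg loss_nonneg trees_root [OF 0(2)])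
next
  case (Suc k)
  have "0 \<le> stage k (L s \<gamma> (g [])) (\<lambda>h. g (j # h))" if "\<gamma> \<in> {0,1}" for \<gamma> j
    by (rule Suc.IH [OF L_space [OF Suc.prems(1) that trees_root] trees_sub]) (rule Suc.prems)+
  then show ?case unfolding stage.simps
    by (intro sum_nonneg mult_nonneg_nonneg [OF w_nonneg])
qed

lemma stage_near:
  "near t s s' \<Longrightarrow> g \<in> trees \<Longrightarrow>
     stage k s' g \<le> stage k s g \<and> stage k s g \<le> stage k s' g + K * (r ^ k * t)"
proof (induction k arbitrary: g s s' t)
  case 0
  have "(\<Sum>\<gamma>\<in>{0,1}. loss_prob p \<gamma> * c s' \<gamma> (g [])) \<le> (\<Sum>\<gamma>\<in>{0,1}. loss_prob p \<gamma> * c s \<gamma> (g []))"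
    by (intro sum_mono mult_left_mono loss_nonneg conjunct1 [OF near_cost [OF 0(1)]] trees_root [OF 0(2)])
  moreover have "(\<Sum>\<gamma>\<in>{0,1}. loss_prob p \<gamma> * c s \<gamma> (g [])) \<le>
      (\<Sum>\<gamma>\<in>{0,1}. loss_prob p \<gamma> * (c s' \<gamma> (g []) + K * t))"
    by (intro sum_mono mult_left_mono loss_nonneg conjunct2 [OF near_cost [OF 0(1)]] trees_root [OF 0(2)])
  ultimately show ?case
    unfolding stage.simps by (simp only: distrib_left sum.distrib loss_avg_const power_0 mult_1)
next
  case (Suc k)
  let ?h = "\<lambda>j h. g (j # h)"
  have n: "near (r * t) (L s \<gamma> (g [])) (L s' \<gamma> (g []))" if "\<gamma> \<in> {0,1}" for \<gamma>
    using near_step Suc.prems trees_root that by blast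
  have IH: "stage k (L s' \<gamma> (g [])) (?h j) \<le> stage k (L s \<gamma> (g [])) (?h j)"
    "stage k (L s \<gamma> (g [])) (?h j) \<le> stage k (L s' \<gamma> (g [])) (?h j) + K * (r ^ Suc k * t)"
    if "\<gamma> \<in> {0,1}" for \<gamma> j
    using Suc.IH [OF n [OF that] trees_sub [OF Suc.prems(2)], of j] by (simp_all add: mult_ac)
  have "stage (Suc k) s g \<le> (\<Sum>\<gamma>\<in>{0,1}. \<Sum>j\<in>{0,1,2}. w \<gamma> j *
      (stage k (L s' \<gamma> (g [])) (?h j) + K * (r ^ Suc k * t)))"
    unfolding stage.simps by (intro w_avg_mono IH)
  moreover have "stage (Suc k) s' g \<le> stage (Suc k) s g"
    unfolding stage.simps by (intro w_avg_mono IH)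
  ultimately show ?case
    unfolding stage.simps w_avg_add by blast
qed

definition K0 :: real where
  "K0 = (\<Sum>\<gamma>\<in>{0,1}. \<Sum>\<nu>\<in>{0,1}. c s0 \<gamma> \<nu>)"

lemma cost_bound:
  assumes "s \<in> space SS" "\<gamma> \<in> {0,1}" "\<nu> \<in> {0,1}"
  shows "c s \<gamma> \<nu> \<le> K0 + K * u s"
proof -
  have "c s0 \<gamma> \<nu> \<le> (\<Sum>\<nu>\<in>{0,1}. c s0 \<gamma> \<nu>)"
    by (rule member_le_sum) (use assms c_nonneg [OF s0] in auto)
  also have "\<dots> \<le> K0"
    unfolding K0_def
    by (rule member_le_sum [where f="\<lambda>\<gamma>. \<Sum>\<nu>\<in>{0,1}. c s0 \<gamma> \<nu>"])
      (use assms in \<open>auto intro!: sum_nonneg c_nonneg s0 add_nonneg_nonneg\<close>)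
  finally show ?thesis
    using near_cost [OF near_base [OF assms(1)] assms(2,3)] by linarith
qed

lemma stage_bound: "s \<in> space SS \<Longrightarrow> g \<in> trees \<Longrightarrow> stage k s g \<le> K0 + K * u s"
proof (induction k arbitrary: g s)
  case 0
  have "(\<Sum>\<gamma>\<in>{0,1}. loss_prob p \<gamma> * c s \<gamma> (g [])) \<le> (\<Sum>\<gamma>\<in>{0,1}. loss_prob p \<gamma> * (K0 + K * u s))"
    by (intro sum_mono mult_left_mono loss_nonneg cost_bound 0(1) trees_root [OF 0(2)])
  then show ?case
    unfolding stage.simps loss_avg_const .
next
  case (Suc k)
  have "stage k (L s \<gamma> (g [])) (\<lambda>h. g (j # h)) \<le> K0 + K * u s" if "\<gamma> \<in> {0,1}" for \<gamma> j
    using Suc.IH [OF L_space [OF Suc.prems(1) that trees_root [OF Suc.prems(2)]]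
        trees_sub [OF Suc.prems(2)], of j]
      mult_left_mono [OF drift [OF Suc.prems(1) that trees_root [OF Suc.prems(2)]] K] by linarith
  then have "stage (Suc k) s g \<le> (\<Sum>\<gamma>\<in>{0,1}. \<Sum>j\<in>{0,1,2}. w \<gamma> j * (K0 + K * u s))"
    unfolding stage.simps by (intro w_avg_mono)
  then show ?case
    unfolding w_avg_const .
qed

section \<open>Discounted costs\<close>

definition disc :: "real \<Rightarrow> 's \<Rightarrow> (nat list \<Rightarrow> nat) \<Rightarrow> real" where
  "disc \<beta> s g = (\<Sum>k. \<beta> ^ k * stage k s g)"

lemma disc_summable:
  assumes "0 \<le> \<beta>" "\<beta> < 1" "s \<in> space SS" "g \<in> trees"
  shows "summable (\<lambda>k. \<beta> ^ k * stage k s g)"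
proof (rule summable_comparison_test')
  show "summable (\<lambda>k. \<beta> ^ k * (K0 + K * u s))"
    using assms by (intro summable_mult2 summable_geometric) auto
  show "norm (\<beta> ^ k * stage k s g) \<le> \<beta> ^ k * (K0 + K * u s)" for k
    using assms stage_nonneg [of s g k] stage_bound [of s g k] by (auto intro!: mult_mono)
qed

lemma disc_measurable:
  assumes "g \<in> trees" shows "(\<lambda>s. disc \<beta> s g) \<in> borel_measurable SS"
  unfolding disc_def
  by (intro borel_measurable_suminf borel_measurable_times borel_measurable_const
      stage_measurable assms)

lemma disc_nonneg:
  assumes "0 \<le> \<beta>" "\<beta> < 1" "s \<in> space SS" "g \<in> trees"
  shows "0 \<le> disc \<beta> s g"
  unfolding disc_def using assms
  by (intro suminf_nonneg disc_summable mult_nonneg_nonneg stage_nonneg) auto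

lemma disc_rec:
  assumes \<beta>: "0 \<le> \<beta>" "\<beta> < 1" and s: "s \<in> space SS" and g: "g \<in> trees"
  shows "disc \<beta> s g = (\<Sum>\<gamma>\<in>{0,1}. loss_prob p \<gamma> * c s \<gamma> (g [])) +
    \<beta> * (\<Sum>\<gamma>\<in>{0,1}. \<Sum>j\<in>{0,1,2}. w \<gamma> j * disc \<beta> (L s \<gamma> (g [])) (\<lambda>h. g (j # h)))"
proof -
  have sm: "summable (\<lambda>k. \<beta> ^ k * stage k (L s \<gamma> (g [])) (\<lambda>h. g (j # h)))" if "\<gamma> \<in> {0,1}" for \<gamma> j
    by (intro disc_summable \<beta> L_space [OF s that trees_root [OF g]] trees_sub [OF g])
  have "(\<lambda>k. \<Sum>\<gamma>\<in>{0,1}. \<Sum>j\<in>{0,1,2}. w \<gamma> j * (\<beta> ^ k * stage k (L s \<gamma> (g [])) (\<lambda>h. g (j # h))))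
      sums (\<Sum>\<gamma>\<in>{0,1}. \<Sum>j\<in>{0,1,2}. w \<gamma> j * disc \<beta> (L s \<gamma> (g [])) (\<lambda>h. g (j # h)))"
    unfolding disc_def by (intro sums_sum sums_mult summable_sums sm)
  then have "(\<lambda>k. \<beta> * (\<Sum>\<gamma>\<in>{0,1}. \<Sum>j\<in>{0,1,2}. w \<gamma> j * (\<beta> ^ k * stage k (L s \<gamma> (g [])) (\<lambda>h. g (j # h)))))
      sums (\<beta> * (\<Sum>\<gamma>\<in>{0,1}. \<Sum>j\<in>{0,1,2}. w \<gamma> j * disc \<beta> (L s \<gamma> (g [])) (\<lambda>h. g (j # h))))"
    by (rule sums_mult)
  moreover have "\<beta> * (\<Sum>\<gamma>\<in>{0,1}. \<Sum>j\<in>{0,1,2}. w \<gamma> j * (\<beta> ^ k * stage k (L s \<gamma> (g [])) (\<lambda>h. g (j # h))))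
      = \<beta> ^ Suc k * stage (Suc k) s g" for k
    unfolding stage.simps sum_distrib_left by (intro sum.cong refl) (simp add: mult_ac)
  ultimately have "(\<lambda>k. \<beta> ^ Suc k * stage (Suc k) s g) sums
      (\<beta> * (\<Sum>\<gamma>\<in>{0,1}. \<Sum>j\<in>{0,1,2}. w \<gamma> j * disc \<beta> (L s \<gamma> (g [])) (\<lambda>h. g (j # h))))"
    by (simp only:)
  then show ?thesis
    unfolding disc_def [of \<beta> s g]
    using suminf_split_head [OF disc_summable [OF \<beta> s g]] sums_unique by fastforce
qed

lemma disc_near:
  assumes \<beta>: "0 \<le> \<beta>" "\<beta> < 1" and s: "s \<in> space SS" and g: "g \<in> trees"
  shows "disc \<beta> s0 g \<le> disc \<beta> s g" "disc \<beta> s g \<le> disc \<beta> s0 g + K / (1 - r) * u s"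
proof -
  note near = stage_near [OF near_base [OF s] g]
  note sm = disc_summable [OF \<beta> s g] disc_summable [OF \<beta> s0 g]
  show "disc \<beta> s0 g \<le> disc \<beta> s g"
    unfolding disc_def using near \<beta> by (intro suminf_le sm mult_left_mono) auto
  have geo: "(\<lambda>k. K * u s * r ^ k) sums (K * u s * (1 / (1 - r)))"
    using r by (intro sums_mult geometric_sums) auto
  have le: "\<beta> ^ k * stage k s g \<le> \<beta> ^ k * stage k s0 g + K * u s * r ^ k" for k
  proof -
    have "\<beta> ^ k * stage k s g \<le> \<beta> ^ k * (stage k s0 g + K * (r ^ k * u s))"
      using near \<beta> by (intro mult_left_mono) auto
    also have "\<dots> = \<beta> ^ k * stage k s0 g + \<beta> ^ k * (K * u s * r ^ k)"
      by (simp add: algebra_simps)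
    also have "\<beta> ^ k * (K * u s * r ^ k) \<le> 1 * (K * u s * r ^ k)"
      using \<beta> r K u_nonneg [OF s] by (intro mult_right_mono power_le_one) auto
    finally show ?thesis by simp
  qed
  have "disc \<beta> s g \<le> (\<Sum>k. \<beta> ^ k * stage k s0 g + K * u s * r ^ k)"
    unfolding disc_def by (intro suminf_le sm summable_add sums_summable [OF geo] le)
  also have "\<dots> = disc \<beta> s0 g + K * u s * (1 / (1 - r))"
    unfolding disc_def
    by (simp only: suminf_add [symmetric] sm sums_summable [OF geo] sums_unique [OF geo])
  finally show "disc \<beta> s g \<le> disc \<beta> s0 g + K / (1 - r) * u s"
    by simp
qed

lemma disc_base_bound:
  assumes \<beta>: "0 \<le> \<beta>" "\<beta> < 1" and g: "g \<in> trees"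
  shows "(1 - \<beta>) * disc \<beta> s0 g \<le> K0 + K * u s0"
proof -
  have geo: "(\<lambda>k. (K0 + K * u s0) * \<beta> ^ k) sums ((K0 + K * u s0) * (1 / (1 - \<beta>)))"
    using \<beta> by (intro sums_mult geometric_sums) auto
  have "disc \<beta> s0 g \<le> (\<Sum>k. (K0 + K * u s0) * \<beta> ^ k)"
    unfolding disc_def using \<beta> stage_bound [OF s0 g]
    by (intro suminf_le disc_summable s0 g sums_summable [OF geo])
      (simp_all add: mult.commute mult_left_mono)
  also have "\<dots> = (K0 + K * u s0) / (1 - \<beta>)"
    using geo by (simp add: sums_iff)
  finally show ?thesis
    using \<beta> by (simp add: field_simps)
qed

end

section \<open>The information state\<close>

text \<open>The set function in \<open>info_update\<close> is a nonnegative combination of push-forwards of \<open>\<pi>\<close>, hence countably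
  additive, and integrals against it are the same combination of integrals.\<close>

lemma info_update_mixture:
  fixes SS :: "'s measure" and L :: "'s \<Rightarrow> nat \<Rightarrow> nat \<Rightarrow> 's"
  assumes \<pi>: "sets \<pi> = sets SS"
    and L: "\<And>\<gamma>. \<gamma> \<in> {0,1} \<Longrightarrow> (\<lambda>s. L s \<gamma> \<nu>) \<in> measurable SS SS"
    and f: "f \<in> borel_measurable SS"
  shows "(\<integral>\<^sup>+s. f s \<partial>info_update SS L p \<delta> \<eta> \<pi> j \<nu>) =
    (\<Sum>\<gamma>\<in>{0,1}. ennreal (ack_mat \<delta> \<eta> \<gamma> j * loss_prob p \<gamma> / ack_prob p \<delta> \<eta> j) * (\<integral>\<^sup>+s. f (L s \<gamma> \<nu>) \<partial>\<pi>))"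
proof -
  let ?\<Phi> = "info_update SS L p \<delta> \<eta> \<pi> j \<nu>"
  define k where "k = (\<lambda>\<gamma>. ennreal (ack_mat \<delta> \<eta> \<gamma> j * loss_prob p \<gamma> / ack_prob p \<delta> \<eta> j))"
  define D where "D = (\<lambda>\<gamma>. distr \<pi> SS (\<lambda>s. L s \<gamma> \<nu>))"
  define \<mu> where "\<mu> = (\<lambda>B. \<Sum>\<gamma>\<in>{0,1}. (\<integral>\<^sup>+P. emeasure (return SS (L P \<gamma> \<nu>)) B \<partial>\<pi>) * k \<gamma>)"
  have L\<pi>: "(\<lambda>s. L s \<gamma> \<nu>) \<in> measurable \<pi> SS" if "\<gamma> \<in> {0,1}" for \<gamma>
    using L [OF that] measurable_cong_sets [OF \<pi> refl] by blast
  have \<mu>_eq: "\<mu> B = (\<Sum>\<gamma>\<in>{0,1}. k \<gamma> * emeasure (D \<gamma>) B)" if B: "B \<in> sets SS" for B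
  proof -
    have "(\<integral>\<^sup>+P. emeasure (return SS (L P \<gamma> \<nu>)) B \<partial>\<pi>) = emeasure (D \<gamma>) B" if \<gamma>: "\<gamma> \<in> {0,1}" for \<gamma>
    proof -
      have "emeasure (D \<gamma>) B = (\<integral>\<^sup>+x. indicator B x \<partial>D \<gamma>)"
        using B by (simp add: D_def)
      also have "\<dots> = (\<integral>\<^sup>+P. indicator B (L P \<gamma> \<nu>) \<partial>\<pi>)"
        unfolding D_def using B by (intro nn_integral_distr L\<pi> \<gamma>) auto
      also have "\<dots> = (\<integral>\<^sup>+P. emeasure (return SS (L P \<gamma> \<nu>)) B \<partial>\<pi>)"
        using B by simp
      finally show ?thesis by simp
    qed
    then show ?thesis
      unfolding \<mu>_def by (intro sum.cong refl) (simp add: mult.commute)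
  qed
  have \<Phi>: "?\<Phi> = measure_of (space SS) (sets SS) \<mu>"
    unfolding info_update_def \<mu>_def k_def ack_prob_def ..
  have sets_\<Phi>: "sets ?\<Phi> = sets SS"
    unfolding \<Phi> by simp
  have meas: "h \<in> borel_measurable ?\<Phi>" "h \<in> borel_measurable (D \<gamma>)"
    if "h \<in> borel_measurable SS" for h :: "'s \<Rightarrow> ennreal" and \<gamma>
    using that measurable_cong_sets [OF sets_\<Phi> refl, of "borel :: ennreal measure"] by (simp_all add: D_def)
  have em: "emeasure ?\<Phi> B = (\<Sum>\<gamma>\<in>{0,1}. k \<gamma> * emeasure (D \<gamma>) B)" if B: "B \<in> sets SS" for B
  proof -
    have "emeasure ?\<Phi> B = \<mu> B"
    proof (rule emeasure_measure_of_sigma [OF sets.sigma_algebra_axioms _ _ B, of \<mu>, folded \<Phi>])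
      show "positive (sets SS) \<mu>"
        unfolding positive_def by (simp add: \<mu>_eq)
      show "countably_additive (sets SS) \<mu>"
      proof (rule countably_additiveI)
        fix F :: "nat \<Rightarrow> 's set"
        assume F: "range F \<subseteq> sets SS" "disjoint_family F" "(\<Union>i. F i) \<in> sets SS"
        have "(\<Sum>i. \<mu> (F i)) = (\<Sum>i. \<Sum>\<gamma>\<in>{0,1}. k \<gamma> * emeasure (D \<gamma>) (F i))"
          using F by (intro suminf_cong \<mu>_eq) auto
        also have "\<dots> = (\<Sum>\<gamma>\<in>{0,1}. k \<gamma> * (\<Sum>i. emeasure (D \<gamma>) (F i)))"
          by (simp add: suminf_add [symmetric] ennreal_suminf_cmult)
        also have "\<dots> = (\<Sum>\<gamma>\<in>{0,1}. k \<gamma> * emeasure (D \<gamma>) (\<Union>i. F i))"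
          using F by (intro sum.cong refl arg_cong2 [where f="(*)"] suminf_emeasure) (auto simp: D_def)
        finally show "(\<Sum>i. \<mu> (F i)) = \<mu> (\<Union>i. F i)"
          using F by (simp add: \<mu>_eq)
      qed
    qed
    then show ?thesis
      using \<mu>_eq [OF B] by simp
  qed
  have "f \<in> borel_measurable SS \<Longrightarrow> (\<integral>\<^sup>+s. f s \<partial>?\<Phi>) = (\<Sum>\<gamma>\<in>{0,1}. k \<gamma> * (\<integral>\<^sup>+s. f s \<partial>D \<gamma>))"
  proof (induction rule: borel_measurable_induct)
    case (cong f g)
    have "(\<integral>\<^sup>+s. f s \<partial>?\<Phi>) = (\<integral>\<^sup>+s. g s \<partial>?\<Phi>)" "(\<integral>\<^sup>+s. f s \<partial>D \<gamma>) = (\<integral>\<^sup>+s. g s \<partial>D \<gamma>)" for \<gamma>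
      using cong(3) sets_eq_imp_space_eq [OF sets_\<Phi>] by (auto intro!: nn_integral_cong simp: D_def)
    then show ?case
      using cong(4) by simp
  next
    case (set B)
    then show ?case
      using em [OF set] sets_\<Phi> by (simp add: D_def)
  next
    case (mult g a)
    have "g \<in> borel_measurable ?\<Phi>" "\<And>\<gamma>. g \<in> borel_measurable (D \<gamma>)"
      using mult.hyps meas by blast+
    then show ?case
      using mult by (simp add: nn_integral_cmult distrib_left mult.left_commute)
  next
    case (add g h)
    have "g \<in> borel_measurable ?\<Phi>" "h \<in> borel_measurable ?\<Phi>"
      "\<And>\<gamma>. g \<in> borel_measurable (D \<gamma>)" "\<And>\<gamma>. h \<in> borel_measurable (D \<gamma>)"
      using add.hyps meas by blast+
    then show ?case
      using add by (simp add: nn_integral_add distrib_left add_ac)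
  next
    case (seq U)
    have m: "U i \<in> borel_measurable ?\<Phi>" "U i \<in> borel_measurable (D \<gamma>)" for i \<gamma>
      using seq.hyps meas by blast+
    have inc: "incseq (\<lambda>i. \<integral>\<^sup>+s. U i s \<partial>D \<gamma>)" for \<gamma>
      by (rule incseq_SucI, rule nn_integral_mono, rule le_funD, rule incseq_SucD, rule seq.hyps)
    have pt: "(SUP i. U i) = (\<lambda>s. SUP i. U i s)"
      by (simp add: fun_eq_iff image_comp)
    have "(\<integral>\<^sup>+s. (SUP i. U i) s \<partial>?\<Phi>) = (SUP i. \<integral>\<^sup>+s. U i s \<partial>?\<Phi>)"
      unfolding pt by (rule nn_integral_monotone_convergence_SUP) (use seq m in auto)
    also have "\<dots> = (SUP i. k 0 * (\<integral>\<^sup>+s. U i s \<partial>D 0) + k 1 * (\<integral>\<^sup>+s. U i s \<partial>D 1))"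
      using seq.IH by simp
    also have "\<dots> = (SUP i. k 0 * (\<integral>\<^sup>+s. U i s \<partial>D 0)) + (SUP i. k 1 * (\<integral>\<^sup>+s. U i s \<partial>D 1))"
      using inc by (intro ennreal_SUP_add) (auto simp: incseq_def intro!: mult_left_mono)
    also have "\<dots> = k 0 * (SUP i. \<integral>\<^sup>+s. U i s \<partial>D 0) + k 1 * (SUP i. \<integral>\<^sup>+s. U i s \<partial>D 1)"
      by (simp add: SUP_mult_left_ennreal)
    also have "\<dots> = k 0 * (\<integral>\<^sup>+s. (SUP i. U i) s \<partial>D 0) + k 1 * (\<integral>\<^sup>+s. (SUP i. U i) s \<partial>D 1)"
      using seq m unfolding pt by (subst (1 2) nn_integral_monotone_convergence_SUP) auto
    finally show ?case
      by simp
  qed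
  moreover have "(\<integral>\<^sup>+s. f s \<partial>D \<gamma>) = (\<integral>\<^sup>+s. f (L s \<gamma> \<nu>) \<partial>\<pi>)" if "\<gamma> \<in> {0,1}" for \<gamma>
    unfolding D_def using f by (intro nn_integral_distr L\<pi> that) auto
  ultimately show ?thesis
    using f unfolding k_def by (simp cong: sum.cong)
qed

lemma sets_info_update: "sets (info_update SS L p \<delta> \<eta> \<pi> j \<nu>) = sets SS"
  unfolding info_update_def by simp

context transmission_mdp
begin

abbreviation \<Phi> :: "'s measure \<Rightarrow> nat \<Rightarrow> nat \<Rightarrow> 's measure" where
  "\<Phi> \<equiv> info_update SS L p \<delta> \<eta>"

abbreviation beliefs :: "'s measure set" where
  "beliefs \<equiv> space (prob_algebra SS)"

lemma belief_sets: "\<pi> \<in> beliefs \<Longrightarrow> sets \<pi> = sets SS"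
  and belief_space: "\<pi> \<in> beliefs \<Longrightarrow> space \<pi> = space SS"
  and belief_prob: "\<pi> \<in> beliefs \<Longrightarrow> prob_space \<pi>"
  by (auto simp: space_prob_algebra dest: sets_eq_imp_space_eq)

lemma belief_measurable: "\<pi> \<in> beliefs \<Longrightarrow> f \<in> measurable SS N \<Longrightarrow> f \<in> measurable \<pi> N"
  using measurable_cong_sets [OF belief_sets refl] by blast

lemma nn_integral_Phi:
  assumes \<pi>: "\<pi> \<in> beliefs" and \<nu>: "\<nu> \<in> {0,1}" and j: "j \<in> {0,1,2}" and q: "q j > 0"
    and f: "f \<in> borel_measurable SS"
  shows "ennreal (q j) * (\<integral>\<^sup>+s. f s \<partial>\<Phi> \<pi> j \<nu>) = (\<Sum>\<gamma>\<in>{0,1}. ennreal (w \<gamma> j) * (\<integral>\<^sup>+s. f (L s \<gamma> \<nu>) \<partial>\<pi>))"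
proof -
  have "ennreal (q j) * (\<integral>\<^sup>+s. f s \<partial>\<Phi> \<pi> j \<nu>) =
      (\<Sum>\<gamma>\<in>{0,1}. (ennreal (q j) * ennreal (ack_mat \<delta> \<eta> \<gamma> j * loss_prob p \<gamma> / q j)) * (\<integral>\<^sup>+s. f (L s \<gamma> \<nu>) \<partial>\<pi>))"
    using info_update_mixture [where L=L and f=f and \<nu>=\<nu>, OF belief_sets [OF \<pi>] L_measurable [OF _ \<nu>] f]
    by (simp only: sum_distrib_left mult.assoc)
  also have "\<dots> = (\<Sum>\<gamma>\<in>{0,1}. ennreal (w \<gamma> j) * (\<integral>\<^sup>+s. f (L s \<gamma> \<nu>) \<partial>\<pi>))"
  proof (rule sum.cong [OF refl], rule arg_cong2 [where f="(*)", OF _ refl])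
    fix \<gamma> :: nat assume \<gamma>: "\<gamma> \<in> {0,1}"
    show "ennreal (q j) * ennreal (ack_mat \<delta> \<eta> \<gamma> j * loss_prob p \<gamma> / q j) = ennreal (w \<gamma> j)"
      using w_nonneg [OF \<gamma> j] q by (simp add: ennreal_mult' [symmetric] mult.commute)
  qed
  finally show ?thesis .
qed

lemma Phi_beliefs:
  assumes \<pi>: "\<pi> \<in> beliefs" and \<nu>: "\<nu> \<in> {0,1}" and j: "j \<in> {0,1,2}" and q: "q j > 0"
  shows "\<Phi> \<pi> j \<nu> \<in> beliefs"
proof -
  have "ennreal (q j) * emeasure (\<Phi> \<pi> j \<nu>) (space (\<Phi> \<pi> j \<nu>)) = ennreal (q j)"
  proof -
    have "(\<integral>\<^sup>+s. 1 \<partial>\<pi>) = 1"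
      using prob_space.emeasure_space_1 [OF belief_prob [OF \<pi>]] by simp
    then have "ennreal (q j) * (\<integral>\<^sup>+s. 1 \<partial>\<Phi> \<pi> j \<nu>) = (\<Sum>\<gamma>\<in>{0,1}. ennreal (w \<gamma> j))"
      using nn_integral_Phi [OF \<pi> \<nu> j q, of "\<lambda>_. 1"] by simp
    also have "\<dots> = ennreal (q j)"
      unfolding q_eq using w_nonneg j by (intro sum_ennreal) auto
    finally show ?thesis by simp
  qed
  then have "emeasure (\<Phi> \<pi> j \<nu>) (space (\<Phi> \<pi> j \<nu>)) = 1"
    using q ennreal_mult_cancel_left [of "ennreal (q j)" _ 1] by simp
  then show ?thesis
    by (simp add: space_prob_algebra sets_info_update prob_spaceI)
qed

lemma integral_Phi:
  assumes \<pi>: "\<pi> \<in> beliefs" and \<nu>: "\<nu> \<in> {0,1}" and j: "j \<in> {0,1,2}" and q: "q j > 0"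
    and f: "f \<in> borel_measurable SS" "\<And>s. s \<in> space SS \<Longrightarrow> 0 \<le> f s"
    and int: "\<And>\<gamma>. \<gamma> \<in> {0,1} \<Longrightarrow> w \<gamma> j > 0 \<Longrightarrow> integrable \<pi> (\<lambda>s. f (L s \<gamma> \<nu>))"
  shows "integrable (\<Phi> \<pi> j \<nu>) f"
    and "q j * (\<integral>s. f s \<partial>\<Phi> \<pi> j \<nu>) = (\<Sum>\<gamma>\<in>{0,1}. w \<gamma> j * (\<integral>s. f (L s \<gamma> \<nu>) \<partial>\<pi>))"
proof -
  note \<Phi> = Phi_beliefs [OF \<pi> \<nu> j q]
  have f0: "AE s in \<Phi> \<pi> j \<nu>. 0 \<le> f s"
    using f(2) belief_space [OF \<Phi>] by (intro AE_I2) auto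
  have fL0: "AE s in \<pi>. 0 \<le> f (L s \<gamma> \<nu>)" if "\<gamma> \<in> {0,1}" for \<gamma>
    using f(2) L_space [OF _ that \<nu>] belief_space [OF \<pi>] by (intro AE_I2) auto
  have sum: "(\<Sum>\<gamma>\<in>{0,1}. ennreal (w \<gamma> j) * (\<integral>\<^sup>+s. f (L s \<gamma> \<nu>) \<partial>\<pi>)) =
      ennreal (\<Sum>\<gamma>\<in>{0,1}. w \<gamma> j * (\<integral>s. f (L s \<gamma> \<nu>) \<partial>\<pi>))"
  proof -
    have "(\<Sum>\<gamma>\<in>{0,1}. ennreal (w \<gamma> j) * (\<integral>\<^sup>+s. f (L s \<gamma> \<nu>) \<partial>\<pi>)) =
        (\<Sum>\<gamma>\<in>{0,1}. ennreal (w \<gamma> j * (\<integral>s. f (L s \<gamma> \<nu>) \<partial>\<pi>)))"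
    proof (rule sum.cong [OF refl])
      fix \<gamma> :: nat assume \<gamma>: "\<gamma> \<in> {0,1}"
      show "ennreal (w \<gamma> j) * (\<integral>\<^sup>+s. f (L s \<gamma> \<nu>) \<partial>\<pi>) = ennreal (w \<gamma> j * (\<integral>s. f (L s \<gamma> \<nu>) \<partial>\<pi>))"
      proof (cases "w \<gamma> j > 0")
        case True
        then show ?thesis
          using nn_integral_eq_integral [OF int fL0] \<gamma> by (simp add: ennreal_mult')
      next
        case False
        then have "w \<gamma> j = 0" using w_nonneg [OF \<gamma> j] by linarith
        then show ?thesis by (simp only: mult_zero_left ennreal_0)
      qed
    qed
    also have "\<dots> = ennreal (\<Sum>\<gamma>\<in>{0,1}. w \<gamma> j * (\<integral>s. f (L s \<gamma> \<nu>) \<partial>\<pi>))"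
      by (intro sum_ennreal mult_nonneg_nonneg [OF w_nonneg [OF _ j]] integral_nonneg_AE fL0)
    finally show ?thesis .
  qed
  have fm: "f \<in> borel_measurable (\<Phi> \<pi> j \<nu>)"
    by (rule belief_measurable [OF \<Phi> f(1)])
  have eq: "ennreal (q j) * (\<integral>\<^sup>+s. f s \<partial>\<Phi> \<pi> j \<nu>) = ennreal (\<Sum>\<gamma>\<in>{0,1}. w \<gamma> j * (\<integral>s. f (L s \<gamma> \<nu>) \<partial>\<pi>))"
    using nn_integral_Phi [OF \<pi> \<nu> j q, of "\<lambda>s. ennreal (f s)"] f(1) unfolding sum by simp
  have "(\<integral>\<^sup>+s. f s \<partial>\<Phi> \<pi> j \<nu>) < \<infinity>"
  proof (rule ccontr)
    assume "\<not> ?thesis"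
    then have "(\<integral>\<^sup>+s. f s \<partial>\<Phi> \<pi> j \<nu>) = \<infinity>"
      by (metis infinity_ennreal_def less_top)
    then show False
      using eq q by (simp add: ennreal_mult_eq_top_iff)
  qed
  then show int\<Phi>: "integrable (\<Phi> \<pi> j \<nu>) f"
    using fm f0 by (intro integrableI_nonneg)
  have "ennreal (q j * (\<integral>s. f s \<partial>\<Phi> \<pi> j \<nu>)) = ennreal (\<Sum>\<gamma>\<in>{0,1}. w \<gamma> j * (\<integral>s. f (L s \<gamma> \<nu>) \<partial>\<pi>))"
    using eq q unfolding nn_integral_eq_integral [OF int\<Phi> f0] by (simp add: ennreal_mult')
  then show "q j * (\<integral>s. f s \<partial>\<Phi> \<pi> j \<nu>) = (\<Sum>\<gamma>\<in>{0,1}. w \<gamma> j * (\<integral>s. f (L s \<gamma> \<nu>) \<partial>\<pi>))"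
    using q by (subst (asm) ennreal_inj)
      (auto intro!: mult_nonneg_nonneg integral_nonneg_AE f0 fL0 sum_nonneg w_nonneg j add_nonneg_nonneg)
qed

definition finite_moment :: "'s measure set" where
  "finite_moment = {\<pi> \<in> beliefs. integrable \<pi> u}"

definition dominated :: "('s \<Rightarrow> real) \<Rightarrow> bool" where
  "dominated f \<longleftrightarrow> f \<in> borel_measurable SS \<and> (\<exists>a\<ge>0. \<forall>s\<in>space SS. 0 \<le> f s \<and> f s \<le> a * (1 + u s))"

lemma finite_momentD: "\<pi> \<in> finite_moment \<Longrightarrow> \<pi> \<in> beliefs" "\<pi> \<in> finite_moment \<Longrightarrow> integrable \<pi> u"
  unfolding finite_moment_def by auto

lemma dominatedD: "dominated f \<Longrightarrow> f \<in> borel_measurable SS" "dominated f \<Longrightarrow> s \<in> space SS \<Longrightarrow> 0 \<le> f s"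
  unfolding dominated_def by auto

lemma dominated_u: "dominated u"
  unfolding dominated_def using u_nonneg by (auto intro!: exI [of _ 1])

lemma dominated_integrable:
  assumes \<pi>: "\<pi> \<in> finite_moment" and f: "dominated f"
  shows "integrable \<pi> f"
proof -
  interpret prob_space \<pi>
    using finite_momentD \<pi> belief_prob by blast
  obtain a where a: "\<And>s. s \<in> space SS \<Longrightarrow> 0 \<le> f s \<and> f s \<le> a * (1 + u s)"
    using f unfolding dominated_def by blast
  show ?thesis
  proof (rule Bochner_Integration.integrable_bound)
    show "integrable \<pi> (\<lambda>s. a * (1 + u s))"
      using finite_momentD [OF \<pi>] by auto
    show "f \<in> borel_measurable \<pi>"
      using dominatedD f finite_momentD \<pi> belief_measurable by blast
    show "AE s in \<pi>. norm (f s) \<le> norm (a * (1 + u s))"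
      using a belief_space [OF finite_momentD(1) [OF \<pi>]] by (intro AE_I2) force
  qed
qed

lemma integral_dominated_nonneg: "\<pi> \<in> beliefs \<Longrightarrow> dominated f \<Longrightarrow> 0 \<le> (\<integral>s. f s \<partial>\<pi>)"
  using dominatedD(2) belief_space by (intro integral_nonneg_AE AE_I2) auto

lemma dominated_L:
  assumes f: "dominated f" and "\<gamma> \<in> {0,1}" "\<nu> \<in> {0,1}"
  shows "dominated (\<lambda>s. f (L s \<gamma> \<nu>))"
proof -
  obtain a where a: "0 \<le> a" "\<And>s. s \<in> space SS \<Longrightarrow> 0 \<le> f s \<and> f s \<le> a * (1 + u s)"
    using f unfolding dominated_def by blast
  have "f (L s \<gamma> \<nu>) \<le> a * (1 + u s)" if "s \<in> space SS" for s
  proof -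
    have "f (L s \<gamma> \<nu>) \<le> a * (1 + u (L s \<gamma> \<nu>))"
      using a L_space [OF that assms(2,3)] by blast
    also have "\<dots> \<le> a * (1 + u s)"
      using drift [OF that assms(2,3)] a(1) by (intro mult_left_mono) auto
    finally show ?thesis .
  qed
  then show ?thesis
    unfolding dominated_def
    using a measurable_compose [OF L_measurable [OF assms(2,3)] dominatedD(1) [OF f]]
      L_space [OF _ assms(2,3)] by blast
qed

lemma dominatedI:
  assumes "f \<in> borel_measurable SS" "\<And>s. s \<in> space SS \<Longrightarrow> 0 \<le> f s"
    and "\<And>s. s \<in> space SS \<Longrightarrow> f s \<le> a + b * u s"
  shows "dominated f"
proof -
  have "f s \<le> (\<bar>a\<bar> + \<bar>b\<bar>) * (1 + u s)" if "s \<in> space SS" for s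
  proof -
    have "a + b * u s \<le> \<bar>a\<bar> + \<bar>b\<bar> * u s"
      using u_nonneg [OF that] by (intro add_mono mult_right_mono) auto
    also have "\<dots> \<le> (\<bar>a\<bar> + \<bar>b\<bar>) * (1 + u s)"
      using u_nonneg [OF that] by (simp add: algebra_simps)
    finally show ?thesis using assms(3) [OF that] by linarith
  qed
  then show ?thesis
    unfolding dominated_def using assms(1,2) by (auto intro!: exI [of _ "\<bar>a\<bar> + \<bar>b\<bar>"])
qed

lemma dominated_cost: "\<gamma> \<in> {0,1} \<Longrightarrow> \<nu> \<in> {0,1} \<Longrightarrow> dominated (\<lambda>s. c s \<gamma> \<nu>)"
  by (rule dominatedI [OF c_measurable c_nonneg cost_bound])

lemma dominated_stage: "g \<in> trees \<Longrightarrow> dominated (\<lambda>s. stage k s g)"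
  by (rule dominatedI [OF stage_measurable stage_nonneg stage_bound])

lemma dominated_disc: "0 \<le> \<beta> \<Longrightarrow> \<beta> < 1 \<Longrightarrow> g \<in> trees \<Longrightarrow> dominated (\<lambda>s. disc \<beta> s g)"
  by (rule dominatedI [OF disc_measurable disc_nonneg disc_near(2)])

lemma finite_moment_Phi:
  assumes "\<pi> \<in> finite_moment" "\<nu> \<in> {0,1}" "j \<in> {0,1,2}" "q j > 0"
  shows "\<Phi> \<pi> j \<nu> \<in> finite_moment"
  unfolding finite_moment_def
  using Phi_beliefs [OF finite_momentD(1)] assms
    integral_Phi(1) [OF finite_momentD(1) _ _ _ u_measurable u_nonneg dominated_integrable [OF _ dominated_L [OF dominated_u]]]
  by blast

text \<open>Bayes' rule in integrated form: the normalizing constant \<open>q j\<close> of the update cancels when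
  the posterior is averaged over the acknowledgment.\<close>

lemma average_Phi:
  assumes \<pi>: "\<pi> \<in> finite_moment" and \<nu>: "\<nu> \<in> {0,1}" and f: "\<And>j. j \<in> {0,1,2} \<Longrightarrow> dominated (f j)"
  shows "(\<Sum>j\<in>{0,1,2}. q j * (\<integral>s. f j s \<partial>\<Phi> \<pi> j \<nu>)) =
    (\<integral>s. (\<Sum>\<gamma>\<in>{0,1}. \<Sum>j\<in>{0,1,2}. w \<gamma> j * f j (L s \<gamma> \<nu>)) \<partial>\<pi>)"
proof -
  have int: "integrable \<pi> (\<lambda>s. f j (L s \<gamma> \<nu>))" if "\<gamma> \<in> {0,1}" "j \<in> {0,1,2}" for \<gamma> j
    by (intro dominated_integrable \<pi> dominated_L f that \<nu>)
  have "q j * (\<integral>s. f j s \<partial>\<Phi> \<pi> j \<nu>) = (\<Sum>\<gamma>\<in>{0,1}. w \<gamma> j * (\<integral>s. f j (L s \<gamma> \<nu>) \<partial>\<pi>))"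
    if j: "j \<in> {0,1,2}" for j
  proof (cases "q j > 0")
    case True
    then show ?thesis
      by (intro integral_Phi finite_momentD \<pi> \<nu> j dominatedD f int)
  next
    case False
    then have q0: "q j = 0" using q_nonneg [OF j] by linarith
    have "(\<Sum>\<gamma>\<in>{0,1}. w \<gamma> j * (\<integral>s. f j (L s \<gamma> \<nu>) \<partial>\<pi>)) = 0"
      by (intro sum.neutral ballI) (simp only: w_zero [OF j q0] mult_zero_left)
    then show ?thesis
      using q0 by (simp only: mult_zero_left)
  qed
  then have "(\<Sum>j\<in>{0,1,2}. q j * (\<integral>s. f j s \<partial>\<Phi> \<pi> j \<nu>)) =
      (\<Sum>j\<in>{0,1,2}. \<Sum>\<gamma>\<in>{0,1}. w \<gamma> j * (\<integral>s. f j (L s \<gamma> \<nu>) \<partial>\<pi>))"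
    by (rule sum.cong [OF refl])
  also have "\<dots> = (\<Sum>\<gamma>\<in>{0,1}. \<Sum>j\<in>{0,1,2}. w \<gamma> j * (\<integral>s. f j (L s \<gamma> \<nu>) \<partial>\<pi>))"
    by (rule sum.swap)
  also have "\<dots> = (\<Sum>\<gamma>\<in>{0,1}. \<Sum>j\<in>{0,1,2}. (\<integral>s. w \<gamma> j * f j (L s \<gamma> \<nu>) \<partial>\<pi>))"
    by (intro sum.cong refl integral_mult_right_zero [symmetric])
  also have "\<dots> = (\<Sum>\<gamma>\<in>{0,1}. (\<integral>s. (\<Sum>j\<in>{0,1,2}. w \<gamma> j * f j (L s \<gamma> \<nu>)) \<partial>\<pi>))"
    by (intro sum.cong refl Bochner_Integration.integral_sum [symmetric] integrable_mult_right int)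
  also have "\<dots> = (\<integral>s. (\<Sum>\<gamma>\<in>{0,1}. \<Sum>j\<in>{0,1,2}. w \<gamma> j * f j (L s \<gamma> \<nu>)) \<partial>\<pi>)"
    by (intro Bochner_Integration.integral_sum [symmetric] Bochner_Integration.integrable_sum
        integrable_mult_right int)
  finally show ?thesis .
qed

lemma average_Phi_u:
  assumes \<pi>: "\<pi> \<in> finite_moment" and \<nu>: "\<nu> \<in> {0,1}"
  shows "(\<Sum>j\<in>{0,1,2}. q j * (\<integral>s. u s \<partial>\<Phi> \<pi> j \<nu>)) \<le> (\<integral>s. u s \<partial>\<pi>)"
proof -
  have "(\<Sum>j\<in>{0,1,2}. q j * (\<integral>s. u s \<partial>\<Phi> \<pi> j \<nu>)) =
      (\<integral>s. (\<Sum>\<gamma>\<in>{0,1}. \<Sum>j\<in>{0,1,2}. w \<gamma> j * u (L s \<gamma> \<nu>)) \<partial>\<pi>)"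
    by (rule average_Phi [OF \<pi> \<nu> dominated_u])
  also have "\<dots> \<le> (\<integral>s. u s \<partial>\<pi>)"
  proof (rule integral_mono_AE)
    show "integrable \<pi> (\<lambda>s. \<Sum>\<gamma>\<in>{0,1}. \<Sum>j\<in>{0,1,2}. w \<gamma> j * u (L s \<gamma> \<nu>))"
      by (intro Bochner_Integration.integrable_sum integrable_mult_right dominated_integrable \<pi> dominated_L \<nu> dominated_u)
    show "integrable \<pi> u" by (rule finite_momentD [OF \<pi>])
    have "(\<Sum>\<gamma>\<in>{0,1}. \<Sum>j\<in>{0,1,2}. w \<gamma> j * u (L s \<gamma> \<nu>)) \<le> u s" if "s \<in> space SS" for s
    proof -
      have "(\<Sum>\<gamma>\<in>{0,1}. \<Sum>j\<in>{0,1,2}. w \<gamma> j * u (L s \<gamma> \<nu>)) \<le> (\<Sum>\<gamma>\<in>{0,1}. \<Sum>j\<in>{0,1,2}. w \<gamma> j * u s)"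
        by (intro w_avg_mono drift that \<nu>)
      then show ?thesis unfolding w_avg_const .
    qed
    then show "AE s in \<pi>. (\<Sum>\<gamma>\<in>{0,1}. \<Sum>j\<in>{0,1,2}. w \<gamma> j * u (L s \<gamma> \<nu>)) \<le> u s"
      by (intro AE_I2) (simp only: belief_space [OF finite_momentD(1) [OF \<pi>]])
  qed
  finally show ?thesis .
qed

definition mean_cost :: "'s measure \<Rightarrow> nat \<Rightarrow> real" where
  "mean_cost \<pi> \<nu> = (\<Sum>\<gamma>\<in>{0,1}. loss_prob p \<gamma> * (\<integral>s. c s \<gamma> \<nu> \<partial>\<pi>))"

lemma mean_cost_integral:
  assumes "\<pi> \<in> finite_moment" "\<nu> \<in> {0,1}"
  shows "mean_cost \<pi> \<nu> = (\<integral>s. (\<Sum>\<gamma>\<in>{0,1}. loss_prob p \<gamma> * c s \<gamma> \<nu>) \<partial>\<pi>)"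
    and "integrable \<pi> (\<lambda>s. (\<Sum>\<gamma>\<in>{0,1}. loss_prob p \<gamma> * c s \<gamma> \<nu>))"
proof -
  have int: "integrable \<pi> (\<lambda>s. loss_prob p \<gamma> * c s \<gamma> \<nu>)" if "\<gamma> \<in> {0,1}" for \<gamma>
    by (intro integrable_mult_right dominated_integrable dominated_cost that assms)
  have "mean_cost \<pi> \<nu> = (\<Sum>\<gamma>\<in>{0,1}. (\<integral>s. loss_prob p \<gamma> * c s \<gamma> \<nu> \<partial>\<pi>))"
    unfolding mean_cost_def by (intro sum.cong refl integral_mult_right_zero [symmetric])
  also have "\<dots> = (\<integral>s. (\<Sum>\<gamma>\<in>{0,1}. loss_prob p \<gamma> * c s \<gamma> \<nu>) \<partial>\<pi>)"
    by (intro Bochner_Integration.integral_sum [symmetric] int)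
  finally show "mean_cost \<pi> \<nu> = (\<integral>s. (\<Sum>\<gamma>\<in>{0,1}. loss_prob p \<gamma> * c s \<gamma> \<nu>) \<partial>\<pi>)" .
  show "integrable \<pi> (\<lambda>s. (\<Sum>\<gamma>\<in>{0,1}. loss_prob p \<gamma> * c s \<gamma> \<nu>))"
    by (intro Bochner_Integration.integrable_sum int)
qed

lemma stage_integral_Suc:
  assumes \<pi>: "\<pi> \<in> finite_moment" and g: "g \<in> trees"
  shows "(\<integral>s. stage (Suc k) s g \<partial>\<pi>) =
    (\<Sum>j\<in>{0,1,2}. q j * (\<integral>s. stage k s (\<lambda>h. g (j # h)) \<partial>\<Phi> \<pi> j (g [])))"
  unfolding stage.simps
  by (rule average_Phi [OF \<pi> trees_root [OF g] dominated_stage [OF trees_sub [OF g]], symmetric])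

lemma disc_integral_rec:
  assumes \<pi>: "\<pi> \<in> finite_moment" and g: "g \<in> trees" and \<beta>: "0 \<le> \<beta>" "\<beta> < 1"
  shows "(\<integral>s. disc \<beta> s g \<partial>\<pi>) = mean_cost \<pi> (g []) +
    \<beta> * (\<Sum>j\<in>{0,1,2}. q j * (\<integral>s. disc \<beta> s (\<lambda>h. g (j # h)) \<partial>\<Phi> \<pi> j (g [])))"
proof -
  have "(\<integral>s. disc \<beta> s g \<partial>\<pi>) = (\<integral>s. (\<Sum>\<gamma>\<in>{0,1}. loss_prob p \<gamma> * c s \<gamma> (g [])) +
    \<beta> * (\<Sum>\<gamma>\<in>{0,1}. \<Sum>j\<in>{0,1,2}. w \<gamma> j * disc \<beta> (L s \<gamma> (g [])) (\<lambda>h. g (j # h))) \<partial>\<pi>)"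
    by (intro Bochner_Integration.integral_cong refl disc_rec \<beta> g)
      (simp only: belief_space [OF finite_momentD(1) [OF \<pi>]])
  also have "\<dots> = (\<integral>s. (\<Sum>\<gamma>\<in>{0,1}. loss_prob p \<gamma> * c s \<gamma> (g [])) \<partial>\<pi>) +
     (\<integral>s. \<beta> * (\<Sum>\<gamma>\<in>{0,1}. \<Sum>j\<in>{0,1,2}. w \<gamma> j * disc \<beta> (L s \<gamma> (g [])) (\<lambda>h. g (j # h))) \<partial>\<pi>)"
    by (rule Bochner_Integration.integral_add [OF mean_cost_integral(2) [OF \<pi> trees_root [OF g]]])
      (intro Bochner_Integration.integrable_sum integrable_mult_right dominated_integrable [OF \<pi>]
        dominated_L [OF dominated_disc [OF \<beta> trees_sub [OF g]] _ trees_root [OF g]])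
  also have "\<dots> = mean_cost \<pi> (g []) +
    \<beta> * (\<Sum>j\<in>{0,1,2}. q j * (\<integral>s. disc \<beta> s (\<lambda>h. g (j # h)) \<partial>\<Phi> \<pi> j (g [])))"
    unfolding average_Phi [OF \<pi> trees_root [OF g] dominated_disc [OF \<beta> trees_sub [OF g]]]
      mean_cost_integral(1) [OF \<pi> trees_root [OF g]] integral_mult_right_zero ..
  finally show ?thesis .
qed

section \<open>Dynamic programming for the discounted problem\<close>

definition disc_value :: "real \<Rightarrow> 's measure \<Rightarrow> real" where
  "disc_value \<beta> \<pi> = (INF g\<in>trees. \<integral>s. disc \<beta> s g \<partial>\<pi>)"

lemma trees_nonempty: "trees \<noteq> {}"
  unfolding trees_def by (auto intro!: exI [of _ "\<lambda>_. 0"])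

lemma disc_value_bdd: "0 \<le> \<beta> \<Longrightarrow> \<beta> < 1 \<Longrightarrow> \<pi> \<in> beliefs \<Longrightarrow> bdd_below ((\<lambda>g. \<integral>s. disc \<beta> s g \<partial>\<pi>) ` trees)"
  by (rule bdd_belowI2 [of _ 0]) (intro integral_dominated_nonneg dominated_disc)

lemma disc_value_le: "0 \<le> \<beta> \<Longrightarrow> \<beta> < 1 \<Longrightarrow> \<pi> \<in> beliefs \<Longrightarrow> g \<in> trees \<Longrightarrow> disc_value \<beta> \<pi> \<le> (\<integral>s. disc \<beta> s g \<partial>\<pi>)"
  unfolding disc_value_def by (intro cINF_lower disc_value_bdd)

lemma disc_value_approx:
  assumes "0 < e"
  shows "\<exists>g\<in>trees. (\<integral>s. disc \<beta> s g \<partial>\<pi>) < disc_value \<beta> \<pi> + e"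
  using cInf_lessD [of "(\<lambda>g. \<integral>s. disc \<beta> s g \<partial>\<pi>) ` trees" "disc_value \<beta> \<pi> + e"] trees_nonempty assms
  unfolding disc_value_def by auto

text \<open>A tree is freely composed of its root and its subtrees, so the infimum over trees splits into
  a minimum over the root and independent infima over the subtrees.\<close>

lemma disc_value_bellman:
  assumes \<pi>: "\<pi> \<in> finite_moment" and \<beta>: "0 \<le> \<beta>" "\<beta> < 1"
  shows "disc_value \<beta> \<pi> = (MIN \<nu>\<in>{0,1}. mean_cost \<pi> \<nu> + \<beta> * (\<Sum>j\<in>{0,1,2}. q j * disc_value \<beta> (\<Phi> \<pi> j \<nu>)))"
    (is "_ = (MIN \<nu>\<in>{0,1}. ?B \<nu>)")
proof (rule antisym)
  have "?B (g []) \<le> (\<integral>s. disc \<beta> s g \<partial>\<pi>)" if g: "g \<in> trees" for g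
  proof -
    have "q j * disc_value \<beta> (\<Phi> \<pi> j (g [])) \<le> q j * (\<integral>s. disc \<beta> s (\<lambda>h. g (j # h)) \<partial>\<Phi> \<pi> j (g []))"
      if j: "j \<in> {0,1,2}" for j
    proof (cases "q j > 0")
      case True
      then show ?thesis
        using disc_value_le [OF \<beta> Phi_beliefs [OF finite_momentD(1) [OF \<pi>] trees_root [OF g] j True] trees_sub [OF g]]
        by (intro mult_left_mono) auto
    next
      case False
      then have "q j = 0" using q_nonneg [OF j] by linarith
      then show ?thesis by simp
    qed
    then have "(\<Sum>j\<in>{0,1,2}. q j * disc_value \<beta> (\<Phi> \<pi> j (g []))) \<le>
        (\<Sum>j\<in>{0,1,2}. q j * (\<integral>s. disc \<beta> s (\<lambda>h. g (j # h)) \<partial>\<Phi> \<pi> j (g [])))"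
      by (rule sum_mono)
    then show ?thesis
      unfolding disc_integral_rec [OF \<pi> g \<beta>] by (intro add_left_mono mult_left_mono \<beta>)
  qed
  moreover have "(MIN \<nu>\<in>{0,1}. ?B \<nu>) \<le> ?B (g [])" if "g \<in> trees" for g
    using trees_root [OF that] by (intro Min_le) auto
  ultimately show "(MIN \<nu>\<in>{0,1}. ?B \<nu>) \<le> disc_value \<beta> \<pi>"
    unfolding disc_value_def by (intro cINF_greatest trees_nonempty) (meson order_trans)
next
  have "disc_value \<beta> \<pi> \<le> ?B \<nu>" if \<nu>: "\<nu> \<in> {0,1}" for \<nu>
  proof (rule field_le_epsilon)
    fix e :: real assume e: "0 < e"
    have "\<forall>j. \<exists>g\<in>trees. (\<integral>s. disc \<beta> s g \<partial>\<Phi> \<pi> j \<nu>) < disc_value \<beta> (\<Phi> \<pi> j \<nu>) + e"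
      using disc_value_approx [OF e] by blast
    then obtain G where G: "\<And>j. G j \<in> trees"
      "\<And>j. (\<integral>s. disc \<beta> s (G j) \<partial>\<Phi> \<pi> j \<nu>) < disc_value \<beta> (\<Phi> \<pi> j \<nu>) + e"
      by metis
    define g where "g = (\<lambda>h. case h of [] \<Rightarrow> \<nu> | j # h' \<Rightarrow> G j h')"
    have g: "g \<in> trees"
      using G(1) \<nu> unfolding trees_def g_def by (auto split: list.split)
    have gs: "g [] = \<nu>" "\<And>j. (\<lambda>h. g (j # h)) = G j"
      unfolding g_def by auto
    have "disc_value \<beta> \<pi> \<le> (\<integral>s. disc \<beta> s g \<partial>\<pi>)"
      by (rule disc_value_le [OF \<beta> finite_momentD(1) [OF \<pi>] g])
    also have "\<dots> = mean_cost \<pi> \<nu> + \<beta> * (\<Sum>j\<in>{0,1,2}. q j * (\<integral>s. disc \<beta> s (G j) \<partial>\<Phi> \<pi> j \<nu>))"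
      unfolding disc_integral_rec [OF \<pi> g \<beta>] gs ..
    also have "\<dots> \<le> mean_cost \<pi> \<nu> + \<beta> * (\<Sum>j\<in>{0,1,2}. q j * (disc_value \<beta> (\<Phi> \<pi> j \<nu>) + e))"
      by (intro add_left_mono mult_left_mono sum_mono \<beta> q_nonneg less_imp_le [OF G(2)])
    also have "\<dots> = ?B \<nu> + \<beta> * e"
      by (simp only: distrib_left sum.distrib sum_distrib_right [symmetric] q_sum mult_1 add.assoc)
    also have "\<dots> \<le> ?B \<nu> + e"
      using \<beta> e by (simp add: mult_left_le_one_le)
    finally show "disc_value \<beta> \<pi> \<le> ?B \<nu> + e" .
  qed
  then show "disc_value \<beta> \<pi> \<le> (MIN \<nu>\<in>{0,1}. ?B \<nu>)"
    by (intro Min.boundedI) auto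
qed

definition base_value :: "real \<Rightarrow> real" where
  "base_value \<beta> = (INF g\<in>trees. disc \<beta> s0 g)"

lemma base_value_bounds:
  assumes "0 \<le> \<beta>" "\<beta> < 1"
  shows "0 \<le> base_value \<beta>" "(1 - \<beta>) * base_value \<beta> \<le> K0 + K * u s0"
proof -
  show "0 \<le> base_value \<beta>"
    unfolding base_value_def by (intro cINF_greatest trees_nonempty disc_nonneg s0 assms)
  obtain g where g: "g \<in> trees" using trees_nonempty by blast
  have "base_value \<beta> \<le> disc \<beta> s0 g"
    unfolding base_value_def using g disc_nonneg [OF assms s0] by (intro cINF_lower bdd_belowI2 [of _ 0])
  then show "(1 - \<beta>) * base_value \<beta> \<le> K0 + K * u s0"
    using disc_base_bound [OF assms g] mult_left_mono [of "base_value \<beta>" "disc \<beta> s0 g" "1 - \<beta>"] assms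
    by linarith
qed

lemma disc_value_near_base:
  assumes \<pi>: "\<pi> \<in> finite_moment" and \<beta>: "0 \<le> \<beta>" "\<beta> < 1"
  shows "base_value \<beta> \<le> disc_value \<beta> \<pi>" "disc_value \<beta> \<pi> \<le> base_value \<beta> + K / (1 - r) * (\<integral>s. u s \<partial>\<pi>)"
proof -
  interpret prob_space \<pi>
    using finite_momentD \<pi> belief_prob by blast
  have int: "integrable \<pi> (\<lambda>s. disc \<beta> s g)" if "g \<in> trees" for g
    by (intro dominated_integrable \<pi> dominated_disc \<beta> that)
  have sp: "space \<pi> = space SS"
    by (rule belief_space [OF finite_momentD(1) [OF \<pi>]])
  have bdd: "bdd_below (disc \<beta> s0 ` trees)"
    using disc_nonneg [OF \<beta> s0] by (intro bdd_belowI2 [of _ 0])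
  have lo: "disc \<beta> s0 g \<le> (\<integral>s. disc \<beta> s g \<partial>\<pi>)" if g: "g \<in> trees" for g
  proof -
    have "(\<integral>s. disc \<beta> s0 g \<partial>\<pi>) \<le> (\<integral>s. disc \<beta> s g \<partial>\<pi>)"
      using disc_near(1) [OF \<beta> _ g] sp by (intro integral_mono int g) auto
    then show ?thesis by (simp add: prob_space)
  qed
  have hi: "(\<integral>s. disc \<beta> s g \<partial>\<pi>) \<le> disc \<beta> s0 g + K / (1 - r) * (\<integral>s. u s \<partial>\<pi>)" if g: "g \<in> trees" for g
  proof -
    have "(\<integral>s. disc \<beta> s g \<partial>\<pi>) \<le> (\<integral>s. disc \<beta> s0 g + K / (1 - r) * u s \<partial>\<pi>)"
      using disc_near(2) [OF \<beta> _ g] sp finite_momentD(2) [OF \<pi>]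
      by (intro integral_mono int g Bochner_Integration.integrable_add integrable_mult_right) auto
    also have "\<dots> = disc \<beta> s0 g + K / (1 - r) * (\<integral>s. u s \<partial>\<pi>)"
      using finite_momentD(2) [OF \<pi>] by (subst Bochner_Integration.integral_add) (auto simp: prob_space)
    finally show ?thesis .
  qed
  show "base_value \<beta> \<le> disc_value \<beta> \<pi>"
    unfolding base_value_def disc_value_def by (rule cINF_mono [OF trees_nonempty bdd]) (use lo in blast)
  have "disc_value \<beta> \<pi> - K / (1 - r) * (\<integral>s. u s \<partial>\<pi>) \<le> disc \<beta> s0 g" if g: "g \<in> trees" for g
    using hi [OF g] disc_value_le [OF \<beta> finite_momentD(1) [OF \<pi>] g] by linarith
  then have "disc_value \<beta> \<pi> - K / (1 - r) * (\<integral>s. u s \<partial>\<pi>) \<le> base_value \<beta>"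
    unfolding base_value_def by (intro cINF_greatest trees_nonempty)
  then show "disc_value \<beta> \<pi> \<le> base_value \<beta> + K / (1 - r) * (\<integral>s. u s \<partial>\<pi>)"
    by linarith
qed

end

text \<open>Tychonoff's theorem gives a cluster point in the product of the intervals. Since the index set may be
  uncountable, no subsequence need converge, and convergence is along a finer filter.\<close>

lemma pointwise_cluster_function:
  fixes f :: "nat \<Rightarrow> 'i \<Rightarrow> real"
  assumes f: "\<And>n i. f n i \<in> {a i..b i}"
  shows "\<exists>F h. F \<noteq> bot \<and> F \<le> sequentially \<and> (\<forall>i. ((\<lambda>n. f n i) \<longlongrightarrow> h i) F \<and> h i \<in> {a i..b i})"
proof -
  define S where "S = (\<Pi>\<^sub>E i\<in>UNIV. {a i..b i})"
  have "compactin (product_topology (\<lambda>_. euclidean) UNIV) S"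
    unfolding S_def compactin_PiE by (simp add: compactin_euclidean_iff)
  then have "compact S"
    by (simp add: euclidean_product_topology compactin_euclidean_iff)
  moreover have "\<forall>\<^sub>F x in filtermap f sequentially. x \<in> S"
    using f unfolding S_def by (simp add: eventually_filtermap PiE_UNIV_domain)
  moreover have "filtermap f sequentially \<noteq> bot"
    by (simp add: filtermap_bot_iff)
  ultimately obtain h where h: "h \<in> S" "inf (nhds h) (filtermap f sequentially) \<noteq> bot"
    unfolding compact_filter by blast
  \<comment> \<open>The trace on the indices of the neighbourhoods of \<open>h\<close>.\<close>
  define F where "F = inf sequentially (filtercomap f (nhds h))"
  have "F \<noteq> bot"
  proof
    assume "F = bot"
    then have "eventually (\<lambda>_. False) F" by simp
    then obtain P Q where P: "eventually P sequentially" and Q: "eventually Q (filtercomap f (nhds h))"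
      and no: "\<And>n. P n \<Longrightarrow> Q n \<Longrightarrow> False"
      unfolding F_def eventually_inf by blast
    obtain R where R: "eventually R (nhds h)" "\<And>n. R (f n) \<Longrightarrow> Q n"
      using Q unfolding eventually_filtercomap by blast
    have "eventually (\<lambda>x. \<not> R x) (filtermap f sequentially)"
      unfolding eventually_filtermap using P by eventually_elim (use no R(2) in blast)
    then have "eventually (\<lambda>_. False) (inf (nhds h) (filtermap f sequentially))"
      unfolding eventually_inf using R(1) by blast
    then show False
      using h(2) by (simp add: trivial_limit_def)
  qed
  moreover have lim: "(f \<longlongrightarrow> h) F"
    unfolding F_def using filterlim_filtercomap by (rule filterlim_mono) auto
  have "((\<lambda>n. f n i) \<longlongrightarrow> h i) F" for i
  proof (rule topological_tendstoI)
    fix U :: "real set" assume "open U" "h i \<in> U"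
    then have "open ((\<lambda>x :: 'i \<Rightarrow> real. x i) -` U)" "h \<in> (\<lambda>x. x i) -` U"
      by (auto intro!: open_vimage continuous_on_product_coordinates)
    from topological_tendstoD [OF lim this] show "\<forall>\<^sub>F n in F. f n i \<in> U"
      by simp
  qed
  moreover have "F \<le> sequentially"
    unfolding F_def by simp
  ultimately show ?thesis
    using h(1) unfolding S_def by (intro exI [of _ F] exI [of _ h]) (auto simp: PiE_UNIV_domain)
qed

lemma Min_pair: "(MIN \<nu>\<in>{0,1::nat}. f \<nu>) = min (f 0) (f 1)"
  by simp

context transmission_mdp
begin

section \<open>The vanishing discount limit\<close>

lemma relative_bellman:
  assumes \<pi>: "\<pi> \<in> finite_moment" and \<beta>: "0 \<le> \<beta>" "\<beta> < 1"
    and H: "\<And>\<pi>. \<pi> \<in> finite_moment \<Longrightarrow> H \<pi> = disc_value \<beta> \<pi> - base_value \<beta>"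
  shows "(1 - \<beta>) * base_value \<beta> + H \<pi> = (MIN \<nu>\<in>{0,1}. mean_cost \<pi> \<nu> + \<beta> * (\<Sum>j\<in>{0,1,2}. q j * H (\<Phi> \<pi> j \<nu>)))"
proof -
  have "mean_cost \<pi> \<nu> + \<beta> * (\<Sum>j\<in>{0,1,2}. q j * disc_value \<beta> (\<Phi> \<pi> j \<nu>)) =
      mean_cost \<pi> \<nu> + \<beta> * (\<Sum>j\<in>{0,1,2}. q j * H (\<Phi> \<pi> j \<nu>)) + \<beta> * base_value \<beta>" if \<nu>: "\<nu> \<in> {0,1}" for \<nu>
  proof -
    have "q j * disc_value \<beta> (\<Phi> \<pi> j \<nu>) = q j * H (\<Phi> \<pi> j \<nu>) + q j * base_value \<beta>" if j: "j \<in> {0,1,2}" for j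
    proof (cases "q j > 0")
      case True
      then show ?thesis
        unfolding H [OF finite_moment_Phi [OF \<pi> \<nu> j True]] by (simp only: right_diff_distrib diff_add_cancel)
    next
      case False
      then have "q j = 0" using q_nonneg [OF j] by linarith
      then show ?thesis by simp
    qed
    then have "(\<Sum>j\<in>{0,1,2}. q j * disc_value \<beta> (\<Phi> \<pi> j \<nu>)) = (\<Sum>j\<in>{0,1,2}. q j * H (\<Phi> \<pi> j \<nu>) + q j * base_value \<beta>)"
      by (rule sum.cong [OF refl])
    also have "\<dots> = (\<Sum>j\<in>{0,1,2}. q j * H (\<Phi> \<pi> j \<nu>)) + base_value \<beta>"
      by (simp only: sum.distrib sum_distrib_right [symmetric] q_sum mult_1)
    finally show ?thesis
      by (simp only: distrib_left add.assoc)
  qed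
  then have "disc_value \<beta> \<pi> = (MIN \<nu>\<in>{0,1}. mean_cost \<pi> \<nu> + \<beta> * (\<Sum>j\<in>{0,1,2}. q j * H (\<Phi> \<pi> j \<nu>))) + \<beta> * base_value \<beta>"
    unfolding disc_value_bellman [OF \<pi> \<beta>] Min_pair by (simp only: insertI1 insertI2 min_add_distrib_left)
  then show ?thesis
    using H [OF \<pi>] by (simp only: left_diff_distrib mult_1)
qed

theorem bellman_finite_moment:
  "\<exists>\<rho> H. \<forall>\<pi>\<in>finite_moment. \<rho> + H \<pi> = (MIN \<nu>\<in>{0,1}. mean_cost \<pi> \<nu> + (\<Sum>j\<in>{0,1,2}. q j * H (\<Phi> \<pi> j \<nu>))) \<and>
     H \<pi> \<in> {0..K / (1 - r) * (\<integral>s. u s \<partial>\<pi>)}"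
proof -
  define \<beta> where "\<beta> = (\<lambda>n. 1 - inverse (real (Suc n)))"
  have \<beta>: "0 \<le> \<beta> n" "\<beta> n < 1" for n
    unfolding \<beta>_def by (auto simp: field_simps)
  have \<beta>_lim: "\<beta> \<longlonglongrightarrow> 1"
    unfolding \<beta>_def using tendsto_diff [OF tendsto_const LIMSEQ_inverse_real_of_nat, of 1] by simp
  have "\<forall>n. (1 - \<beta> n) * base_value (\<beta> n) \<in> {0..K0 + K * u s0}"
    using base_value_bounds \<beta> by (simp add: less_imp_le)
  then obtain \<rho> \<phi> where "\<rho> \<in> {0..K0 + K * u s0}" and \<phi>: "strict_mono \<phi>"
    and \<rho>: "((\<lambda>n. (1 - \<beta> n) * base_value (\<beta> n)) \<circ> \<phi>) \<longlonglongrightarrow> \<rho>"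
    by (rule seq_compactE [OF compact_imp_seq_compact [OF compact_Icc]])
  define f where "f = (\<lambda>n \<pi>. if \<pi> \<in> finite_moment then disc_value (\<beta> (\<phi> n)) \<pi> - base_value (\<beta> (\<phi> n)) else 0)"
  define b where "b = (\<lambda>\<pi>. if \<pi> \<in> finite_moment then K / (1 - r) * (\<integral>s. u s \<partial>\<pi>) else 0)"
  have "f n \<pi> \<in> {0..b \<pi>}" for n \<pi>
    using disc_value_near_base [OF _ \<beta>(1) [of "\<phi> n"] \<beta>(2) [of "\<phi> n"], of \<pi>] unfolding f_def b_def by (auto simp: algebra_simps)
  then obtain F H where F: "F \<noteq> bot" "F \<le> sequentially"
    and H: "\<And>\<pi>. ((\<lambda>n. f n \<pi>) \<longlongrightarrow> H \<pi>) F" "\<And>\<pi>. H \<pi> \<in> {0..b \<pi>}"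
    using pointwise_cluster_function [of f "\<lambda>_. 0" b] by blast
  have "\<rho> + H \<pi> = (MIN \<nu>\<in>{0,1}. mean_cost \<pi> \<nu> + (\<Sum>j\<in>{0,1,2}. q j * H (\<Phi> \<pi> j \<nu>)))" if \<pi>: "\<pi> \<in> finite_moment" for \<pi>
  proof (rule tendsto_unique [OF F(1)])
    have "((\<lambda>n. (1 - \<beta> (\<phi> n)) * base_value (\<beta> (\<phi> n))) \<longlongrightarrow> \<rho>) F"
      using tendsto_mono [OF F(2) \<rho>] by (simp add: comp_def)
    then show "((\<lambda>n. (1 - \<beta> (\<phi> n)) * base_value (\<beta> (\<phi> n)) + f n \<pi>) \<longlongrightarrow> \<rho> + H \<pi>) F"
      by (intro tendsto_add H)
    have "((\<lambda>n. \<beta> (\<phi> n)) \<longlongrightarrow> 1) F"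
      using tendsto_mono [OF F(2) LIMSEQ_subseq_LIMSEQ [OF \<beta>_lim \<phi>]] by (simp add: comp_def)
    then have "((\<lambda>n. MIN \<nu>\<in>{0,1}. mean_cost \<pi> \<nu> + \<beta> (\<phi> n) * (\<Sum>j\<in>{0,1,2}. q j * f n (\<Phi> \<pi> j \<nu>))) \<longlongrightarrow>
        (MIN \<nu>\<in>{0,1}. mean_cost \<pi> \<nu> + 1 * (\<Sum>j\<in>{0,1,2}. q j * H (\<Phi> \<pi> j \<nu>)))) F"
      unfolding Min_pair by (intro tendsto_min tendsto_add tendsto_mult tendsto_const tendsto_sum H)
    then show "((\<lambda>n. (1 - \<beta> (\<phi> n)) * base_value (\<beta> (\<phi> n)) + f n \<pi>) \<longlongrightarrow>
        (MIN \<nu>\<in>{0,1}. mean_cost \<pi> \<nu> + (\<Sum>j\<in>{0,1,2}. q j * H (\<Phi> \<pi> j \<nu>)))) F"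
      unfolding mult_1
      by (subst relative_bellman [OF \<pi> \<beta>, of "f _"]) (simp_all only: f_def if_True)
  qed
  moreover have "H \<pi> \<in> {0..K / (1 - r) * (\<integral>s. u s \<partial>\<pi>)}" if "\<pi> \<in> finite_moment" for \<pi>
    using H(2) [of \<pi>] that unfolding b_def by (simp only: if_True)
  ultimately show ?thesis
    by blast
qed

definition extended_cost :: "'s measure \<Rightarrow> nat \<Rightarrow> ennreal" where
  "extended_cost \<pi> \<nu> = (\<Sum>\<gamma>\<in>{0,1}. ennreal (loss_prob p \<gamma>) * (\<integral>\<^sup>+s. ennreal (c s \<gamma> \<nu>) \<partial>\<pi>))"

lemma mean_cost_nonneg: "\<pi> \<in> beliefs \<Longrightarrow> \<nu> \<in> {0,1} \<Longrightarrow> 0 \<le> mean_cost \<pi> \<nu>"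
  unfolding mean_cost_def by (intro sum_nonneg mult_nonneg_nonneg loss_nonneg integral_dominated_nonneg dominated_cost)

lemma extended_cost_finite_moment:
  assumes \<pi>: "\<pi> \<in> finite_moment" and \<nu>: "\<nu> \<in> {0,1}"
  shows "extended_cost \<pi> \<nu> = ennreal (mean_cost \<pi> \<nu>)"
proof -
  have "(\<integral>\<^sup>+s. ennreal (c s \<gamma> \<nu>) \<partial>\<pi>) = ennreal (\<integral>s. c s \<gamma> \<nu> \<partial>\<pi>)" if "\<gamma> \<in> {0,1}" for \<gamma>
    using dominatedD(2) [OF dominated_cost [OF that \<nu>]] belief_space [OF finite_momentD(1) [OF \<pi>]]
    by (intro nn_integral_eq_integral dominated_integrable \<pi> dominated_cost that \<nu> AE_I2) auto
  then have "extended_cost \<pi> \<nu> = (\<Sum>\<gamma>\<in>{0,1}. ennreal (loss_prob p \<gamma> * (\<integral>s. c s \<gamma> \<nu> \<partial>\<pi>)))"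
    unfolding extended_cost_def by (intro sum.cong refl) (simp only: ennreal_mult' loss_nonneg)
  also have "\<dots> = ennreal (mean_cost \<pi> \<nu>)"
    unfolding mean_cost_def
    by (intro sum_ennreal mult_nonneg_nonneg loss_nonneg integral_dominated_nonneg dominated_cost finite_momentD \<pi> \<nu>)
  finally show ?thesis .
qed

text \<open>This confines the states without a first moment to the first step: whenever the Bellman
  equation is finite there, it refers to states with a first moment only.\<close>

lemma finite_moment_Phi_if_finite_cost:
  assumes \<pi>: "\<pi> \<in> beliefs" and \<nu>: "\<nu> \<in> {0,1}" and fin: "extended_cost \<pi> \<nu> < \<infinity>"
    and j: "j \<in> {0,1,2}" and q: "q j > 0"
  shows "\<Phi> \<pi> j \<nu> \<in> finite_moment"
proof -
  interpret prob_space \<pi>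
    using belief_prob [OF \<pi>] .
  have sp: "space \<pi> = space SS"
    by (rule belief_space [OF \<pi>])
  have int: "integrable \<pi> (\<lambda>s. u (L s \<gamma> \<nu>))" if \<gamma>: "\<gamma> \<in> {0,1}" and w: "w \<gamma> j > 0" for \<gamma>
  proof -
    have "loss_prob p \<gamma> > 0"
      using w loss_nonneg [of \<gamma>] by (auto simp: zero_less_mult_iff)
    moreover have "ennreal (loss_prob p \<gamma>) * (\<integral>\<^sup>+s. ennreal (c s \<gamma> \<nu>) \<partial>\<pi>) < \<infinity>"
      using fin \<gamma> unfolding extended_cost_def by auto
    ultimately have "(\<integral>\<^sup>+s. ennreal (c s \<gamma> \<nu>) \<partial>\<pi>) < \<infinity>"
      by (metis ennreal_less_zero_iff ennreal_mult_top infinity_ennreal_def less_irrefl mult.commute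
          not_gr_zero top.not_eq_extremum)
    then have "integrable \<pi> (\<lambda>s. c s \<gamma> \<nu>)"
      using c_nonneg [OF _ \<gamma> \<nu>] belief_measurable [OF \<pi> c_measurable [OF \<gamma> \<nu>]] sp
      by (intro integrableI_nonneg AE_I2) auto
    then have "integrable \<pi> (\<lambda>s. K' * (c s \<gamma> \<nu> + 1))"
      by simp
    then show ?thesis
    proof (rule Bochner_Integration.integrable_bound)
      show "(\<lambda>s. u (L s \<gamma> \<nu>)) \<in> borel_measurable \<pi>"
        by (rule belief_measurable [OF \<pi> measurable_compose [OF L_measurable [OF \<gamma> \<nu>] u_measurable]])
      show "AE s in \<pi>. norm (u (L s \<gamma> \<nu>)) \<le> norm (K' * (c s \<gamma> \<nu> + 1))"
        using coercive [OF _ \<gamma> \<nu>] u_nonneg [OF L_space [OF _ \<gamma> \<nu>]] sp by (intro AE_I2) force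
    qed
  qed
  show ?thesis
    unfolding finite_moment_def
    using Phi_beliefs [OF \<pi> \<nu> j q] integral_Phi(1) [OF \<pi> \<nu> j q u_measurable u_nonneg int] by blast
qed

text \<open>On information states with infinite moment \<open>V\<close> is defined by the equation itself. Nothing circular
  arises, since decisions with finite cost lead back to finite moments and a decision with infinite
  cost contributes \<open>\<infinity>\<close> for any real value of \<open>V\<close>.\<close>

lemma bellman_extended:
  assumes eq: "\<And>\<pi>. \<pi> \<in> finite_moment \<Longrightarrow> \<rho> + H \<pi> = (MIN \<nu>\<in>{0,1}. mean_cost \<pi> \<nu> + (\<Sum>j\<in>{0,1,2}. q j * H (\<Phi> \<pi> j \<nu>)))"
  shows "\<exists>V. (\<forall>\<pi>\<in>finite_moment. V \<pi> = H \<pi>) \<and>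
     (\<forall>\<pi>\<in>beliefs. (\<exists>\<nu>\<in>{0,1}. extended_cost \<pi> \<nu> < \<infinity>) \<longrightarrow>
       ereal (\<rho> + V \<pi>) = (MIN \<nu>\<in>{0,1}. enn2ereal (extended_cost \<pi> \<nu>) + ereal (\<Sum>j\<in>{0,1,2}. q j * V (\<Phi> \<pi> j \<nu>))))"
proof -
  define B where "B = (\<lambda>W \<pi> \<nu>. enn2ereal (extended_cost \<pi> \<nu>) + ereal (\<Sum>j\<in>{0,1,2}. q j * W (\<Phi> \<pi> j \<nu>)))"
  define V where "V = (\<lambda>\<pi>. if \<pi> \<in> finite_moment then H \<pi> else real_of_ereal (MIN \<nu>\<in>{0,1}. B H \<pi> \<nu>) - \<rho>)"
  have BV: "B V \<pi> \<nu> = B H \<pi> \<nu>" if \<pi>: "\<pi> \<in> beliefs" and \<nu>: "\<nu> \<in> {0,1}" for \<pi> \<nu>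
  proof (cases "extended_cost \<pi> \<nu> < \<infinity>")
    case True
    have "q j * V (\<Phi> \<pi> j \<nu>) = q j * H (\<Phi> \<pi> j \<nu>)" if j: "j \<in> {0,1,2}" for j
    proof (cases "q j > 0")
      case True
      then show ?thesis
        using finite_moment_Phi_if_finite_cost [OF \<pi> \<nu> \<open>extended_cost \<pi> \<nu> < \<infinity>\<close> j] by (simp add: V_def)
    next
      case False
      then have "q j = 0" using q_nonneg [OF j] by linarith
      then show ?thesis by simp
    qed
    then show ?thesis
      unfolding B_def by (simp only: cong: sum.cong)
  next
    case False
    then have "extended_cost \<pi> \<nu> = \<infinity>" by (metis infinity_ennreal_def less_top)
    then have "enn2ereal (extended_cost \<pi> \<nu>) = \<infinity>" by simp
    then show ?thesis unfolding B_def by simp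
  qed
  have "ereal (\<rho> + V \<pi>) = (MIN \<nu>\<in>{0,1}. B V \<pi> \<nu>)"
    if \<pi>: "\<pi> \<in> beliefs" and fin: "\<exists>\<nu>\<in>{0,1}. extended_cost \<pi> \<nu> < \<infinity>" for \<pi>
  proof (cases "\<pi> \<in> finite_moment")
    case True
    have "B H \<pi> \<nu> = ereal (mean_cost \<pi> \<nu> + (\<Sum>j\<in>{0,1,2}. q j * H (\<Phi> \<pi> j \<nu>)))" if "\<nu> \<in> {0,1}" for \<nu>
      unfolding B_def extended_cost_finite_moment [OF True that]
      by (simp only: enn2ereal_ennreal mean_cost_nonneg [OF \<pi> that] plus_ereal.simps)
    then have "(MIN \<nu>\<in>{0,1}. B V \<pi> \<nu>) = ereal (MIN \<nu>\<in>{0,1}. mean_cost \<pi> \<nu> + (\<Sum>j\<in>{0,1,2}. q j * H (\<Phi> \<pi> j \<nu>)))"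
      unfolding Min_pair using BV [OF \<pi>] by (simp only: insertI1 insertI2 ereal_min)
    then show ?thesis
      using eq [OF True] True by (simp only: V_def if_True)
  next
    case False
    have notm: "B H \<pi> \<nu> \<noteq> -\<infinity>" for \<nu>
      using enn2ereal_nonneg [of "extended_cost \<pi> \<nu>"] by (cases "enn2ereal (extended_cost \<pi> \<nu>)") (auto simp: B_def)
    obtain \<nu> where \<nu>: "\<nu> \<in> {0,1}" "extended_cost \<pi> \<nu> < \<infinity>"
      using fin by blast
    then have "B H \<pi> \<nu> \<noteq> \<infinity>"
      unfolding B_def by (cases "extended_cost \<pi> \<nu>") (auto simp: enn2ereal_ennreal)
    moreover have "(MIN \<nu>\<in>{0,1}. B H \<pi> \<nu>) \<le> B H \<pi> \<nu>"
      using \<nu>(1) by (intro Min_le) auto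
    moreover have "(MIN \<nu>\<in>{0,1}. B H \<pi> \<nu>) \<noteq> -\<infinity>"
      unfolding Min_pair min_def using notm by simp
    ultimately have "ereal (real_of_ereal (MIN \<nu>\<in>{0,1}. B H \<pi> \<nu>)) = (MIN \<nu>\<in>{0,1}. B H \<pi> \<nu>)"
      by (intro ereal_real') auto
    moreover have "(MIN \<nu>\<in>{0,1}. B V \<pi> \<nu>) = (MIN \<nu>\<in>{0,1}. B H \<pi> \<nu>)"
      unfolding Min_pair using BV [OF \<pi>] by (simp only: insertI1 insertI2)
    ultimately show ?thesis
      using False by (simp add: V_def)
  qed
  moreover have "\<forall>\<pi>\<in>finite_moment. V \<pi> = H \<pi>"
    unfolding V_def by simp
  ultimately show ?thesis
    unfolding B_def by blast
qed

section \<open>Verification\<close>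

lemma total_cost_lower:
  assumes eq: "\<And>\<pi>. \<pi> \<in> finite_moment \<Longrightarrow> \<rho> + H \<pi> = (MIN \<nu>\<in>{0,1}. mean_cost \<pi> \<nu> + (\<Sum>j\<in>{0,1,2}. q j * H (\<Phi> \<pi> j \<nu>)))"
    and H: "\<And>\<pi>. \<pi> \<in> finite_moment \<Longrightarrow> H \<pi> \<le> a * (\<integral>s. u s \<partial>\<pi>)" and a: "0 \<le> a"
  shows "\<pi> \<in> finite_moment \<Longrightarrow> g \<in> trees \<Longrightarrow>
    T * \<rho> + H \<pi> \<le> (\<Sum>k<T. \<integral>s. stage k s g \<partial>\<pi>) + a * (\<integral>s. u s \<partial>\<pi>)"
proof (induction T arbitrary: \<pi> g)
  case 0
  then show ?case using H by simp
next
  case (Suc T)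
  note \<pi> = Suc.prems(1) and g = Suc.prems(2)
  note \<nu> = trees_root [OF g]
  define S where "S = (\<lambda>j. \<Sum>k<T. \<integral>s. stage k s (\<lambda>h. g (j # h)) \<partial>\<Phi> \<pi> j (g []))"
  have step: "q j * (T * \<rho>) + q j * H (\<Phi> \<pi> j (g [])) \<le> q j * S j + a * (q j * (\<integral>s. u s \<partial>\<Phi> \<pi> j (g [])))"
    if j: "j \<in> {0,1,2}" for j
  proof (cases "q j > 0")
    case True
    have "T * \<rho> + H (\<Phi> \<pi> j (g [])) \<le> S j + a * (\<integral>s. u s \<partial>\<Phi> \<pi> j (g []))"
      unfolding S_def by (rule Suc.IH [OF finite_moment_Phi [OF \<pi> \<nu> j True] trees_sub [OF g]])
    from mult_left_mono [OF this, of "q j"] True show ?thesis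
      by (simp add: algebra_simps)
  next
    case False
    then have "q j = 0" using q_nonneg [OF j] by linarith
    then show ?thesis by simp
  qed
  have "T * \<rho> + (\<Sum>j\<in>{0,1,2}. q j * H (\<Phi> \<pi> j (g []))) =
      (\<Sum>j\<in>{0,1,2}. q j * (T * \<rho>) + q j * H (\<Phi> \<pi> j (g [])))"
    by (simp only: sum.distrib sum_distrib_right [symmetric] q_sum mult_1)
  also have "\<dots> \<le> (\<Sum>j\<in>{0,1,2}. q j * S j + a * (q j * (\<integral>s. u s \<partial>\<Phi> \<pi> j (g []))))"
    by (intro sum_mono step)
  also have "\<dots> = (\<Sum>j\<in>{0,1,2}. q j * S j) + a * (\<Sum>j\<in>{0,1,2}. q j * (\<integral>s. u s \<partial>\<Phi> \<pi> j (g [])))"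
    by (simp only: sum.distrib sum_distrib_left)
  also have "\<dots> \<le> (\<Sum>j\<in>{0,1,2}. q j * S j) + a * (\<integral>s. u s \<partial>\<pi>)"
    by (intro add_left_mono mult_left_mono average_Phi_u \<pi> \<nu> a)
  also have "(\<Sum>j\<in>{0,1,2}. q j * S j) = (\<Sum>k<T. \<integral>s. stage (Suc k) s g \<partial>\<pi>)"
    unfolding S_def stage_integral_Suc [OF \<pi> g] sum_distrib_left by (rule sum.swap)
  finally have 1: "T * \<rho> + (\<Sum>j\<in>{0,1,2}. q j * H (\<Phi> \<pi> j (g []))) \<le>
      (\<Sum>k<T. \<integral>s. stage (Suc k) s g \<partial>\<pi>) + a * (\<integral>s. u s \<partial>\<pi>)" .
  have 2: "\<rho> + H \<pi> \<le> mean_cost \<pi> (g []) + (\<Sum>j\<in>{0,1,2}. q j * H (\<Phi> \<pi> j (g [])))"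
    unfolding eq [OF \<pi>] using \<nu> by (intro Min_le) auto
  have 3: "(\<Sum>k<Suc T. \<integral>s. stage k s g \<partial>\<pi>) = mean_cost \<pi> (g []) + (\<Sum>k<T. \<integral>s. stage (Suc k) s g \<partial>\<pi>)"
    unfolding sum.lessThan_Suc_shift mean_cost_integral(1) [OF \<pi> \<nu>] by (simp only: stage.simps(1))
  show ?case
    unfolding 3 using 1 2 by (simp only: of_nat_Suc distrib_right mult_1)
qed

primrec follow :: "('s measure \<Rightarrow> nat) \<Rightarrow> nat list \<Rightarrow> 's measure \<Rightarrow> nat" where
  "follow f [] \<pi> = f \<pi>"
| "follow f (j # h) \<pi> = follow f h (\<Phi> \<pi> j (f \<pi>))"

lemma follow_in: "(\<And>\<pi>. f \<pi> \<in> {0,1}) \<Longrightarrow> follow f h \<pi> \<in> {0,1}"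
  by (induction h arbitrary: \<pi>) simp_all

lemma total_cost_upper:
  assumes f: "\<And>\<pi>. f \<pi> \<in> {0,1}"
    and eq: "\<And>\<pi>. \<pi> \<in> finite_moment \<Longrightarrow> \<rho> + H \<pi> = mean_cost \<pi> (f \<pi>) + (\<Sum>j\<in>{0,1,2}. q j * H (\<Phi> \<pi> j (f \<pi>)))"
    and H: "\<And>\<pi>. \<pi> \<in> finite_moment \<Longrightarrow> 0 \<le> H \<pi>"
  shows "\<pi> \<in> finite_moment \<Longrightarrow> (\<Sum>k<T. \<integral>s. stage k s (\<lambda>h. follow f h \<pi>) \<partial>\<pi>) \<le> T * \<rho> + H \<pi>"
proof (induction T arbitrary: \<pi>)
  case 0
  then show ?case using H by simp
next
  case (Suc T)
  note \<pi> = Suc.prems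
  define g where "g = (\<lambda>h. follow f h \<pi>)"
  have g: "g \<in> trees"
    unfolding g_def trees_def using follow_in [of f, OF f] by blast
  have g0: "g [] = f \<pi>" "\<And>j. (\<lambda>h. g (j # h)) = (\<lambda>h. follow f h (\<Phi> \<pi> j (f \<pi>)))"
    unfolding g_def by simp_all
  note \<nu> = f [of \<pi>]
  define S where "S = (\<lambda>j. \<Sum>k<T. \<integral>s. stage k s (\<lambda>h. g (j # h)) \<partial>\<Phi> \<pi> j (f \<pi>))"
  have step: "q j * S j \<le> q j * (T * \<rho>) + q j * H (\<Phi> \<pi> j (f \<pi>))" if j: "j \<in> {0,1,2}" for j
  proof (cases "q j > 0")
    case True
    have "S j \<le> T * \<rho> + H (\<Phi> \<pi> j (f \<pi>))"
      unfolding S_def g0 by (rule Suc.IH [OF finite_moment_Phi [OF \<pi> \<nu> j True]])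
    from mult_left_mono [OF this, of "q j"] True show ?thesis
      by (simp add: algebra_simps)
  next
    case False
    then have "q j = 0" using q_nonneg [OF j] by linarith
    then show ?thesis by simp
  qed
  have "(\<Sum>k<T. \<integral>s. stage (Suc k) s g \<partial>\<pi>) = (\<Sum>j\<in>{0,1,2}. q j * S j)"
    unfolding S_def stage_integral_Suc [OF \<pi> g] g0(1) sum_distrib_left by (rule sum.swap)
  also have "\<dots> \<le> (\<Sum>j\<in>{0,1,2}. q j * (T * \<rho>) + q j * H (\<Phi> \<pi> j (f \<pi>)))"
    by (intro sum_mono step)
  also have "\<dots> = T * \<rho> + (\<Sum>j\<in>{0,1,2}. q j * H (\<Phi> \<pi> j (f \<pi>)))"
    by (simp only: sum.distrib sum_distrib_right [symmetric] q_sum mult_1)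
  finally have 1: "(\<Sum>k<T. \<integral>s. stage (Suc k) s g \<partial>\<pi>) \<le> T * \<rho> + (\<Sum>j\<in>{0,1,2}. q j * H (\<Phi> \<pi> j (f \<pi>)))" .
  have 3: "(\<Sum>k<Suc T. \<integral>s. stage k s g \<partial>\<pi>) = mean_cost \<pi> (f \<pi>) + (\<Sum>k<T. \<integral>s. stage (Suc k) s g \<partial>\<pi>)"
    unfolding sum.lessThan_Suc_shift mean_cost_integral(1) [OF \<pi> \<nu>] by (simp only: stage.simps(1) g0(1))
  show ?case
    unfolding g_def [symmetric] 3 using 1 eq [OF \<pi>] by (simp only: of_nat_Suc distrib_right mult_1)
qed

lemma finite_moment_return: "s \<in> space SS \<Longrightarrow> return SS s \<in> finite_moment"
  unfolding finite_moment_def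
  by (auto simp: space_prob_algebra prob_space_return nn_integral_return
      intro!: integrableI_bounded)

theorem average_cost_optimality:
  "\<exists>\<rho> V a. (\<forall>s\<in>space SS.
      (\<exists>g\<in>trees. \<forall>T. (\<Sum>k<T. stage k s g) \<le> T * \<rho> + a * u s) \<and>
      (\<forall>g\<in>trees. \<forall>T. T * \<rho> \<le> (\<Sum>k<T. stage k s g) + a * u s)) \<and>
    (\<forall>\<pi>\<in>beliefs. (\<exists>\<nu>\<in>{0,1}. extended_cost \<pi> \<nu> < \<infinity>) \<longrightarrow>
       ereal (\<rho> + V \<pi>) = (MIN \<nu>\<in>{0,1}. enn2ereal (extended_cost \<pi> \<nu>) + ereal (\<Sum>j\<in>{0,1,2}. q j * V (\<Phi> \<pi> j \<nu>))))"
proof -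
  obtain \<rho> H where eq: "\<And>\<pi>. \<pi> \<in> finite_moment \<Longrightarrow>
      \<rho> + H \<pi> = (MIN \<nu>\<in>{0,1}. mean_cost \<pi> \<nu> + (\<Sum>j\<in>{0,1,2}. q j * H (\<Phi> \<pi> j \<nu>)))"
    and H: "\<And>\<pi>. \<pi> \<in> finite_moment \<Longrightarrow> 0 \<le> H \<pi> \<and> H \<pi> \<le> K / (1 - r) * (\<integral>s. u s \<partial>\<pi>)"
    using bellman_finite_moment by auto
  obtain V where V: "\<forall>\<pi>\<in>beliefs. (\<exists>\<nu>\<in>{0,1}. extended_cost \<pi> \<nu> < \<infinity>) \<longrightarrow>
       ereal (\<rho> + V \<pi>) = (MIN \<nu>\<in>{0,1}. enn2ereal (extended_cost \<pi> \<nu>) + ereal (\<Sum>j\<in>{0,1,2}. q j * V (\<Phi> \<pi> j \<nu>)))"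
    using bellman_extended [OF eq] by blast
  define f where "f = (\<lambda>\<pi>. if mean_cost \<pi> 0 + (\<Sum>j\<in>{0,1,2}. q j * H (\<Phi> \<pi> j 0)) \<le>
      mean_cost \<pi> 1 + (\<Sum>j\<in>{0,1,2}. q j * H (\<Phi> \<pi> j 1)) then 0 else 1 :: nat)"
  have f: "f \<pi> \<in> {0,1}" for \<pi>
    unfolding f_def by simp
  have feq: "\<rho> + H \<pi> = mean_cost \<pi> (f \<pi>) + (\<Sum>j\<in>{0,1,2}. q j * H (\<Phi> \<pi> j (f \<pi>)))" if "\<pi> \<in> finite_moment" for \<pi>
    unfolding eq [OF that] Min_pair min_def f_def by (simp only: if_distrib split: if_split) simp
  have a: "0 \<le> K / (1 - r)"
    using K r by simp
  have ret: "(\<integral>s'. stage k s' g \<partial>return SS s) = stage k s g" if "s \<in> space SS" "g \<in> trees" for s g k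
    by (rule integral_return [OF that(1) stage_measurable [OF that(2)]])
  have retu: "(\<integral>s'. u s' \<partial>return SS s) = u s" if "s \<in> space SS" for s
    by (rule integral_return [OF that u_measurable])
  show ?thesis
  proof (intro exI conjI ballI)
    fix s assume s: "s \<in> space SS"
    note \<pi> = finite_moment_return [OF s]
    show "\<exists>g\<in>trees. \<forall>T. (\<Sum>k<T. stage k s g) \<le> T * \<rho> + K / (1 - r) * u s"
    proof (intro bexI allI)
      show g: "(\<lambda>h. follow f h (return SS s)) \<in> trees"
        unfolding trees_def using follow_in [of f, OF f] by blast
      show "(\<Sum>k<T. stage k s (\<lambda>h. follow f h (return SS s))) \<le> T * \<rho> + K / (1 - r) * u s" for T
        using total_cost_upper [OF f feq, of "return SS s" T] H [OF \<pi>] H \<pi> unfolding ret [OF s g] retu [OF s]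
        by fastforce
    qed
    fix g assume g: "g \<in> trees"
    show "\<forall>T. T * \<rho> \<le> (\<Sum>k<T. stage k s g) + K / (1 - r) * u s"
    proof
      fix T
      show "T * \<rho> \<le> (\<Sum>k<T. stage k s g) + K / (1 - r) * u s"
        using total_cost_lower [OF eq conjunct2 [OF H] a \<pi> g, of T] H [OF \<pi>]
        unfolding ret [OF s g] retu [OF s] by linarith
    qed
  next
    fix \<pi> assume "\<pi> \<in> beliefs"
    with V show "(\<exists>\<nu>\<in>{0,1}. extended_cost \<pi> \<nu> < \<infinity>) \<longrightarrow>
       ereal (\<rho> + V \<pi>) = (MIN \<nu>\<in>{0,1}. enn2ereal (extended_cost \<pi> \<nu>) + ereal (\<Sum>j\<in>{0,1,2}. q j * V (\<Phi> \<pi> j \<nu>)))"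
      by blast
  qed
qed

end

lemma sum_lists_Suc:
  "(\<Sum>z\<in>{z. set z \<subseteq> A \<and> length z = Suc N}. F z) =
    (\<Sum>a\<in>A. \<Sum>z\<in>{z. set z \<subseteq> A \<and> length z = N}. F (a # z))"
proof -
  let ?X = "{z. set z \<subseteq> A \<and> length z = N}"
  have inj: "inj_on (\<lambda>(z, a). a # z) (?X \<times> A)"
    by (auto simp: inj_on_def)
  have "(\<Sum>z\<in>{z. set z \<subseteq> A \<and> length z = Suc N}. F z) = (\<Sum>(z, a)\<in>?X \<times> A. F (a # z))"
    unfolding lists_length_Suc_eq sum.reindex [OF inj] by (intro sum.cong refl) auto
  also have "\<dots> = (\<Sum>a\<in>A. \<Sum>z\<in>?X. F (a # z))"
    unfolding sum.cartesian_product [symmetric] by (rule sum.swap)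
  finally show ?thesis .
qed

context transmission_mdp
begin

section \<open>Expectations over the losses and acknowledgments\<close>

primrec path_sum :: "nat \<Rightarrow> ((nat \<times> nat) list \<Rightarrow> real) \<Rightarrow> real" where
  "path_sum 0 f = f []"
| "path_sum (Suc N) f = (\<Sum>\<gamma>\<in>{0,1}. \<Sum>j\<in>{0,1,2}. w \<gamma> j * path_sum N (\<lambda>z. f ((\<gamma>, j) # z)))"

lemma path_sum_cong: "(\<And>z. length z = N \<Longrightarrow> f z = g z) \<Longrightarrow> path_sum N f = path_sum N g"
proof (induction N arbitrary: f g)
  case (Suc N)
  have "path_sum N (\<lambda>z. f ((\<gamma>, j) # z)) = path_sum N (\<lambda>z. g ((\<gamma>, j) # z))" for \<gamma> j
    by (rule Suc.IH) (simp add: Suc.prems)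
  then show ?case by (simp only: path_sum.simps)
qed simp

abbreviation symbols :: "(nat \<times> nat) set" where
  "symbols \<equiv> {0,1} \<times> {0,1,2}"

lemma path_sum_lists:
  "path_sum N f = (\<Sum>z\<in>{z. set z \<subseteq> symbols \<and> length z = N}. (\<Prod>a\<leftarrow>z. w (fst a) (snd a)) * f z)"
proof (induction N arbitrary: f)
  case 0
  have "{z. set z \<subseteq> symbols \<and> length z = 0} = {[]}" by auto
  then show ?case by simp
next
  case (Suc N)
  let ?X = "{z. set z \<subseteq> symbols \<and> length z = N}"
  have "(\<Sum>z\<in>{z. set z \<subseteq> symbols \<and> length z = Suc N}. (\<Prod>a\<leftarrow>z. w (fst a) (snd a)) * f z) =
      (\<Sum>a\<in>symbols. \<Sum>z\<in>?X. (\<Prod>b\<leftarrow>a # z. w (fst b) (snd b)) * f (a # z))"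
    by (rule sum_lists_Suc)
  also have "\<dots> = (\<Sum>a\<in>symbols. w (fst a) (snd a) * path_sum N (\<lambda>z. f (a # z)))"
    unfolding Suc.IH sum_distrib_left by (intro sum.cong refl) (simp only: list.map prod_list.Cons mult.assoc)
  also have "\<dots> = path_sum (Suc N) f"
    unfolding path_sum.simps sum.cartesian_product by (simp only: split_def prod.collapse)
  finally show ?case ..
qed

lemma prefix_probability:
  assumes M: "prob_space M" and gam: "iid_losses M p gam" and ghat: "memoryless_acks M \<delta> \<eta> gam ghat"
    and z: "set z \<subseteq> symbols"
  shows "measure M {\<omega>\<in>space M. \<forall>k<length z. gam k \<omega> = fst (z ! k) \<and> ghat k \<omega> = snd (z ! k)} =
    (\<Prod>a\<leftarrow>z. w (fst a) (snd a))"
proof -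
  interpret prob_space M by (rule M)
  let ?N = "length z"
  have indep: "indep_vars (\<lambda>_. count_space UNIV) gam UNIV"
    and gam01: "\<And>k \<omega>. \<omega> \<in> space M \<Longrightarrow> gam k \<omega> \<in> {0,1}"
    and gam1: "\<And>k. prob {\<omega>\<in>space M. gam k \<omega> = 1} = 1 - p"
    using gam unfolding iid_losses_def by auto
  have zk: "fst (z ! k) \<in> {0,1}" "snd (z ! k) \<in> {0,1,2}" if "k < ?N" for k
    using z nth_mem [OF that] by auto
  have gam_meas: "gam k \<in> measurable M (count_space UNIV)" for k
    using indep unfolding indep_vars_def by blast
  have ev: "{\<omega>\<in>space M. gam k \<omega> = i} \<in> events" for k i
    using measurable_sets [OF gam_meas, of "{i}" k] by (simp add: vimage_def Int_def conj_commute)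
  have marg: "prob {\<omega>\<in>space M. gam k \<omega> = i} = loss_prob p i" if i: "i \<in> {0,1}" for k i
  proof (cases "i = 1")
    case True
    then show ?thesis using gam1 by (simp add: loss_prob_def)
  next
    case False
    then have "i = 0" using i by blast
    moreover have "{\<omega>\<in>space M. gam k \<omega> = 0} = space M - {\<omega>\<in>space M. gam k \<omega> = 1}"
      using gam01 [of _ k] by fastforce
    ultimately show ?thesis
      using prob_compl [OF ev [of k 1]] gam1 by (simp add: loss_prob_def)
  qed
  have "prob {\<omega>\<in>space M. \<forall>k<?N. gam k \<omega> = fst (z ! k)} = (\<Prod>k<?N. loss_prob p (fst (z ! k)))"
  proof (cases "?N = 0")
    case True
    then show ?thesis by (simp add: prob_space)
  next
    case False
    have "{\<omega>\<in>space M. \<forall>k<?N. gam k \<omega> = fst (z ! k)} = (\<Inter>k\<in>{..<?N}. gam k -` {fst (z ! k)} \<inter> space M)"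
      using False by auto
    also have "prob \<dots> = (\<Prod>k<?N. prob (gam k -` {fst (z ! k)} \<inter> space M))"
      using False by (intro indep_varsD [OF indep]) auto
    also have "\<dots> = (\<Prod>k<?N. loss_prob p (fst (z ! k)))"
      using marg zk by (intro prod.cong refl) (simp add: vimage_def Int_def conj_commute)
    finally show ?thesis .
  qed
  moreover have "prob {\<omega>\<in>space M. \<forall>k<?N. gam k \<omega> = fst (z ! k) \<and> ghat k \<omega> = snd (z ! k)} =
      prob {\<omega>\<in>space M. \<forall>k<?N. gam k \<omega> = fst (z ! k)} * (\<Prod>k<?N. ack_mat \<delta> \<eta> (fst (z ! k)) (snd (z ! k)))"
    using ghat [unfolded memoryless_acks_def, THEN conjunct2, THEN conjunct2, rule_format,
        of ?N "\<lambda>k. fst (z ! k)" "\<lambda>k. snd (z ! k)"] zk by blast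
  ultimately show ?thesis
    by (simp add: prod.distrib [symmetric] prod.list_conv_set_nth atLeast0LessThan)
qed

lemma expectation_path:
  assumes M: "prob_space M" and gam: "iid_losses M p gam" and ghat: "memoryless_acks M \<delta> \<eta> gam ghat"
  shows "(\<integral>\<omega>. f (map (\<lambda>i. (gam i \<omega>, ghat i \<omega>)) [0..<N]) \<partial>M) = path_sum N f"
proof -
  interpret prob_space M by (rule M)
  let ?X = "{z. set z \<subseteq> symbols \<and> length z = N}"
  let ?Z = "\<lambda>\<omega>. map (\<lambda>i. (gam i \<omega>, ghat i \<omega>)) [0..<N]"
  let ?E = "\<lambda>z. {\<omega>\<in>space M. \<forall>k<length z. gam k \<omega> = fst (z ! k) \<and> ghat k \<omega> = snd (z ! k)}"
  have fin: "finite ?X" by (rule finite_lists_length_eq) simp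
  have gam_meas: "gam k \<in> measurable M (count_space UNIV)" for k
    using gam unfolding iid_losses_def indep_vars_def by blast
  have ghat_meas: "ghat k \<in> measurable M (count_space UNIV)" for k
    using ghat unfolding memoryless_acks_def by blast
  have ev: "?E z \<in> events" for z
    using gam_meas ghat_meas by measurable
  have fin_em: "emeasure M B < \<infinity>" for B
    by (simp add: emeasure_eq_measure)
  have Z: "?Z \<omega> \<in> ?X" if "\<omega> \<in> space M" for \<omega>
  proof -
    have "gam i \<omega> \<in> {0,1}" "ghat i \<omega> \<in> {0,1,2}" for i
      using gam ghat that unfolding iid_losses_def memoryless_acks_def by blast+
    then have "set (?Z \<omega>) \<subseteq> symbols" unfolding set_map by (intro image_subsetI SigmaI)
    then show ?thesis by simp
  qed
  have E: "\<omega> \<in> ?E z \<longleftrightarrow> z = ?Z \<omega>" if "\<omega> \<in> space M" "z \<in> ?X" for \<omega> z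
  proof -
    have "length z = N" using that by blast
    then show ?thesis using that(1) by (auto simp: list_eq_iff_nth_eq prod_eq_iff)
  qed
  have "f (?Z \<omega>) = (\<Sum>z\<in>?X. indicator (?E z) \<omega> * f z)" if \<omega>: "\<omega> \<in> space M" for \<omega>
  proof -
    have "(\<Sum>z\<in>?X. indicator (?E z) \<omega> * f z) = (\<Sum>z\<in>?X. if z = ?Z \<omega> then f z else 0)"
      using E [OF \<omega>] by (intro sum.cong refl) (simp add: indicator_def)
    also have "\<dots> = f (?Z \<omega>)"
      using fin Z [OF \<omega>] by (subst sum.delta) auto
    finally show ?thesis by simp
  qed
  then have "(\<integral>\<omega>. f (?Z \<omega>) \<partial>M) = (\<integral>\<omega>. (\<Sum>z\<in>?X. indicator (?E z) \<omega> * f z) \<partial>M)"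
    by (intro Bochner_Integration.integral_cong refl)
  also have "\<dots> = (\<Sum>z\<in>?X. \<integral>\<omega>. indicator (?E z) \<omega> * f z \<partial>M)"
    by (intro Bochner_Integration.integral_sum integrable_mult_left integrable_real_indicator ev fin_em)
  also have "\<dots> = (\<Sum>z\<in>?X. prob (?E z) * f z)"
    by (intro sum.cong refl)
      (simp only: integral_mult_left_zero Bochner_Integration.integral_indicator Int_absorb2 sets.sets_into_space ev)
  also have "\<dots> = path_sum N f"
    unfolding path_sum_lists
  proof (intro sum.cong refl)
    fix z assume "z \<in> ?X"
    then have "set z \<subseteq> symbols" by blast
    then show "prob (?E z) * f z = (\<Prod>a\<leftarrow>z. w (fst a) (snd a)) * f z"
      by (simp only: prefix_probability [OF M gam ghat])
  qed
  finally show ?thesis .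
qed

text \<open>The cost of the last transition of a path, for which the path is consumed from the front to match
  the recursion of \<open>stage\<close>.\<close>

primrec last_cost :: "(nat \<times> nat) list \<Rightarrow> 's \<Rightarrow> (nat list \<Rightarrow> nat) \<Rightarrow> real" where
  "last_cost [] s g = 0"
| "last_cost (a # z) s g = (if z = [] then c s (fst a) (g [])
     else last_cost z (L s (fst a) (g [])) (\<lambda>h. g (snd a # h)))"

lemma path_sum_last_cost: "path_sum (Suc k) (\<lambda>z. last_cost z s g) = stage k s g"
proof (induction k arbitrary: s g)
  case 0
  have "path_sum (Suc 0) (\<lambda>z. last_cost z s g) = (\<Sum>\<gamma>\<in>{0,1}. (\<Sum>j\<in>{0,1,2}. w \<gamma> j) * c s \<gamma> (g []))"
    unfolding path_sum.simps sum_distrib_right by simp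
  also have "\<dots> = stage 0 s g"
    unfolding stage.simps by (intro sum.cong refl) (simp only: w_sum)
  finally show ?case .
next
  case (Suc k)
  have "path_sum (Suc k) (\<lambda>z. last_cost ((\<gamma>, j) # z) s g) =
      path_sum (Suc k) (\<lambda>z. last_cost z (L s \<gamma> (g [])) (\<lambda>h. g (j # h)))" for \<gamma> j
    by (rule path_sum_cong) auto
  then have "path_sum (Suc k) (\<lambda>z. last_cost ((\<gamma>, j) # z) s g) = stage k (L s \<gamma> (g [])) (\<lambda>h. g (j # h))" for \<gamma> j
    using Suc.IH by simp
  then show ?case
    unfolding path_sum.simps(2) [of "Suc k"] by (simp only: stage.simps)
qed

lemma trajectory_Suc_shift:
  "trajectory L s gs ns (Suc k) = trajectory L (L s (gs 0) (ns 0)) (\<lambda>i. gs (Suc i)) (\<lambda>i. ns (Suc i)) k"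
  by (induction k) simp_all

lemma last_cost_trajectory:
  "last_cost (map (\<lambda>i. (gs i, h i)) [0..<Suc k]) s g =
     c (trajectory L s gs (\<lambda>i. g (map h [0..<i])) k) (gs k) (g (map h [0..<k]))"
proof (induction k arbitrary: s g gs h)
  case 0
  show ?case by simp
next
  case (Suc k)
  have shift: "map f [0..<Suc i] = f 0 # map (\<lambda>i. f (Suc i)) [0..<i]" for f :: "nat \<Rightarrow> 'x" and i
    by (simp add: upt_conv_Cons map_Suc_upt [symmetric] del: upt_Suc)
  have "last_cost (map (\<lambda>i. (gs i, h i)) [0..<Suc (Suc k)]) s g =
      last_cost (map (\<lambda>i. (gs (Suc i), h (Suc i))) [0..<Suc k]) (L s (gs 0) (g [])) (\<lambda>l. g (h 0 # l))"
    unfolding shift [of _ "Suc k"] by (simp del: upt_Suc)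
  also have "\<dots> = c (trajectory L (L s (gs 0) (g [])) (\<lambda>i. gs (Suc i))
      (\<lambda>i. g (h 0 # map (\<lambda>i. h (Suc i)) [0..<i])) k) (gs (Suc k)) (g (h 0 # map (\<lambda>i. h (Suc i)) [0..<k]))"
    by (rule Suc.IH)
  also have "\<dots> = c (trajectory L s gs (\<lambda>i. g (map h [0..<i])) (Suc k)) (gs (Suc k)) (g (map h [0..<Suc k]))"
    unfolding trajectory_Suc_shift shift by simp
  finally show ?case .
qed

lemma expected_stage_cost:
  assumes "prob_space M" "iid_losses M p gam" "memoryless_acks M \<delta> \<eta> gam ghat"
  shows "(\<integral>\<omega>. c (trajectory L s (\<lambda>i. gam i \<omega>) (\<lambda>i. g (map (\<lambda>i. ghat i \<omega>) [0..<i])) k) (gam k \<omega>)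
      (g (map (\<lambda>i. ghat i \<omega>) [0..<k])) \<partial>M) = stage k s g"
proof -
  have "c (trajectory L s (\<lambda>i. gam i \<omega>) (\<lambda>i. g (map (\<lambda>i. ghat i \<omega>) [0..<i])) k) (gam k \<omega>)
      (g (map (\<lambda>i. ghat i \<omega>) [0..<k])) = last_cost (map (\<lambda>i. (gam i \<omega>, ghat i \<omega>)) [0..<Suc k]) s g" for \<omega>
    using last_cost_trajectory [of "\<lambda>i. gam i \<omega>" "\<lambda>i. ghat i \<omega>" k s g] by (rule sym)
  then show ?thesis
    using expectation_path [OF assms, of "\<lambda>z. last_cost z s g" "Suc k"]
    by (simp only: path_sum_last_cost)
qed

end

lemma decisions_cong:
  "(\<And>i. i < k \<Longrightarrow> h i = h' i) \<Longrightarrow> decisions g P h k = decisions g P h' k"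
proof (induction k)
  case (Suc k)
  have "map h [0..<k] = map h' [0..<k]" using Suc.prems by simp
  moreover have "decisions g P h k = decisions g P h' k" using Suc.IH Suc.prems by simp
  ultimately show ?case by (simp only: decisions.simps)
qed simp

lemma decision_eq_tree:
  "decision g P h k = decision g P (\<lambda>i. map h [0..<k] ! i) (length (map h [0..<k]))"
proof -
  have "decisions g P h k = decisions g P (\<lambda>i. map h [0..<k] ! i) k"
    by (rule decisions_cong) simp
  moreover have "map h [0..<k] = map (\<lambda>i. map h [0..<k] ! i) [0..<k]"
    by simp
  ultimately show ?thesis
    unfolding decision_def length_map length_upt diff_zero by (simp only:)
qed

lemma decision_in: "g \<in> policies \<Longrightarrow> decision g P h k \<in> {0,1}"
  unfolding policies_def decision_def by blast

lemma cov_setE: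
  assumes "s \<in> cov_set P_s"
  obtains D where "psd D" "s = lift_cov P_s (P_s + D)" "upper_left s - P_s = D"
proof -
  obtain P where "s = lift_cov P_s P" "psd (P - P_s)"
    using assms unfolding cov_set_def by blast
  then show ?thesis
    by (intro that [of "P - P_s"]) simp_all
qed

lemma lift_cov_in: "psd D \<Longrightarrow> lift_cov P_s (P_s + D) \<in> cov_set P_s"
  unfolding cov_set_def by force

section \<open>Contraction of the excess covariance in the order unit norm\<close>

text \<open>The order unit norm of a positive semidefinite \<open>D\<close>. It is compatible with the one-step contraction,
  which the trace is not.\<close>

definition order_norm :: "real^'n^'n \<Rightarrow> real^'n^'n \<Rightarrow> real" where
  "order_norm X D = Inf {t. 0 \<le> t \<and> psd (t *\<^sub>R X - D)}"

lemma order_norm_le: "0 \<le> t \<Longrightarrow> psd (t *\<^sub>R X - D) \<Longrightarrow> order_norm X D \<le> t"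
  unfolding order_norm_def by (intro cInf_lower) (auto intro: bdd_belowI [of _ 0])

lemma order_norm_attained:
  assumes D: "transpose D = D" and X: "transpose X = X" and t: "0 \<le> t" "psd (t *\<^sub>R X - D)"
  shows "0 \<le> order_norm X D" "psd (order_norm X D *\<^sub>R X - D)"
proof -
  let ?S = "{t. 0 \<le> t \<and> psd (t *\<^sub>R X - D)}"
  have eq: "?S = {t. 0 \<le> t \<and> (\<forall>x. x \<bullet> (D *v x) \<le> t * (x \<bullet> (X *v x)))}"
    unfolding psd_def
    by (simp add: transpose_diff transpose_scalar D X matrix_vector_mult_diff_rdistrib
        inner_diff_right scaleR_matrix_vector_assoc [symmetric])
  have "closed ?S"
    unfolding eq by (intro closed_Collect_conj closed_Collect_all closed_Collect_le continuous_intros)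
  then have "order_norm X D \<in> ?S"
    unfolding order_norm_def using t by (intro closed_contains_Inf) (auto intro: bdd_belowI [of _ 0])
  then show "0 \<le> order_norm X D" "psd (order_norm X D *\<^sub>R X - D)" by auto
qed

lemma filtered_lost: "filtered Z N 0 \<nu> D = Z + D"
  unfolding filtered_def by simp

lemma filtered_received:
  "filtered Z N (Suc 0) 0 D = D + par_sum Z N"
  "filtered Z N (Suc 0) (Suc 0) D = par_sum (Z + D) N"
  unfolding filtered_def par_sum_def by simp_all

text \<open>The reduced problem: the recursion of the excess covariance together with the Lyapunov equation that
  ties \<open>X\<close> to \<open>Z\<close>.\<close>

locale lifted_riccati =
  fixes A P_s Z X :: "real^'n^'n" and \<alpha>0 \<alpha>1 :: real
    and L :: "real^('n + 'n)^('n + 'n) \<Rightarrow> nat \<Rightarrow> nat \<Rightarrow> real^('n + 'n)^('n + 'n)"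
  assumes P_s: "psd P_s" and stable: "schur_stable A" and Z: "pos_def Z"
    and X: "X = A ** X ** transpose A + Z" and \<alpha>: "0 \<le> \<alpha>0" "0 \<le> \<alpha>1"
    and L_lift: "\<And>D \<gamma> \<nu>. psd D \<Longrightarrow> \<gamma> \<in> {0,1} \<Longrightarrow> \<nu> \<in> {0,1} \<Longrightarrow>
      L (lift_cov P_s (P_s + D)) \<gamma> \<nu> = lift_cov P_s (P_s + A ** filtered Z (if \<nu> = 1 then \<alpha>1 *\<^sub>R X else \<alpha>0 *\<^sub>R Z) \<gamma> \<nu> D ** transpose A)"
    and L_continuous: "\<And>\<gamma> \<nu>. \<gamma> \<in> {0,1} \<Longrightarrow> \<nu> \<in> {0,1} \<Longrightarrow> continuous_on (cov_set P_s) (\<lambda>P. L P \<gamma> \<nu>)"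
begin

abbreviation estimate :: "nat \<Rightarrow> nat \<Rightarrow> real^'n^'n \<Rightarrow> real^'n^'n" where
  "estimate \<gamma> \<nu> \<equiv> filtered Z (if \<nu> = 1 then \<alpha>1 *\<^sub>R X else \<alpha>0 *\<^sub>R Z) \<gamma> \<nu>"

lemma X_symmetric: "transpose X = X"
  and X_ge_Z: "x \<bullet> (Z *v x) \<le> x \<bullet> (X *v x)"
  using lyapunov_solution [OF stable X pos_def_imp_psd [OF Z]] by auto

lemma X_psd: "psd X"
  using X_symmetric X_ge_Z psdD(2) [OF pos_def_imp_psd [OF Z]] by (intro psdI) (auto intro: order_trans)

lemma psd_X_minus_Z: "psd (X - Z)"
  unfolding psd_diff_iff [OF X_symmetric pos_defD(1) [OF Z]] using X_ge_Z by blast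

lemma psd_estimate:
  assumes D: "psd D" and "\<gamma> \<in> {0,1}" "\<nu> \<in> {0,1}"
  shows "psd (estimate \<gamma> \<nu> D)" "psd (Z + D - estimate \<gamma> \<nu> D)"
proof -
  have ZD: "pos_def (Z + D)" by (rule pos_def_add_psd [OF Z D])
  have N: "psd (\<alpha>0 *\<^sub>R Z)" "psd (\<alpha>1 *\<^sub>R X)"
    by (intro psd_scaleR X_psd pos_def_imp_psd Z \<alpha>)+
  have "psd (D + par_sum Z (\<alpha>0 *\<^sub>R Z))" "psd (Z + D - (D + par_sum Z (\<alpha>0 *\<^sub>R Z)))"
    using psd_par_sum [OF Z N(1)] psd_add [OF D] by auto
  then show "psd (estimate \<gamma> \<nu> D)" "psd (Z + D - estimate \<gamma> \<nu> D)"
    using assms(2,3) psd_par_sum [OF ZD N(2)] pos_def_imp_psd [OF ZD] by (auto simp: filtered_lost filtered_received)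
qed

lemma estimate_difference:
  assumes D: "psd D" and E: "psd E" and t: "0 \<le> t" "psd (t *\<^sub>R X - E)" and "\<gamma> \<in> {0,1}" "\<nu> \<in> {0,1}"
  shows "psd (estimate \<gamma> \<nu> (D + E) - estimate \<gamma> \<nu> D)" "psd (t *\<^sub>R X - (estimate \<gamma> \<nu> (D + E) - estimate \<gamma> \<nu> D))"
proof -
  have ZD: "pos_def (Z + D)" by (rule pos_def_add_psd [OF Z D])
  have N: "psd (\<alpha>1 *\<^sub>R X)" by (rule psd_scaleR [OF X_psd \<alpha>(2)])
  show "psd (estimate \<gamma> \<nu> (D + E) - estimate \<gamma> \<nu> D)" "psd (t *\<^sub>R X - (estimate \<gamma> \<nu> (D + E) - estimate \<gamma> \<nu> D))"
    using assms(5,6) E t psd_par_sum_mono [OF ZD N E] psd_par_sum_nonexpansive [OF ZD X_psd \<alpha>(2) E t]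
    by (auto simp: filtered_lost filtered_received add.assoc)
qed

text \<open>\<open>A X A\<^sup>T = X - Z\<close>, and \<open>Z\<close> dominates a positive multiple of \<open>X\<close>.\<close>

lemma contraction_factor: "\<exists>r. 0 \<le> r \<and> r < 1 \<and> psd (r *\<^sub>R X - A ** X ** transpose A)"
proof -
  obtain e where e: "0 < e" "\<And>x. e * (x \<bullet> x) \<le> x \<bullet> (Z *v x)"
    using pos_def_lower_bound [OF Z] by blast
  define k where "k = real CARD('n) * trace X"
  have k: "0 \<le> k" "\<And>x. x \<bullet> (X *v x) \<le> k * (x \<bullet> x)"
    unfolding k_def using psd_trace_nonneg [OF X_psd] psd_form_le_trace [OF X_psd] by auto
  define r where "r = k / (k + e)"
  have r: "0 \<le> r" "r < 1" and re: "(1 - r) * k \<le> e"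
    using e(1) k(1) by (auto simp: r_def field_simps)
  have "(1 - r) * (x \<bullet> (X *v x)) \<le> x \<bullet> (Z *v x)" for x
  proof -
    have "(1 - r) * (x \<bullet> (X *v x)) \<le> (1 - r) * (k * (x \<bullet> x))"
      using r by (intro mult_left_mono k) auto
    also have "\<dots> \<le> e * (x \<bullet> x)"
      using re by (simp add: mult.assoc [symmetric] mult_right_mono)
    finally show ?thesis using e(2) [of x] by linarith
  qed
  then have "psd (Z - (1 - r) *\<^sub>R X)"
    unfolding psd_def
    by (simp add: transpose_diff transpose_scalar pos_defD(1) [OF Z] X_symmetric matrix_vector_mult_diff_rdistrib
        inner_diff_right scaleR_matrix_vector_assoc [symmetric])
  moreover have "Z - (1 - r) *\<^sub>R X = r *\<^sub>R X - A ** X ** transpose A"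
    using X by (simp add: scaleR_diff_left algebra_simps)
  ultimately show ?thesis using r by auto
qed

lemma trace_dominates: "\<exists>k\<ge>0. \<forall>D. psd D \<longrightarrow> psd ((k * trace D) *\<^sub>R X - D)"
proof -
  obtain e where e: "0 < e" "\<And>x. e * (x \<bullet> x) \<le> x \<bullet> (Z *v x)"
    using pos_def_lower_bound [OF Z] by blast
  define k where "k = real CARD('n) / e"
  have "psd ((k * trace D) *\<^sub>R X - D)" if D: "psd D" for D
  proof -
    have "x \<bullet> (D *v x) \<le> k * trace D * (x \<bullet> (X *v x))" for x
    proof -
      have "x \<bullet> (D *v x) \<le> real CARD('n) * trace D * (x \<bullet> x)"
        by (rule psd_form_le_trace [OF D])
      also have "\<dots> = k * trace D * (e * (x \<bullet> x))"
        using e(1) by (simp add: k_def)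
      also have "\<dots> \<le> k * trace D * (x \<bullet> (X *v x))"
        using e(1) psd_trace_nonneg [OF D] order_trans [OF e(2) X_ge_Z]
        by (intro mult_left_mono mult_nonneg_nonneg) (auto simp: k_def)
      finally show ?thesis .
    qed
    then show ?thesis
      unfolding psd_def
      by (simp add: transpose_diff transpose_scalar psdD(1) [OF D] X_symmetric matrix_vector_mult_diff_rdistrib
          inner_diff_right scaleR_matrix_vector_assoc [symmetric])
  qed
  then show ?thesis
    using e(1) by (intro exI [of _ k]) (auto simp: k_def)
qed

definition close :: "real \<Rightarrow> real^('n + 'n)^('n + 'n) \<Rightarrow> real^('n + 'n)^('n + 'n) \<Rightarrow> bool" where
  "close t s s' \<longleftrightarrow> 0 \<le> t \<and> (\<exists>D E. psd D \<and> psd E \<and> psd (t *\<^sub>R X - E) \<and>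
     s' = lift_cov P_s (P_s + D) \<and> s = lift_cov P_s (P_s + (D + E)))"

lemma close_step:
  assumes r: "0 \<le> r" "psd (r *\<^sub>R X - A ** X ** transpose A)" and cl: "close t s s'"
    and \<gamma>: "\<gamma> \<in> {0,1}" and \<nu>: "\<nu> \<in> {0,1}"
  shows "close (r * t) (L s \<gamma> \<nu>) (L s' \<gamma> \<nu>)"
proof -
  obtain D E where t: "0 \<le> t" and D: "psd D" and E: "psd E" "psd (t *\<^sub>R X - E)"
    and s: "s' = lift_cov P_s (P_s + D)" "s = lift_cov P_s (P_s + (D + E))"
    using cl unfolding close_def by blast
  let ?D = "estimate \<gamma> \<nu> D" and ?E = "estimate \<gamma> \<nu> (D + E) - estimate \<gamma> \<nu> D"
  note E' = estimate_difference [OF D E(1) t E(2) \<gamma> \<nu>]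
  have "psd (t *\<^sub>R (A ** X ** transpose A) - A ** ?E ** transpose A)"
    using psd_congruence [OF E'(2), of A] by (simp only: matrix_diff_ldistrib matrix_diff_rdistrib matrix_scaleR_left matrix_scaleR_right)
  moreover have "psd ((r * t) *\<^sub>R X - t *\<^sub>R (A ** X ** transpose A))"
    using psd_scaleR [OF r(2) t] by (simp add: scaleR_diff_right mult.commute)
  ultimately have "psd ((r * t) *\<^sub>R X - A ** ?E ** transpose A)"
    by (rule psd_trans)
  moreover have "A ** estimate \<gamma> \<nu> (D + E) ** transpose A = A ** ?D ** transpose A + A ** ?E ** transpose A"
    by (simp add: matrix_diff_ldistrib matrix_diff_rdistrib)
  ultimately show ?thesis
    unfolding close_def s L_lift [OF D \<gamma> \<nu>] L_lift [OF psd_add [OF D E(1)] \<gamma> \<nu>]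
    using r(1) t psd_congruence [OF psd_estimate(1) [OF D \<gamma> \<nu>]] psd_congruence [OF E'(1)]
    by (intro conjI exI [of _ "A ** ?D ** transpose A"] exI [of _ "A ** ?E ** transpose A"]) auto
qed

lemma close_trace:
  assumes "close t s s'"
  shows "trace (upper_left s') \<le> trace (upper_left s)" "trace (upper_left s) \<le> trace (upper_left s') + t * trace X"
proof -
  obtain D E where E: "psd E" "psd (t *\<^sub>R X - E)"
    and s: "s' = lift_cov P_s (P_s + D)" "s = lift_cov P_s (P_s + (D + E))"
    using assms unfolding close_def by blast
  have tX: "trace (t *\<^sub>R X) = t * trace X"
    by (simp add: trace_def sum_distrib_left)
  show "trace (upper_left s') \<le> trace (upper_left s)"
    unfolding s using psd_trace_nonneg [OF E(1)] by (simp add: trace_add)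
  show "trace (upper_left s) \<le> trace (upper_left s') + t * trace X"
    unfolding s using psd_trace_nonneg [OF E(2)] by (simp add: trace_add trace_sub tX)
qed

definition excess_norm :: "real^('n + 'n)^('n + 'n) \<Rightarrow> real" where
  "excess_norm s = order_norm X (upper_left s - P_s)"

lemma excess_norm_lift: "excess_norm (lift_cov P_s (P_s + D)) = order_norm X D"
  unfolding excess_norm_def by simp

lemma order_norm_psd:
  assumes D: "psd D"
  shows "0 \<le> order_norm X D" "psd (order_norm X D *\<^sub>R X - D)"
proof -
  obtain k where k: "0 \<le> k" "psd ((k * trace D) *\<^sub>R X - D)"
    using trace_dominates D by blast
  have "0 \<le> k * trace D" using k(1) psd_trace_nonneg [OF D] by simp
  from order_norm_attained [OF psdD(1) [OF D] X_symmetric this k(2)]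
  show "0 \<le> order_norm X D" "psd (order_norm X D *\<^sub>R X - D)" by auto
qed

lemma excess_norm_measurable: "excess_norm \<in> borel_measurable (cov_space P_s)"
proof (rule borel_measurable_iff_le [THEN iffD2], intro allI)
  fix a :: real
  let ?B = "{s :: real^('n + 'n)^('n + 'n). \<forall>x. x \<bullet> ((upper_left s - P_s) *v x) \<le> a * (x \<bullet> (X *v x))}"
  have sp: "space (cov_space P_s) = cov_set P_s"
    unfolding cov_space_def by (simp add: space_restrict_space)
  show "{s \<in> space (cov_space P_s). excess_norm s \<le> a} \<in> sets (cov_space P_s)"
  proof (cases "0 \<le> a")
    case True
    have "excess_norm s \<le> a \<longleftrightarrow> s \<in> ?B" if s: "s \<in> cov_set P_s" for s
    proof -
      obtain D where D: "psd D" "upper_left s - P_s = D"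
        using s by (elim cov_setE)
      have psd_iff: "psd (t *\<^sub>R X - D) \<longleftrightarrow> (\<forall>x. x \<bullet> (D *v x) \<le> t * (x \<bullet> (X *v x)))" for t
        unfolding psd_def
        by (simp add: transpose_diff transpose_scalar psdD(1) [OF D(1)] X_symmetric matrix_vector_mult_diff_rdistrib
            inner_diff_right scaleR_matrix_vector_assoc [symmetric])
      have "psd (a *\<^sub>R X - D)" if "order_norm X D \<le> a"
      proof -
        have eq: "a *\<^sub>R X - D = (a - order_norm X D) *\<^sub>R X + (order_norm X D *\<^sub>R X - D)"
          by (simp add: scaleR_diff_left)
        show ?thesis
          unfolding eq using that by (intro psd_add psd_scaleR X_psd order_norm_psd(2) D) simp
      qed
      then show ?thesis
        using order_norm_le [OF True, of X D] psd_iff [of a] D(2) unfolding excess_norm_def by auto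
    qed
    then have "{s \<in> space (cov_space P_s). excess_norm s \<le> a} = cov_set P_s \<inter> ?B"
      unfolding sp by blast
    moreover have "closed ?B"
      unfolding upper_left_def inner_vec_def matrix_vector_mult_def
      by (intro closed_Collect_all closed_Collect_le continuous_intros)
    ultimately show ?thesis
      unfolding cov_space_def sets_restrict_space by (simp only: imageI borel_closed)
  next
    case False
    have "0 \<le> excess_norm s" if "s \<in> cov_set P_s" for s
      using that by (elim cov_setE) (simp only: excess_norm_def order_norm_psd(1))
    then have "{s \<in> space (cov_space P_s). excess_norm s \<le> a} = {}"
      unfolding sp using False by (auto dest: order_trans)
    then show ?thesis by (simp only: sets.empty_sets)
  qed
qed

lemma L_in_cov_set: "s \<in> cov_set P_s \<Longrightarrow> \<gamma> \<in> {0,1} \<Longrightarrow> \<nu> \<in> {0,1} \<Longrightarrow> L s \<gamma> \<nu> \<in> cov_set P_s"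
  by (elim cov_setE) (simp only: L_lift lift_cov_in psd_congruence psd_estimate)

lemma L_measurable: "\<gamma> \<in> {0,1} \<Longrightarrow> \<nu> \<in> {0,1} \<Longrightarrow> (\<lambda>s. L s \<gamma> \<nu>) \<in> measurable (cov_space P_s) (cov_space P_s)"
  unfolding cov_space_def using L_in_cov_set
  by (intro measurable_restrict_space2 borel_measurable_continuous_on_restrict L_continuous)
    (auto simp: space_restrict_space)

lemma trace_upper_left_measurable: "(\<lambda>s :: real^('n + 'n)^('n + 'n). trace (upper_left s)) \<in> borel_measurable borel"
  unfolding trace_def upper_left_def by (intro borel_measurable_continuous_onI continuous_intros)

lemma transmission_mdp_instance:
  assumes p: "p \<in> {0..1}" and \<delta>: "\<delta> \<in> {0..1}" and \<eta>: "\<eta> \<in> {0..1}" and lam: "0 < lam" "lam \<le> 1"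
    and J: "\<And>\<nu>. \<nu> \<in> {0,1} \<Longrightarrow> 0 \<le> J \<nu>"
  shows "\<exists>u r K K'. transmission_mdp (cov_space P_s) L
    (\<lambda>s \<gamma> \<nu>. lam * trace (upper_left (L s \<gamma> \<nu>)) + (1 - lam) * J \<nu>) p \<delta> \<eta> close u (lift_cov P_s P_s) r K K'"
proof -
  obtain r where r: "0 \<le> r" "r < 1" "psd (r *\<^sub>R X - A ** X ** transpose A)"
    using contraction_factor by blast
  obtain k where k: "0 \<le> k" "\<And>D. psd D \<Longrightarrow> psd ((k * trace D) *\<^sub>R X - D)"
    using trace_dominates by blast
  \<comment> \<open>The fixed point of the drift bound \<open>x \<mapsto> r (x + 1)\<close> of the order norm; above it the norm cannot grow.\<close>
  define b where "b = r / (1 - r)"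
  have b: "0 \<le> b" "r * (b + 1) = b"
    using r by (auto simp: b_def field_simps)
  define u where "u = (\<lambda>s. max b (excess_norm s))"
  define c where "c = (\<lambda>s \<gamma> \<nu>. lam * trace (upper_left (L s \<gamma> \<nu>)) + (1 - lam) * J \<nu>)"
  have sp: "space (cov_space P_s) = cov_set P_s"
    unfolding cov_space_def by (simp add: space_restrict_space)
  have tr: "trace D \<le> trace (upper_left (lift_cov P_s (P_s + D)))" for D
    using psd_trace_nonneg [OF P_s] by (simp add: trace_add)
  have cost: "lam * trace D \<le> c s \<gamma> \<nu>" if "L s \<gamma> \<nu> = lift_cov P_s (P_s + D)" "\<nu> \<in> {0,1}" for s \<gamma> \<nu> D
  proof -
    have "0 \<le> (1 - lam) * J \<nu>" using lam J [OF that(2)] by simp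
    moreover have "lam * trace D \<le> lam * trace (upper_left (lift_cov P_s (P_s + D)))"
      using lam by (intro mult_left_mono tr) simp
    ultimately show ?thesis unfolding c_def that(1) by linarith
  qed
  have step: "\<exists>D'. psd D' \<and> L (lift_cov P_s (P_s + D)) \<gamma> \<nu> = lift_cov P_s (P_s + D') \<and>
      order_norm X D' \<le> r * (order_norm X D + 1)"
    if D: "psd D" and \<gamma>: "\<gamma> \<in> {0,1}" and \<nu>: "\<nu> \<in> {0,1}" for D \<gamma> \<nu>
  proof -
    let ?t = "order_norm X D"
    note t = order_norm_psd [OF D]
    have "psd ((?t + 1) *\<^sub>R X - estimate \<gamma> \<nu> D)"
    proof (rule psd_trans)
      show "psd (Z + D - estimate \<gamma> \<nu> D)" by (rule psd_estimate(2) [OF D \<gamma> \<nu>])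
      show "psd ((?t + 1) *\<^sub>R X - (Z + D))"
        using psd_add [OF psd_X_minus_Z t(2)] by (simp add: scaleR_add_left algebra_simps)
    qed
    then have "psd (A ** ((?t + 1) *\<^sub>R X - estimate \<gamma> \<nu> D) ** transpose A)"
      by (rule psd_congruence)
    then have 1: "psd ((?t + 1) *\<^sub>R (A ** X ** transpose A) - A ** estimate \<gamma> \<nu> D ** transpose A)"
      by (simp only: matrix_diff_ldistrib matrix_diff_rdistrib matrix_scaleR_left matrix_scaleR_right)
    have 2: "psd ((r * (?t + 1)) *\<^sub>R X - (?t + 1) *\<^sub>R (A ** X ** transpose A))"
      using psd_scaleR [OF r(3), of "?t + 1"] t(1) by (simp add: scaleR_diff_right mult.commute)
    show ?thesis
      using psd_trans [OF 1 2] r(1) t(1) L_lift [OF D \<gamma> \<nu>] psd_congruence [OF psd_estimate(1) [OF D \<gamma> \<nu>]]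
      by (intro exI [of _ "A ** estimate \<gamma> \<nu> D ** transpose A"]) (auto intro: order_norm_le)
  qed
  have "transmission_mdp (cov_space P_s) L c p \<delta> \<eta> close u (lift_cov P_s P_s) r (lam * r * trace X) (k / lam + b)"
  proof
    show "p \<in> {0..1}" "\<delta> \<in> {0..1}" "\<eta> \<in> {0..1}" "0 \<le> r" "r < 1" by fact+
    show "0 \<le> lam * r * trace X"
      using lam r psd_trace_nonneg [OF X_psd] by simp
    show "u \<in> borel_measurable (cov_space P_s)"
      unfolding u_def by (intro borel_measurable_max borel_measurable_const excess_norm_measurable)
    show "lift_cov P_s P_s \<in> space (cov_space P_s)"
      unfolding sp using lift_cov_in [of 0 P_s] by simp
  next
    fix s assume "s \<in> space (cov_space P_s)"
    then obtain D where D: "psd D" "s = lift_cov P_s (P_s + D)"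
      unfolding sp by (elim cov_setE)
    show "0 \<le> u s" unfolding u_def using b by simp
    have eq: "u s *\<^sub>R X - D = (u s - order_norm X D) *\<^sub>R X + (order_norm X D *\<^sub>R X - D)"
      by (simp add: scaleR_diff_left)
    have "order_norm X D \<le> u s"
      unfolding u_def D(2) excess_norm_lift by simp
    then have "psd (u s *\<^sub>R X - D)"
      unfolding eq by (intro psd_add psd_scaleR X_psd order_norm_psd(2) D) simp
    then show "close (u s) s (lift_cov P_s P_s)"
      unfolding close_def using D b by (intro conjI exI [of _ 0] exI [of _ D]) (auto simp: u_def)
  next
    fix \<gamma> \<nu> :: nat assume \<gamma>: "\<gamma> \<in> {0,1}" and \<nu>: "\<nu> \<in> {0,1}"
    show m: "(\<lambda>s. L s \<gamma> \<nu>) \<in> measurable (cov_space P_s) (cov_space P_s)"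
      by (rule L_measurable [OF \<gamma> \<nu>])
    have "(\<lambda>s. trace (upper_left s)) \<in> borel_measurable (cov_space P_s)"
      unfolding cov_space_def by (rule measurable_restrict_space1 [OF trace_upper_left_measurable])
    from measurable_compose [OF m this] show "(\<lambda>s. c s \<gamma> \<nu>) \<in> borel_measurable (cov_space P_s)"
      unfolding c_def by (intro borel_measurable_add borel_measurable_times borel_measurable_const)
    fix t s s' assume cl: "close t s s'"
    show cl': "close (r * t) (L s \<gamma> \<nu>) (L s' \<gamma> \<nu>)"
      by (rule close_step [OF r(1,3) cl \<gamma> \<nu>])
    show "c s' \<gamma> \<nu> \<le> c s \<gamma> \<nu> \<and> c s \<gamma> \<nu> \<le> c s' \<gamma> \<nu> + lam * r * trace X * t"
      using mult_left_mono [OF close_trace(1) [OF cl'], of lam] mult_left_mono [OF close_trace(2) [OF cl'], of lam] lam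
      unfolding c_def by (simp add: algebra_simps)
  next
    fix s and \<gamma> \<nu> :: nat assume s: "s \<in> space (cov_space P_s)" and \<gamma>: "\<gamma> \<in> {0,1}" and \<nu>: "\<nu> \<in> {0,1}"
    then obtain D where D: "psd D" "s = lift_cov P_s (P_s + D)"
      unfolding sp by (elim cov_setE)
    obtain D' where D': "psd D'" "L s \<gamma> \<nu> = lift_cov P_s (P_s + D')" "order_norm X D' \<le> r * (order_norm X D + 1)"
      using step [OF D(1) \<gamma> \<nu>] D(2) by blast
    have tr': "0 \<le> trace D'" by (rule psd_trace_nonneg [OF D'(1)])
    have "0 \<le> lam * trace D'" using lam tr' by simp
    also note cost [OF D'(2) \<nu>]
    finally show c0: "0 \<le> c s \<gamma> \<nu>" .
    have "r * (order_norm X D + 1) \<le> r * (max b (order_norm X D) + 1)"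
      using r by (intro mult_left_mono) auto
    also have "\<dots> \<le> max b (order_norm X D)"
    proof -
      have "0 \<le> (1 - r) * (max b (order_norm X D) - b)" using r by simp
      then show ?thesis using b(2) by (simp add: algebra_simps)
    qed
    finally show "u (L s \<gamma> \<nu>) \<le> u s"
      unfolding u_def D'(2) unfolding D(2) excess_norm_lift using D'(3) by simp
    have "order_norm X D' \<le> k * trace D'"
      using k(2) [OF D'(1)] k(1) tr' by (intro order_norm_le) auto
    also have "\<dots> = k / lam * (lam * trace D')" using lam by simp
    also have "\<dots> \<le> k / lam * c s \<gamma> \<nu>"
      using k(1) lam by (intro mult_left_mono cost D' \<nu>) auto
    finally have "max b (order_norm X D') \<le> b + k / lam * c s \<gamma> \<nu>"
      using b(1) k(1) lam c0 by (intro max.boundedI) (auto intro: add_increasing)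
    also have "\<dots> \<le> (k / lam + b) * (c s \<gamma> \<nu> + 1)"
      using b(1) k(1) lam c0 by (simp add: algebra_simps)
    finally show "u (L s \<gamma> \<nu>) \<le> (k / lam + b) * (c s \<gamma> \<nu> + 1)"
      unfolding u_def D'(2) excess_norm_lift .
  qed
  then show ?thesis
    unfolding c_def by blast
qed

text \<open>Without weight on the covariance the cost does not depend on the state, and the trivial relation
  with \<open>u = 0\<close> does. Then every information state counts as having a finite moment.\<close>

lemma transmission_mdp_exists:
  assumes p: "p \<in> {0..1}" and \<delta>: "\<delta> \<in> {0..1}" and \<eta>: "\<eta> \<in> {0..1}" and lam: "lam \<in> {0..1}"
    and J: "\<And>\<nu>. \<nu> \<in> {0,1} \<Longrightarrow> 0 \<le> J \<nu>"
  shows "\<exists>near u s0 r K K'. transmission_mdp (cov_space P_s) L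
    (\<lambda>s \<gamma> \<nu>. lam * trace (upper_left (L s \<gamma> \<nu>)) + (1 - lam) * J \<nu>) p \<delta> \<eta> near u s0 r K K'"
proof (cases "lam = 0")
  case True
  have "transmission_mdp (cov_space P_s) L (\<lambda>s \<gamma> \<nu>. J \<nu>) p \<delta> \<eta>
      (\<lambda>_ _ _. True) (\<lambda>_. 0) (lift_cov P_s P_s) 0 0 0"
  proof
    show "p \<in> {0..1}" "\<delta> \<in> {0..1}" "\<eta> \<in> {0..1}" by fact+
    show "lift_cov P_s P_s \<in> space (cov_space P_s)"
      using lift_cov_in [of 0 P_s] by (simp add: cov_space_def space_restrict_space)
  qed (simp_all only: J L_measurable borel_measurable_const, simp_all)
  then show ?thesis
    unfolding True by simp (intro exI, assumption)
next
  case False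
  then show ?thesis
    using transmission_mdp_instance [OF p \<delta> \<eta> _ _ J, of lam] lam by fastforce
qed

end

section \<open>Optimality of the average cost\<close>

lemma limsup_average_ge:
  assumes "\<And>T. real T * \<rho> \<le> S T + a"
  shows "ereal \<rho> \<le> limsup (\<lambda>T. ereal (1 / real T * S T))"
proof -
  have "(\<lambda>T. \<rho> - a / real T) \<longlonglongrightarrow> \<rho> - 0"
    by (intro tendsto_diff tendsto_const lim_const_over_n)
  then have "limsup (\<lambda>T. ereal (\<rho> - a / real T)) = ereal \<rho>"
    by (intro lim_imp_Limsup) auto
  moreover have "eventually (\<lambda>T. ereal (\<rho> - a / real T) \<le> ereal (1 / real T * S T)) sequentially"
    using eventually_gt_at_top [of 0]
  proof eventually_elim
    case (elim T)
    have "(real T * \<rho> - a) / real T \<le> S T / real T"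
      using assms [of T] by (intro divide_right_mono) auto
    then show ?case using elim by (simp add: diff_divide_distrib)
  qed
  ultimately show ?thesis
    using Limsup_mono by metis
qed

lemma limsup_average_le:
  assumes "\<And>T. S T \<le> real T * \<rho> + a"
  shows "limsup (\<lambda>T. ereal (1 / real T * S T)) \<le> ereal \<rho>"
proof -
  have "(\<lambda>T. \<rho> + a / real T) \<longlonglongrightarrow> \<rho> + 0"
    by (intro tendsto_add tendsto_const lim_const_over_n)
  then have "limsup (\<lambda>T. ereal (\<rho> + a / real T)) = ereal \<rho>"
    by (intro lim_imp_Limsup) auto
  moreover have "eventually (\<lambda>T. ereal (1 / real T * S T) \<le> ereal (\<rho> + a / real T)) sequentially"
    using eventually_gt_at_top [of 0]
  proof eventually_elim
    case (elim T)
    then show ?case using assms [of T] by (simp add: field_simps)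
  qed
  ultimately show ?thesis
    using Limsup_mono by metis
qed

lemma average_cost_stage:
  fixes L :: "real^('n::finite + 'n)^('n + 'n) \<Rightarrow> nat \<Rightarrow> nat \<Rightarrow> real^('n + 'n)^('n + 'n)"
  assumes mdp: "transmission_mdp (cov_space P_s) L
    (\<lambda>s \<gamma> \<nu>. lam * trace (upper_left (L s \<gamma> \<nu>)) + (1 - lam) * J \<nu>) p \<delta> \<eta> near u s0 r K K'"
    and M: "prob_space M" "iid_losses M p gam" "memoryless_acks M \<delta> \<eta> gam ghat"
  defines "tree \<equiv> \<lambda>g Px0 l. decision g Px0 (\<lambda>i. l ! i) (length l)"
  shows "average_cost M gam ghat L P_s lam J g Px0 = limsup (\<lambda>T. ereal (1 / real T * (\<Sum>k<T.
    transmission_mdp.stage L (\<lambda>s \<gamma> \<nu>. lam * trace (upper_left (L s \<gamma> \<nu>)) + (1 - lam) * J \<nu>) p \<delta> \<eta> k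
      (lift_cov P_s Px0) (tree g Px0))))"
proof -
  interpret mdp: transmission_mdp "cov_space P_s" L
    "\<lambda>s \<gamma> \<nu>. lam * trace (upper_left (L s \<gamma> \<nu>)) + (1 - lam) * J \<nu>" p \<delta> \<eta> near u s0 r K K'
    by (rule mdp)
  have dec: "decision g Px0 h = (\<lambda>i. tree g Px0 (map h [0..<i]))" for h
    unfolding tree_def by (rule ext) (rule decision_eq_tree)
  show ?thesis
    unfolding average_cost_def Let_def dec trajectory.simps(2)
    by (simp only: mdp.expected_stage_cost [OF M])
qed

theorem mainTheorem2:
  fixes A Sigma_w P_s Sigma_s Sigma_qx Sigma_qe :: "real^'n^'n"
    and C :: "real^'n^'m" and Sigma_v :: "real^'m^'m"
    and K_f K_s :: "real^'m^'n"
    and \<alpha>0 \<alpha>1 p \<delta> \<eta> lam :: real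
    and nb Eb J :: "nat \<Rightarrow> real"
    and CC :: "nat \<Rightarrow> real^('n + 'n)^'n" and R :: "nat \<Rightarrow> real^'n^'n"
    and L :: "real^('n + 'n)^('n + 'n) \<Rightarrow> nat \<Rightarrow> nat \<Rightarrow> real^('n + 'n)^('n + 'n)"
    and M :: "'w measure" and gam ghat :: "nat \<Rightarrow> 'w \<Rightarrow> nat"
  assumes "schur_stable A" and "detectable A C"
    and "psd Sigma_w" and "pos_def Sigma_v" and "psd P_s"
    and are: "P_s = A ** P_s ** transpose A + Sigma_w
           - A ** P_s ** transpose C ** matrix_inv (innov_cov C Sigma_v P_s) ** C ** P_s ** transpose A"
    and K_f: "K_f = P_s ** transpose C ** matrix_inv (innov_cov C Sigma_v P_s)"
    and K_s: "K_s = A ** K_f"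
    and Sigma_s: "Sigma_s = A ** Sigma_s ** transpose A + K_s ** innov_cov C Sigma_v P_s ** transpose K_s"
    and "0 \<le> \<alpha>0" and "0 \<le> \<alpha>1"
    and Sigma_qx: "Sigma_qx = \<alpha>1 *\<^sub>R (Sigma_s + K_f ** innov_cov C Sigma_v P_s ** transpose K_f)"
    and Sigma_qe: "Sigma_qe = \<alpha>0 *\<^sub>R (K_f ** innov_cov C Sigma_v P_s ** transpose K_f)"
    and "trace Sigma_qx = trace Sigma_qe"
    and CC: "CC = calC C K_f"
    and R: "R = noiseR Sigma_v K_f Sigma_qx Sigma_qe"
    and L: "L = riccati (calA A C K_s) CC (noiseQ Sigma_w Sigma_v K_s) (noiseS Sigma_v K_f K_s) R"
    and inverse_exists: "\<And>P \<nu>. P \<in> cov_set P_s \<Longrightarrow> \<nu> \<in> {0, 1} \<Longrightarrow>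
           invertible (CC \<nu> ** P ** transpose (CC \<nu>) + R \<nu>)"
    and "p \<in> {0..1}" and "\<delta> \<in> {0..1}" and "\<eta> \<in> {0..1}" and "lam \<in> {0..1}"
    and "0 \<le> nb 0" and "nb 0 \<le> nb 1" and "0 \<le> Eb 0" and "Eb 0 \<le> Eb 1"
    and J: "\<And>\<nu>. J \<nu> = nb \<nu> * Eb \<nu>"
    and "prob_space M" and "iid_losses M p gam" and "memoryless_acks M \<delta> \<eta> gam ghat"
  shows "\<exists>(\<rho>::real) (V :: (real^('n + 'n)^('n + 'n)) measure \<Rightarrow> real).
    (\<forall>Px0. psd (Px0 - P_s) \<longrightarrow>
       (\<exists>g\<in>policies. average_cost M gam ghat L P_s lam J g Px0 = ereal \<rho>) \<and>
       (\<forall>g\<in>policies. ereal \<rho> \<le> average_cost M gam ghat L P_s lam J g Px0)) \<and>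
    (\<forall>\<pi>\<in>info_states P_s. (\<exists>\<nu>\<in>{0, 1}. stage_cost L p lam J \<pi> \<nu> < \<infinity>) \<longrightarrow>
       ereal (\<rho> + V \<pi>) =
         (MIN \<nu>\<in>{0, 1}. enn2ereal (stage_cost L p lam J \<pi> \<nu>)
            + ereal (\<Sum>j\<in>{0, 1, 2}. ack_prob p \<delta> \<eta> j * V (info_update (cov_space P_s) L p \<delta> \<eta> \<pi> j \<nu>))))"
proof -
  define W where "W = innov_cov C Sigma_v P_s"
  define Z where "Z = K_f ** W ** transpose K_f"
  define X where "X = Sigma_s + Z"
  define F where "F = K_f ** C"
  define G where "G = K_f ** Sigma_v ** transpose K_f"
  let ?noise = "\<lambda>\<nu>::nat. if \<nu> = 1 then \<alpha>1 *\<^sub>R X else \<alpha>0 *\<^sub>R Z"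
  have P_s: "psd P_s" by fact
  have W: "pos_def W"
  proof -
    have "psd (C ** P_s ** transpose C)" by (rule psd_congruence [OF P_s])
    then show ?thesis
      unfolding W_def innov_cov_def
      by (subst add.commute) (rule pos_def_add_psd [OF \<open>pos_def Sigma_v\<close>])
  qed
  note invW = pos_def_imp_invertible [OF W]
  have KW: "K_f ** W = P_s ** transpose C"
    unfolding K_f W_def [symmetric] by (simp add: matrix_mul_assoc [symmetric] matrix_inv_inverse [OF invW])
  have KW': "X ** K_f ** W = X ** P_s ** transpose C" for X :: "real^'n^'n"
    by (simp only: matrix_mul_assoc [symmetric] KW)
  have WK: "W ** transpose K_f = C ** P_s"
    using arg_cong [OF KW, of transpose]
    by (simp add: matrix_transpose_mul pos_defD(1) [OF W] psdD(1) [OF P_s])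
  have F1: "F ** P_s = Z"
    unfolding F_def Z_def by (simp only: matrix_mul_assoc [symmetric] WK)
  have F2: "P_s ** transpose F = Z"
    unfolding F_def Z_def by (simp only: KW matrix_transpose_mul matrix_mul_assoc)
  have psdZ: "psd Z"
    unfolding Z_def by (rule psd_congruence [OF pos_def_imp_psd [OF W]])
  have ZG: "Z ** transpose F + G = Z"
  proof -
    have "Z ** transpose F + G = K_f ** C ** P_s ** transpose C ** transpose K_f + K_f ** Sigma_v ** transpose K_f"
      unfolding F1 [symmetric] G_def by (simp only: F_def matrix_transpose_mul matrix_mul_assoc)
    also have "\<dots> = Z"
      unfolding Z_def W_def innov_cov_def by (simp add: matrix_algebra)
    finally show ?thesis .
  qed
  have are': "A ** P_s ** transpose A + Sigma_w = P_s + A ** Z ** transpose A"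
  proof -
    have "A ** P_s ** transpose C ** matrix_inv W ** C ** P_s ** transpose A = A ** (F ** P_s) ** transpose A"
      unfolding F_def K_f W_def [symmetric] by (simp only: matrix_mul_assoc)
    then show ?thesis
      using are unfolding W_def [symmetric] F1 by (simp add: eq_diff_eq)
  qed
  have X: "X = A ** X ** transpose A + Z"
  proof -
    have "K_s ** W ** transpose K_s = A ** Z ** transpose A"
      unfolding K_s Z_def by (simp only: matrix_transpose_mul matrix_mul_assoc)
    then show ?thesis
      using Sigma_s unfolding W_def [symmetric] X_def by (simp add: matrix_algebra)
  qed
  have R': "R \<nu> = G + ?noise \<nu>" if "\<nu> \<in> {0,1}" for \<nu>
    using that Sigma_qx Sigma_qe
    unfolding R noiseR_def W_def [symmetric] Z_def [symmetric] G_def [symmetric] X_def by auto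
  have lift: "CC \<nu> ** lift_cov P_s (P_s + D) ** transpose (CC \<nu>) + R \<nu> = (Z + real \<nu> *\<^sub>R D) + ?noise \<nu>"
    "L (lift_cov P_s (P_s + D)) \<gamma> \<nu> = lift_cov P_s (P_s + A ** filtered Z (if \<nu> = 1 then \<alpha>1 *\<^sub>R X else \<alpha>0 *\<^sub>R Z) \<gamma> \<nu> D ** transpose A)"
    if D: "psd D" and \<nu>: "\<nu> \<in> {0,1}" for D \<gamma> \<nu>
  proof -
    have blocks: "calA A C K_s = block_mat A 0 (A ** F) (A - A ** F)"
      "CC = (\<lambda>\<nu>. block_row F (real \<nu> *\<^sub>R mat 1 - F))"
      "noiseQ Sigma_w Sigma_v K_s = block_mat Sigma_w 0 0 (A ** G ** transpose A)"
      "noiseS Sigma_v K_f K_s = block_col 0 (A ** G)"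
      unfolding CC calA_def calC_def noiseQ_def noiseS_def K_s F_def G_def
      by (simp_all only: matrix_transpose_mul matrix_mul_assoc fun_eq_iff calC_def simp_thms)
    note ric = riccati_lift [where R = R and \<nu> = \<nu> and N = "?noise \<nu>", OF F1 F2 ZG psdD(1) [OF psdZ] psdD(1) [OF D] are' \<nu> blocks R' [OF \<nu>]]
    show "CC \<nu> ** lift_cov P_s (P_s + D) ** transpose (CC \<nu>) + R \<nu> = (Z + real \<nu> *\<^sub>R D) + ?noise \<nu>"
      by (rule ric(1))
    show "L (lift_cov P_s (P_s + D)) \<gamma> \<nu> = lift_cov P_s (P_s + A ** filtered Z (if \<nu> = 1 then \<alpha>1 *\<^sub>R X else \<alpha>0 *\<^sub>R Z) \<gamma> \<nu> D ** transpose A)"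
      unfolding L by (rule ric(2))
  qed
  \<comment> \<open>Invertibility for \<open>\<nu> = 0\<close>, where the innovation covariance is \<open>(1 + \<alpha>0) Z\<close>, makes \<open>Z\<close> definite.\<close>
  have Z: "pos_def Z"
  proof (rule psd_invertible_imp_pos_def [OF psdZ])
    have "invertible (CC 0 ** lift_cov P_s (P_s + 0) ** transpose (CC 0) + R 0)"
      by (intro inverse_exists lift_cov_in psd_zero) simp
    then have "invertible ((1 + \<alpha>0) *\<^sub>R Z)"
      unfolding lift(1) [OF psd_zero insertI1] by (simp add: scaleR_add_left)
    then have "invertible ((1 / (1 + \<alpha>0)) *\<^sub>R ((1 + \<alpha>0) *\<^sub>R Z))"
      by (rule scalar_invertible [rotated]) (use \<open>0 \<le> \<alpha>0\<close> in simp)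
    moreover have "(1 / (1 + \<alpha>0)) *\<^sub>R ((1 + \<alpha>0) *\<^sub>R Z) = Z"
      using \<open>0 \<le> \<alpha>0\<close> by simp
    ultimately show "invertible Z" by (simp only:)
  qed
  interpret lifted_riccati A P_s Z X \<alpha>0 \<alpha>1 L
  proof
    show "continuous_on (cov_set P_s) (\<lambda>P. L P \<gamma> \<nu>)" if "\<nu> \<in> {0,1}" for \<gamma> \<nu>
      unfolding L by (intro continuous_on_riccati inverse_exists that)
    show "L (lift_cov P_s (P_s + D)) \<gamma> \<nu> =
        lift_cov P_s (P_s + A ** filtered Z (?noise \<nu>) \<gamma> \<nu> D ** transpose A)"
      if "psd D" "\<nu> \<in> {0,1}" for D \<gamma> \<nu>
      by (rule lift(2) [OF that])
  qed (fact P_s \<open>schur_stable A\<close> Z X \<open>0 \<le> \<alpha>0\<close> \<open>0 \<le> \<alpha>1\<close>)+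
  have J0: "0 \<le> J \<nu>" if "\<nu> \<in> {0,1}" for \<nu>
  proof -
    have "0 \<le> nb \<nu>" "0 \<le> Eb \<nu>"
      using that \<open>0 \<le> nb 0\<close> \<open>nb 0 \<le> nb 1\<close> \<open>0 \<le> Eb 0\<close> \<open>Eb 0 \<le> Eb 1\<close> by auto
    then show ?thesis unfolding J by simp
  qed
  obtain near u s0 r K K' where mdp: "transmission_mdp (cov_space P_s) L
    (\<lambda>s \<gamma> \<nu>. lam * trace (upper_left (L s \<gamma> \<nu>)) + (1 - lam) * J \<nu>) p \<delta> \<eta> near u s0 r K K'"
  proof -
    have "\<exists>near u s0 r K K'. transmission_mdp (cov_space P_s) L
      (\<lambda>s \<gamma> \<nu>. lam * trace (upper_left (L s \<gamma> \<nu>)) + (1 - lam) * J \<nu>) p \<delta> \<eta> near u s0 r K K'"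
      by (rule transmission_mdp_exists) (fact | rule J0)+
    then show ?thesis
      by (elim exE) (rule that)
  qed
  interpret mdp: transmission_mdp "cov_space P_s" L
    "\<lambda>s \<gamma> \<nu>. lam * trace (upper_left (L s \<gamma> \<nu>)) + (1 - lam) * J \<nu>" p \<delta> \<eta> near u s0 r K K'
    by (rule mdp)
  note average = average_cost_stage [OF mdp \<open>prob_space M\<close> \<open>iid_losses M p gam\<close> \<open>memoryless_acks M \<delta> \<eta> gam ghat\<close>]
  have cost: "stage_cost L p lam J \<pi> \<nu> = mdp.extended_cost \<pi> \<nu>" for \<pi> \<nu>
    unfolding stage_cost_def mdp.extended_cost_def ..
  obtain \<rho> V a where
    upper: "\<And>s. s \<in> space (cov_space P_s) \<Longrightarrow> \<exists>g\<in>mdp.trees. \<forall>T. (\<Sum>k<T. mdp.stage k s g) \<le> real T * \<rho> + a * u s"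
    and lower: "\<And>s g T. s \<in> space (cov_space P_s) \<Longrightarrow> g \<in> mdp.trees \<Longrightarrow> real T * \<rho> \<le> (\<Sum>k<T. mdp.stage k s g) + a * u s"
    and bellman: "\<forall>\<pi>\<in>info_states P_s. (\<exists>\<nu>\<in>{0, 1}. stage_cost L p lam J \<pi> \<nu> < \<infinity>) \<longrightarrow>
       ereal (\<rho> + V \<pi>) =
         (MIN \<nu>\<in>{0, 1}. enn2ereal (stage_cost L p lam J \<pi> \<nu>)
            + ereal (\<Sum>j\<in>{0, 1, 2}. ack_prob p \<delta> \<eta> j * V (info_update (cov_space P_s) L p \<delta> \<eta> \<pi> j \<nu>)))"
    using mdp.average_cost_optimality unfolding cost info_states_def by blast
  have "(\<exists>g\<in>policies. average_cost M gam ghat L P_s lam J g Px0 = ereal \<rho>) \<and>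
      (\<forall>g\<in>policies. ereal \<rho> \<le> average_cost M gam ghat L P_s lam J g Px0)" if Px0: "psd (Px0 - P_s)" for Px0
  proof -
    let ?s = "lift_cov P_s Px0"
    have s: "?s \<in> space (cov_space P_s)"
      using Px0 unfolding cov_space_def cov_set_def by (auto simp: space_restrict_space)
    have ge: "ereal \<rho> \<le> average_cost M gam ghat L P_s lam J g Px0" if g: "g \<in> policies" for g
      unfolding average
    proof (rule limsup_average_ge, rule lower [OF s])
      show "(\<lambda>l. decision g Px0 (\<lambda>i. l ! i) (length l)) \<in> mdp.trees"
        unfolding mdp.trees_def using decision_in [OF g] by blast
    qed
    obtain t where t: "t \<in> mdp.trees" "\<And>T. (\<Sum>k<T. mdp.stage k ?s t) \<le> real T * \<rho> + a * u ?s"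
      using upper [OF s] by blast
    define g :: "'n policy" where "g = (\<lambda>acks nus P. t acks)"
    have g: "g \<in> policies"
      using t(1) unfolding policies_def mdp.trees_def g_def by blast
    have tree: "(\<lambda>l. decision g Px0 (\<lambda>i. l ! i) (length l)) = t"
      unfolding decision_def g_def by (simp add: map_nth)
    have "average_cost M gam ghat L P_s lam J g Px0 \<le> ereal \<rho>"
      unfolding average tree by (rule limsup_average_le) (rule t(2))
    with ge [OF g] g ge show ?thesis
      by (meson antisym)
  qed
  with bellman show ?thesis
    by blast
qed

end
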